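(* Let $J$ be the semi-infinite Jacobi matrix with real diagonal sequence $\lambda=\{\lambda_n\}_{n=0}^\infty$ and positive off-diagonal sequence $w=\{w_n\}_{n=0}^\infty$, and assume that $\operatorname{der}(\lambda)$ is composed of isolated points only. Suppose there exists $z_0\in\mathbb{C}$ such that $$\sum_{n=0}^{\infty}\frac{w_n^{2}}{|(\lambda_n-z_0)(\lambda_{n+1}-z_0)|}<\infty .$$ Then the orthogonality relation for the sequence of orthogonal polynomials $\{P_n\}_{n=0}^\infty$ determined by $P_0(x)=1$, $P_1(x)=(x-\lambda_0)/w_0$ and $xP_n(x)=w_{n-1}P_{n-1}(x)+\lambda_nP_n(x)+w_nP_{n+1}(x)$ for $n\in\mathbb{N}$ reads $$\int_{\mathbb{R}}P_m(x)P_n(x)\,d\nu(x)+\sum_{x\in\mathcal{D}}\frac{P_m(x)P_n(x)}{\|P(x)\|^{2}}=\delta_{mn},\qquad m,n\in\mathbb{Z}_+,$$ where $\mathcal{D}=\operatorname{spec}_p(J)\cap\operatorname{der}(\lambda)$ and $\|P(x)\|$ is the $\ell^2$-norm of the vector $P(x)=(P_0(x),P_1(x),\dots)$. The measure $d\nu$ is positive, purely discrete and supported on the set $\mathfrak{Z}(J)$. The magnitude of the jump of the step function $\nu(x)$ at those points $x\in\mathfrak{Z}(J)$ which do not belong to the range of $\lambda$ equals $$\nu(x)-\nu(x-0)=\frac{1}{x-\lambda_0}\,\mathfrak{F}\!\left(\left\{\frac{\gamma_{k+1}^{2}}{\lambda_{k+1}-x}\right\}_{k=0}^{\infty}\ri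ght)\left[\frac{d}{dx}\,\mathfrak{F}\!\left(\left\{\frac{\gamma_k^{2}}{\lambda_k-x}\right\}_{k=0}^{\infty}\right)\right]^{-1}.$$
   Context: $\mathbb{Z}_+=\{0,1,2,\dots\}$. The function $\mathfrak{F}$ is defined on $D=\{\{x_k\}_{k=1}^\infty\subset\mathbb{C}:\ \sum_{k\ge1}|x_kx_{k+1}|<\infty\}$ by $$\mathfrak{F}(x)=1+\sum_{m=1}^{\infty}(-1)^m\sum_{k_1=1}^{\infty}\sum_{k_2=k_1+2}^{\infty}\cdots\sum_{k_m=k_{m-1}+2}^{\infty}x_{k_1}x_{k_1+1}x_{k_2}x_{k_2+1}\cdots x_{k_m}x_{k_m+1}$$ (for a sequence indexed from $0$ the indices are simply shifted). $J$ is the symmetric tridiagonal matrix, indexed by $\mathbb{Z}_+$, with diagonal entries $\lambda_0,\lambda_1,\dots$ and entries $w_0,w_1,\dots$ immediately above and below the diagonal. Under the summability condition in the claim (which in particular requires $\lambda_n\ne z_0$ for all $n$), $J$ represents a unique self-adjoint operator on $\ell^2(\mathbb{Z}_+)$ (exactly one self-adjoint operator has the canonical basis in its domain and matrix $J$ in that basis), denoted again $J$; $\operatorname{spec}_p(J)$ is its set of eigenvalues. $\operatorname{der}(\lambda)$ is the set of all finite cluster points of $\lambda$, i.e. limits of all convergent subsequences of $\lambda$. The sequence $\{\gamma_n\}$ is given by $\gamma_0=1$, $\gamma_{k+1}=w_k/\gamma_k$ for $k\in\mathbb{Z}_+$. The characteristic function of $J$ is $\mathcal{F}_J(z)=\mathfrak{F}\big(\{\gamma_n^2/(\lambda_n-z)\}_{n=0}^\infty\big)$,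 which is meromorphic on $\mathbb{C}\setminus\operatorname{der}(\lambda)$. Put $$\mathfrak{Z}(J)=\Big\{z\in\mathbb{C}\setminus\operatorname{der}(\lambda):\ \lim_{u\to z}(u-z)^{r(z)}\mathcal{F}_J(u)=0\Big\},$$ where $r(z)=\sum_{k=0}^\infty\delta_{z,\lambda_k}$ is the number of occurrences of $z$ in the sequence $\lambda$. The symbol $\nu$ denotes both the measure and its right-continuous distribution function $\nu(x)=\nu((-\infty,x])$. *)

theory Defs
  imports "HOL-Analysis.Analysis" "HOL-Probability.Distribution_Functions"
begin

section \<open>The function \<open>\<FF>\<close>\<close>

(* gap_sum x m j is the iterated sum over k_1 >= j, k_2 >= k_1 + 2, ..., k_m >= k_(m-1) + 2 of
   the products x k_1 * x (k_1 + 1) * ... * x k_m * x (k_m + 1). *)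
primrec gap_sum :: "(nat \<Rightarrow> complex) \<Rightarrow> nat \<Rightarrow> nat \<Rightarrow> complex" where
  "gap_sum x 0 j = 1"
| "gap_sum x (Suc m) j = (\<Sum>k. x (j + k) * x (j + k + 1) * gap_sum x m (j + k + 2))"

(* Sequences are indexed from 0.  Meaningful (all series converge absolutely) whenever
   the series of cmod (x k * x (k + 1)) converges; unspecified otherwise. *)
definition frakF :: "(nat \<Rightarrow> complex) \<Rightarrow> complex" where
  "frakF x = 1 + (\<Sum>m. (-1) ^ (m + 1) * gap_sum x (m + 1) 0)"


section \<open>The Hilbert space of square summable sequences and its unbounded operators\<close>

definition l2 :: "(nat \<Rightarrow> complex) set" where
  "l2 = {f. summable (\<lambda>n. (cmod (f n))\<^sup>2)}"

definition l2_inner :: "(nat \<Rightarrow> complex) \<Rightarrow> (nat \<Rightarrow> complex) \<Rightarrow> complex" where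
  "l2_inner f g = (\<Sum>n. cnj (f n) * g n)"

definition l2_norm :: "(nat \<Rightarrow> 'a::real_normed_vector) \<Rightarrow> real" where
  "l2_norm f = sqrt (\<Sum>n. (norm (f n))\<^sup>2)"

definition unit_seq :: "nat \<Rightarrow> nat \<Rightarrow> complex" where
  "unit_seq n = (\<lambda>k. if k = n then 1 else 0)"

(* Operators are represented by their graphs: the domain of T is Domain T,
   and (f, g) \<in> T says that f is in the domain and T f = g. *)
type_synonym l2_graph = "((nat \<Rightarrow> complex) \<times> (nat \<Rightarrow> complex)) set"

definition linear_operator :: "l2_graph \<Rightarrow> bool" where
  "linear_operator T \<longleftrightarrow>
     T \<subseteq> l2 \<times> l2 \<and> single_valued T \<and> ((\<lambda>n. 0), (\<lambda>n. 0)) \<in> T \<and>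
     (\<forall>f f' g g' a b. (f, f') \<in> T \<longrightarrow> (g, g') \<in> T \<longrightarrow>
        ((\<lambda>n. a * f n + b * g n), (\<lambda>n. a * f' n + b * g' n)) \<in> T)"

definition densely_defined :: "l2_graph \<Rightarrow> bool" where
  "densely_defined T \<longleftrightarrow>
     (\<forall>f\<in>l2. \<forall>\<epsilon>>0. \<exists>g\<in>Domain T. l2_norm (\<lambda>n. f n - g n) < \<epsilon>)"

definition operator_adjoint :: "l2_graph \<Rightarrow> l2_graph" where
  "operator_adjoint T =
     {(g, h). g \<in> l2 \<and> h \<in> l2 \<and> (\<forall>(f, f')\<in>T. l2_inner g f' = l2_inner h f)}"

definition self_adjoint :: "l2_graph \<Rightarrow> bool" where
  "self_adjoint T \<longleftrightarrow> linear_operator T \<and> densely_defined T \<and> operator_adjoint T = T"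

definition represents_matrix :: "l2_graph \<Rightarrow> (nat \<Rightarrow> nat \<Rightarrow> complex) \<Rightarrow> bool" where
  "represents_matrix T A \<longleftrightarrow>
     (\<forall>n. \<exists>g. (unit_seq n, g) \<in> T \<and> (\<forall>m. l2_inner (unit_seq m) g = A m n))"

definition point_spectrum :: "l2_graph \<Rightarrow> complex set" where
  "point_spectrum T = {z. \<exists>f. f \<noteq> (\<lambda>n. 0) \<and> (f, (\<lambda>n. z * f n)) \<in> T}"


section \<open>Jacobi matrices\<close>

definition jacobi_matrix :: "(nat \<Rightarrow> real) \<Rightarrow> (nat \<Rightarrow> real) \<Rightarrow> nat \<Rightarrow> nat \<Rightarrow> complex" where
  "jacobi_matrix lam w m n =
     (if m = n then of_real (lam n)
      else if m = n + 1 then of_real (w n)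
      else if n = m + 1 then of_real (w m)
      else 0)"

(* Unspecified unless exactly one self-adjoint operator has the given matrix.  Under the
   summability condition uniqueness can only fail when the diagonal has no finite cluster point. *)
definition jacobi_operator :: "(nat \<Rightarrow> real) \<Rightarrow> (nat \<Rightarrow> real) \<Rightarrow> l2_graph" where
  "jacobi_operator lam w =
     (THE T. self_adjoint T \<and> represents_matrix T (jacobi_matrix lam w))"

(* Cluster points of the sequence, not of its range: a value attained infinitely often counts. *)
definition der :: "(nat \<Rightarrow> real) \<Rightarrow> real set" where
  "der lam = {l. \<exists>s. strict_mono s \<and> (lam \<circ> s) \<longlonglongrightarrow> l}"

primrec gam :: "(nat \<Rightarrow> real) \<Rightarrow> nat \<Rightarrow> real" where
  "gam w 0 = 1"
| "gam w (Suc k) = w k / gam w k"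

definition char_fun :: "(nat \<Rightarrow> real) \<Rightarrow> (nat \<Rightarrow> real) \<Rightarrow> complex \<Rightarrow> complex" where
  "char_fun lam w z = frakF (\<lambda>n. of_real ((gam w n)\<^sup>2) / (of_real (lam n) - z))"

definition occurrences :: "(nat \<Rightarrow> real) \<Rightarrow> complex \<Rightarrow> nat" where
  "occurrences lam z = card {k. complex_of_real (lam k) = z}"

(* A point outside der has a punctured neighbourhood free of values of the diagonal, so the
   limit only involves points at which the formula for char_fun is meaningful. *)
definition frakZ :: "(nat \<Rightarrow> real) \<Rightarrow> (nat \<Rightarrow> real) \<Rightarrow> complex set" where
  "frakZ lam w =
     {z. z \<notin> complex_of_real ` der lam \<and>
         ((\<lambda>u. (u - z) ^ occurrences lam z * char_fun lam w u) \<longlongrightarrow> 0) (at z)}"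


section \<open>Discrete measures\<close>

definition purely_discrete :: "real measure \<Rightarrow> bool" where
  "purely_discrete M \<longleftrightarrow> (\<exists>S. countable S \<and> (AE x in M. x \<in> S))"

(* For a purely discrete measure, the set on which it is supported. *)
definition atoms :: "real measure \<Rightarrow> real set" where
  "atoms M = {x. measure M {x} > 0}"

end

theory Submission
  imports Defs "HOL-Complex_Analysis.Complex_Analysis" "HOL-Probability.Helly_Selection"
    "HOL-Computational_Algebra.Fundamental_Theorem_Algebra"
begin

text \<open>The eigenvalue measures of the truncated Jacobi matrices (Gauss quadrature) have bounded moments,
  so a subsequence converges weakly to a measure \<open>\<mu>\<close> for which the \<open>P n\<close> are orthonormal.  Their Cauchy
  transforms are quotients of second and first kind polynomials, so Markov's argument identifies the
  Cauchy transform of \<open>\<mu>\<close> off the real line as \<open>F z 1 / ((lam 0 - z) * F z 0)\<close>, where \<open>F z j\<close> is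
  \<open>\<FF>\<close> of the sequence shifted by \<open>j\<close>.  Near a point outside \<open>der lam\<close> this quotient extends
  meromorphically: \<open>\<mu>\<close> vanishes near regular points, and the residues at the poles give the jumps.

  If \<open>der lam\<close> is empty, \<open>\<nu> = \<mu>\<close>.  Otherwise the maximal operator of \<open>J\<close> is self-adjoint, and
  pairing eigenvectors with resolvent vectors shows that \<open>\<mu> {x} = 1 / \<parallel>P(x)\<parallel>\<^sup>2\<close> for eigenvalues \<open>x\<close>
  and \<open>\<mu> {x} = 0\<close> otherwise; since \<open>der lam\<close> is countable, restricting \<open>\<mu>\<close> to its complement gives
  \<open>\<nu>\<close>.\<close>

section \<open>The function \<open>\<FF>\<close>\<close>

text \<open>Convergence of \<FF> is controlled only away from \<open>der lam\<close>, hence the two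
  unrelated ways of computing atoms: residues off \<open>der lam\<close>, the operator on it.
  Quadrature supplies the measure even if \<open>der lam\<close> is empty, when the matrix may have
  several self-adjoint realisations; the sum over eigenvalues is then empty. The obstacle in the
  analytic half is that \<FF> itself has poles at diagonal entries, possibly of higher order.
  Clearing denominators gives a pair \<open>G N 0\<close>, \<open>G N 1\<close> holomorphic near a
  given point. The pair has no common zero, because a solution of the three-term recurrence with two
  adjacent zeros vanishes from there on, whereas \<FF> of the tails tends to 1. So a zero of
  \<open>G N 0\<close> is always a true pole, and positivity of the measure makes it simple. In the
  operator half the point is that the maximal operator is symmetric: the boundary term in Green's
  formula must vanish at infinity, which needs decay of square summable sequences weighted by the
  diagonal. Isolation of the cluster points enters through countability: on a countable set the
  measure is the sum of its atoms.\<close>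

lemma power_Suc_increment:
  fixes a b :: real
  assumes "0 \<le> a" "0 \<le> b"
  shows "real (Suc m) * b * a ^ m \<le> (a + b) ^ Suc m - a ^ Suc m"
proof (induction m)
  case (Suc m)
  have "a * (real (Suc m) * b * a ^ m) \<le> a * ((a + b) ^ Suc m - a ^ Suc m)"
    by (rule mult_left_mono[OF Suc.IH assms(1)])
  moreover have "b * a ^ Suc m \<le> b * (a + b) ^ Suc m"
    using assms by (intro mult_left_mono power_mono) auto
  ultimately show ?case
    by (simp add: algebra_simps)
qed simp

definition tail_sum :: "(nat \<Rightarrow> real) \<Rightarrow> nat \<Rightarrow> real" where
  "tail_sum b j = (\<Sum>k. b (k + j))"

lemma tail_sum_Suc:
  assumes "summable b"
  shows "tail_sum b j = b j + tail_sum b (Suc j)"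
  using suminf_split_head[OF summable_ignore_initial_segment[OF assms, of j]]
  by (simp add: tail_sum_def)

lemma tail_sum_nonneg:
  assumes "summable b" "\<And>k. 0 \<le> b k"
  shows "0 \<le> tail_sum b j"
  unfolding tail_sum_def using assms by (intro suminf_nonneg summable_ignore_initial_segment) auto

lemma tail_sum_tendsto_0:
  assumes "summable b"
  shows "tail_sum b \<longlonglongrightarrow> 0"
  using suminf_exist_split2[OF assms] by (simp add: tail_sum_def[abs_def])

lemma tail_sum_antimono:
  assumes "summable b" "\<And>k. 0 \<le> b k" "i \<le> j"
  shows "tail_sum b j \<le> tail_sum b i"
  using assms(3)
proof (induction j rule: dec_induct)
  case (step n)
  then show ?case using tail_sum_Suc[OF assms(1), of n] assms(2)[of n] by linarith
qed simp

text \<open>As for elementary symmetric functions, choosing m increasing indices costs at most the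
  m-th power of the tail divided by m!. The induction obtains this by telescoping, with
  \<open>power_Suc_increment\<close> as a mean value inequality for the power. Summability comes
  along in the same induction, since the bound on \<open>suminf\<close> rests on it.\<close>

lemma gap_sum_bound:
  assumes xb: "\<And>k. cmod (x k * x (k + 1)) \<le> b k" and b: "summable b"
  shows "cmod (gap_sum x m j) \<le> tail_sum b j ^ m / fact m"
    and "summable (\<lambda>k. cmod (x (j + k) * x (j + k + 1) * gap_sum x m (j + k + 2)))"
proof -
  have b0: "0 \<le> b k" for k using norm_ge_zero xb order_trans by blast
  note s0 = tail_sum_nonneg[OF b b0]
  have step: "cmod (gap_sum x (Suc m) j) \<le> tail_sum b j ^ Suc m / fact (Suc m)
      \<and> summable (\<lambda>k. cmod (x (j + k) * x (j + k + 1) * gap_sum x m (j + k + 2)))"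
    if IH: "\<And>j. cmod (gap_sum x m j) \<le> tail_sum b j ^ m / fact m" for m j
  proof -
    \<comment> \<open>\<open>t k\<close> is the bound claimed for the tail starting at
      \<open>j + k\<close>; each term of the outer sum is at most its decrement.\<close>
    define t where "t k = tail_sum b (j + k) ^ Suc m / fact (Suc m)" for k
    have "(\<lambda>k. tail_sum b (j + k)) \<longlonglongrightarrow> 0"
      using LIMSEQ_ignore_initial_segment[OF tail_sum_tendsto_0[OF b], of j] by (simp add: add.commute)
    from tendsto_power[OF this, of "Suc m"] have "(\<lambda>k. tail_sum b (j + k) ^ Suc m) \<longlonglongrightarrow> 0" by simp
    hence "t \<longlonglongrightarrow> 0"
      using tendsto_divide_zero unfolding t_def by blast
    from telescope_sums'[OF this] have tele: "(\<lambda>k. t k - t (Suc k)) sums t 0" by simp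
    have le: "cmod (x (j + k) * x (j + k + 1) * gap_sum x m (j + k + 2)) \<le> t k - t (Suc k)" for k
    proof -
      have "cmod (x (j + k) * x (j + k + 1)) * cmod (gap_sum x m (j + k + 2))
          \<le> b (j + k) * (tail_sum b (j + k + 1) ^ m / fact m)"
        using IH[of "j + k + 2"] tail_sum_antimono[OF b b0, of "j + k + 1" "j + k + 2"] s0
        by (intro mult_mono xb order_trans[OF IH] divide_right_mono power_mono b0) auto
      also have "\<dots> = (real (Suc m) * b (j + k) * tail_sum b (j + k + 1) ^ m) / fact (Suc m)"
        by (simp add: field_simps del: of_nat_Suc)
      also have "\<dots> \<le> ((tail_sum b (j + k + 1) + b (j + k)) ^ Suc m - tail_sum b (j + k + 1) ^ Suc m) / fact (Suc m)"
        by (intro divide_right_mono power_Suc_increment s0 b0) auto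
      also have "\<dots> = t k - t (Suc k)"
        using tail_sum_Suc[OF b, of "j + k"] by (simp add: t_def diff_divide_distrib add.commute)
      finally show ?thesis by (simp add: norm_mult)
    qed
    have "cmod (gap_sum x (Suc m) j) \<le> (\<Sum>k. t k - t (Suc k))"
      unfolding gap_sum.simps using le tele by (intro norm_suminf_le) (auto simp: sums_iff)
    moreover have "summable (\<lambda>k. cmod (x (j + k) * x (j + k + 1) * gap_sum x m (j + k + 2)))"
      by (rule summable_comparison_test'[OF sums_summable[OF tele], of 0])
         (simp only: real_norm_def abs_norm_cancel le)
    ultimately show ?thesis using tele by (simp add: sums_iff t_def)
  qed
  have main: "cmod (gap_sum x m j) \<le> tail_sum b j ^ m / fact m" for m j
  proof (induction m arbitrary: j)
    case (Suc m)
    from conjunct1[OF step[OF Suc.IH]] show ?case .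
  qed simp
  show "cmod (gap_sum x m j) \<le> tail_sum b j ^ m / fact m"
    by (rule main)
  show "summable (\<lambda>k. cmod (x (j + k) * x (j + k + 1) * gap_sum x m (j + k + 2)))"
    by (rule conjunct2[OF step[OF main]])
qed

text \<open>Starting the series at \<open>m = 0\<close> absorbs the leading 1 of
  \<open>frakF\<close>; moving the starting index instead of the sequence exposes the recurrence in
  \<open>j\<close>.\<close>

definition tailF :: "(nat \<Rightarrow> complex) \<Rightarrow> nat \<Rightarrow> complex" where
  "tailF x j = (\<Sum>m. (-1) ^ m * gap_sum x m j)"

lemma gap_sum_shift: "gap_sum (\<lambda>k. x (k + i)) m j = gap_sum x m (j + i)"
  by (induction m arbitrary: j) (simp_all add: ac_simps)

context
  fixes x :: "nat \<Rightarrow> complex" and b :: "nat \<Rightarrow> real"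
  assumes xb: "\<And>k. cmod (x k * x (k + 1)) \<le> b k" and b: "summable b"
begin

lemma summable_gap_sum: "summable (\<lambda>m. (-1) ^ m * gap_sum x m j)"
proof (rule summable_comparison_test')
  show "summable (\<lambda>m. tail_sum b j ^ m / fact m)"
    using summable_exp[of "tail_sum b j"] by (simp add: divide_inverse mult.commute)
  show "norm ((-1) ^ m * gap_sum x m j) \<le> tail_sum b j ^ m / fact m" for m
    using gap_sum_bound(1)[OF xb b, of m j] by (simp add: norm_mult norm_power)
qed

lemma frakF_shift: "frakF (\<lambda>k. x (k + j)) = tailF x j"
  unfolding frakF_def tailF_def gap_sum_shift
  using suminf_split_head[OF summable_gap_sum, of j] by simp

lemma frakF_eq_tailF: "frakF x = tailF x 0"
  using frakF_shift[of 0] by simp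

lemma tailF_bound: "cmod (tailF x j - 1) \<le> exp (tail_sum b j) - 1"
proof -
  have e: "(\<lambda>m. tail_sum b j ^ Suc m / fact (Suc m)) sums (exp (tail_sum b j) - 1)"
    using exp_converges[of "tail_sum b j"] sums_Suc_iff[of "\<lambda>m. tail_sum b j ^ m / fact m"]
    by (simp add: field_simps)
  have "tailF x j - 1 = (\<Sum>m. (-1) ^ Suc m * gap_sum x (Suc m) j)"
    unfolding tailF_def using suminf_split_head[OF summable_gap_sum, of j] by simp
  also have "cmod \<dots> \<le> (\<Sum>m. tail_sum b j ^ Suc m / fact (Suc m))"
  proof (rule norm_suminf_le)
    show "cmod ((-1) ^ Suc m * gap_sum x (Suc m) j) \<le> tail_sum b j ^ Suc m / fact (Suc m)" for m
      using gap_sum_bound(1)[OF xb b, of "Suc m" j] by (simp only: norm_mult norm_power) simp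
  qed (use e in \<open>simp add: sums_iff\<close>)
  finally show ?thesis using e by (simp add: sums_iff)
qed

lemma tailF_tendsto_1: "tailF x \<longlonglongrightarrow> 1"
proof -
  have "(\<lambda>j. exp (tail_sum b j) - 1) \<longlonglongrightarrow> 0"
    using tendsto_diff[OF tendsto_exp[OF tail_sum_tendsto_0[OF b]] tendsto_const[of 1]] by simp
  hence "(\<lambda>j. tailF x j - 1) \<longlonglongrightarrow> 0"
    by (rule Lim_null_comparison[rotated]) (simp add: tailF_bound)
  thus ?thesis by (simp add: LIM_zero_iff)
qed

text \<open>Either the smallest index of a product is \<open>j\<close>, and the others start at
  \<open>j + 2\<close>, or all indices start at \<open>j + 1\<close>.\<close>

lemma tailF_rec: "tailF x j = tailF x (j + 1) - x j * x (j + 1) * tailF x (j + 2)"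
proof -
  have gs: "gap_sum x (Suc m) j = x j * x (j + 1) * gap_sum x m (j + 2) + gap_sum x (Suc m) (j + 1)" for m
    using suminf_split_head[OF summable_norm_cancel[OF gap_sum_bound(2)[OF xb b, of j m]]] by simp
  have "tailF x j = 1 + (\<Sum>m. (-1) ^ Suc m * gap_sum x (Suc m) j)"
    unfolding tailF_def using suminf_split_head[OF summable_gap_sum, of j] by simp
  also have "(\<lambda>m. (-1) ^ Suc m * gap_sum x (Suc m) j) =
      (\<lambda>m. (-1) ^ Suc m * gap_sum x (Suc m) (j + 1) - x j * x (j + 1) * ((-1) ^ m * gap_sum x m (j + 2)))"
    by (intro ext, subst gs) (simp only: power_Suc, simp add: algebra_simps del: gap_sum.simps)
  also have "suminf \<dots> = (\<Sum>m. (-1) ^ Suc m * gap_sum x (Suc m) (j + 1)) - x j * x (j + 1) * tailF x (j + 2)"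
    unfolding tailF_def
    by (subst suminf_diff[symmetric], subst summable_Suc_iff, rule summable_gap_sum,
        intro summable_mult summable_gap_sum, subst suminf_mult, rule summable_gap_sum) simp
  also have "1 + \<dots> = tailF x (j + 1) - x j * x (j + 1) * tailF x (j + 2)"
    unfolding tailF_def using suminf_split_head[OF summable_gap_sum, of "j + 1"] by simp
  finally show ?thesis .
qed

text \<open>With nonzero coefficients the recurrence can be solved forwards, so two adjacent zeros
  propagate to infinity, against the limit 1.\<close>

lemma tailF_eq_0_propagates:
  assumes "tailF x j = 0" "tailF x (Suc j) = 0" "\<And>k. k \<ge> j \<Longrightarrow> x k \<noteq> 0"
  shows False
proof -
  have "tailF x (j + n) = 0 \<and> tailF x (Suc (j + n)) = 0" for n
  proof (induction n)
    case (Suc n)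
    then show ?case using tailF_rec[of "j + n"] assms(3)[of "j + n"] assms(3)[of "Suc (j + n)"] by auto
  qed (use assms in auto)
  hence "(\<lambda>n. tailF x (n + j)) = (\<lambda>_. 0)" by (simp add: add.commute)
  with LIMSEQ_ignore_initial_segment[OF tailF_tendsto_1, of j] show False
    using LIMSEQ_unique tendsto_const zero_neq_one by metis
qed

end

section \<open>Holomorphic dependence on a parameter\<close>

lemma holomorphic_suminf:
  fixes f :: "nat \<Rightarrow> complex \<Rightarrow> complex"
  assumes "open S" "\<And>n. f n holomorphic_on S" "\<And>n z. z \<in> S \<Longrightarrow> cmod (f n z) \<le> M n" "summable M"
  shows "(\<lambda>z. \<Sum>n. f n z) holomorphic_on S"
proof (rule holomorphic_uniform_sequence[OF assms(1)])
  show "(\<lambda>z. \<Sum>i<n. f i z) holomorphic_on S" for n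
    using assms(2) by (intro holomorphic_intros)
  have "uniform_limit S (\<lambda>n z. \<Sum>i<n. f i z) (\<lambda>z. \<Sum>n. f n z) sequentially"
    using assms(3,4) by (intro Weierstrass_m_test)
  thus "\<exists>d>0. cball z d \<subseteq> S \<and> uniform_limit (cball z d) (\<lambda>n z. \<Sum>i<n. f i z) (\<lambda>z. \<Sum>n. f n z) sequentially"
    if "z \<in> S" for z
    using that assms(1) uniform_limit_on_subset open_contains_cball by metis
qed

text \<open>The hypotheses concern only indices from \<open>j\<close> on, so that finitely many
  earlier entries may have poles inside \<open>S\<close>.\<close>

lemma holomorphic_gap_sum:
  assumes S: "open S" and x: "\<And>k. k \<ge> j \<Longrightarrow> (\<lambda>z. x z k) holomorphic_on S"
    and b: "\<And>z k. z \<in> S \<Longrightarrow> k \<ge> j \<Longrightarrow> cmod (x z k * x z (k + 1)) \<le> b k" "summable b"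
  shows "(\<lambda>z. gap_sum (x z) m j) holomorphic_on S"
  using x b(1)
proof (induction m arbitrary: j)
  case (Suc m j)
  define b' where "b' k = (if j \<le> k then b k else 0)" for k
  \<comment> \<open>The bound at the starting index \<open>j\<close>: tails decrease, so it serves
    all later starting indices and all \<open>z\<close> at once.\<close>
  define B where "B = tail_sum (\<lambda>k. b (k + j)) 0 ^ m / fact m"
  have sb': "summable (\<lambda>k. b (k + j))" using b(2) by (simp add: summable_iff_shift)
  have nn: "0 \<le> b (k + j)" if "z \<in> S" for z k
    using Suc.prems(2)[OF that, of "k + j"] by (meson le_add2 norm_ge_zero order_trans)
  have gb: "cmod (gap_sum (x z) m (j + i)) \<le> B" if z: "z \<in> S" for z i
  proof -
    have "cmod (gap_sum (\<lambda>k. x z (k + j)) m i) \<le> tail_sum (\<lambda>k. b (k + j)) i ^ m / fact m"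
      using Suc.prems(2)[OF z] sb' by (intro gap_sum_bound(1)) (auto simp: ac_simps)
    also have "\<dots> \<le> B" unfolding B_def using sb' nn[OF z]
      by (intro divide_right_mono power_mono tail_sum_antimono tail_sum_nonneg) auto
    finally show ?thesis by (simp add: gap_sum_shift add.commute)
  qed
  show ?case unfolding gap_sum.simps
  proof (rule holomorphic_suminf[OF S])
    show "(\<lambda>z. x z (j + k) * x z (j + k + 1) * gap_sum (x z) m (j + k + 2)) holomorphic_on S" for k
      using Suc.prems by (intro holomorphic_intros Suc.IH) auto
    show "cmod (x z (j + k) * x z (j + k + 1) * gap_sum (x z) m (j + k + 2)) \<le> b (k + j) * B"
      if "z \<in> S" for k z
    proof -
      have "cmod (x z (j + k) * x z (j + k + 1)) * cmod (gap_sum (x z) m (j + k + 2)) \<le> b (k + j) * B"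
        using gb[OF that, of "k + 2"] Suc.prems(2)[OF that, of "j + k"] nn[OF that, of k]
        by (intro mult_mono) (auto simp: ac_simps)
      thus ?thesis by (simp add: norm_mult)
    qed
    show "summable (\<lambda>k. b (k + j) * B)" using sb' by (rule summable_mult2)
  qed
qed simp

lemma holomorphic_tailF:
  assumes S: "open S" and x: "\<And>k. k \<ge> j \<Longrightarrow> (\<lambda>z. x z k) holomorphic_on S"
    and b: "\<And>z k. z \<in> S \<Longrightarrow> k \<ge> j \<Longrightarrow> cmod (x z k * x z (k + 1)) \<le> b k" "summable b"
  shows "(\<lambda>z. tailF (x z) j) holomorphic_on S"
  unfolding tailF_def
proof (rule holomorphic_suminf[OF S])
  show "(\<lambda>z. (-1) ^ m * gap_sum (x z) m j) holomorphic_on S" for m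
    using holomorphic_gap_sum[OF S x b] by (intro holomorphic_intros) auto
  have sb': "summable (\<lambda>k. b (k + j))" using b(2) by (simp add: summable_iff_shift)
  show "cmod ((-1) ^ m * gap_sum (x z) m j) \<le> tail_sum (\<lambda>k. b (k + j)) 0 ^ m / fact m" if z: "z \<in> S" for m z
    using gap_sum_bound(1)[of "\<lambda>k. x z (k + j)" "\<lambda>k. b (k + j)" m 0] b(1)[OF z] sb'
    by (simp add: gap_sum_shift norm_mult norm_power)
  show "summable (\<lambda>m. tail_sum (\<lambda>k. b (k + j)) 0 ^ m / fact m)"
    using summable_exp[of "tail_sum (\<lambda>k. b (k + j)) 0"] by (simp add: divide_inverse mult.commute)
qed

section \<open>Solutions of the three-term recurrence\<close>

lemma gam_pos:
  assumes "\<And>n. 0 < w n"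
  shows "0 < gam w k"
  using assms by (induction k) auto

lemma cluster_point_in_der:
  assumes "\<And>d N. 0 < d \<Longrightarrow> \<exists>k\<ge>N. \<bar>lam k - x\<bar> < d"
  shows "x \<in> der lam"
proof -
  have "\<exists>s. \<forall>n. \<bar>lam (s n) - x\<bar> < 1 / real (Suc n) \<and> s n < s (Suc n)"
  proof (rule dependent_nat_choice)
    show "\<exists>k. \<bar>lam k - x\<bar> < 1 / real (Suc 0)" using assms[of 1] by auto
    show "\<exists>l. \<bar>lam l - x\<bar> < 1 / real (Suc (Suc n)) \<and> k < l" for k n
      using assms[of "1 / real (Suc (Suc n))" "Suc k"] by (auto simp: Suc_le_eq)
  qed
  then obtain s where s: "\<And>n. \<bar>lam (s n) - x\<bar> < 1 / real (Suc n)" "\<And>n. s n < s (Suc n)" by blast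
  have "(\<lambda>n. lam (s n) - x) \<longlonglongrightarrow> 0"
  proof (rule Lim_null_comparison)
    show "\<forall>\<^sub>F n in sequentially. norm (lam (s n) - x) \<le> 1 / real (Suc n)"
      using s(1) by (intro always_eventually allI) (simp add: less_imp_le)
  qed (rule LIMSEQ_Suc[OF lim_1_over_n])
  hence "(lam \<circ> s) \<longlonglongrightarrow> x" by (simp add: o_def LIM_zero_iff)
  moreover have "strict_mono s" using s(2) by (simp add: strict_mono_Suc_iff)
  ultimately show ?thesis unfolding der_def by blast
qed

text \<open>Cluster points are those of the sequence, so outside \<open>der lam\<close> even a
  repeated value is met only finitely often; entries before \<open>N\<close> may still equal
  \<open>x\<close>.\<close>

lemma eventually_away_from_non_cluster_point:
  assumes "x \<notin> complex_of_real ` der lam"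
  shows "\<exists>d>0. \<exists>N. \<forall>k\<ge>N. d \<le> cmod (complex_of_real (lam k) - x)"
proof (cases "Im x = 0")
  case False
  have "\<bar>Im x\<bar> \<le> cmod (complex_of_real (lam k) - x)" for k
    using abs_Im_le_cmod[of "complex_of_real (lam k) - x"] by simp
  thus ?thesis using False by (intro exI[of _ "\<bar>Im x\<bar>"]) auto
next
  case True
  hence x: "x = of_real (Re x)" by (simp add: complex_eq_iff)
  hence "Re x \<notin> der lam" using assms by (metis imageI)
  then obtain d N where "d > 0" "\<And>k. k \<ge> N \<Longrightarrow> d \<le> \<bar>lam k - Re x\<bar>"
    using cluster_point_in_der[of lam "Re x"] by (meson not_le)
  moreover have "cmod (complex_of_real (lam k) - x) = \<bar>lam k - Re x\<bar>" for k
    by (subst x) (metis norm_of_real of_real_diff)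
  ultimately show ?thesis by metis
qed

locale jacobi =
  fixes lam w :: "nat \<Rightarrow> real" and z0 :: complex
  assumes w_pos: "0 < w n"
    and lam_z0: "complex_of_real (lam n) \<noteq> z0"
    and summable_z0: "summable (\<lambda>n. (w n)\<^sup>2 /
            cmod ((complex_of_real (lam n) - z0) * (complex_of_real (lam (n + 1)) - z0)))"
begin

definition X :: "complex \<Rightarrow> nat \<Rightarrow> complex" where
  "X z k = of_real ((gam w k)\<^sup>2) / (of_real (lam k) - z)"

definition F :: "complex \<Rightarrow> nat \<Rightarrow> complex" where
  "F z j = tailF (X z) j"

lemma X_eq_0_iff: "X z k = 0 \<longleftrightarrow> of_real (lam k) = z"
  using gam_pos[of w k, OF w_pos] by (simp add: X_def)

text \<open>Consecutive values of \<open>gam\<close> multiply to \<open>w\<close>; this is the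
  purpose of \<open>gam\<close>, and it ties the products inside \<FF> to the terms of the
  summability condition.\<close>

lemma X_mult: "X z k * X z (k + 1) = of_real ((w k)\<^sup>2) / ((of_real (lam k) - z) * (of_real (lam (k + 1)) - z))"
proof -
  have "gam w k * gam w (k + 1) = w k" using gam_pos[of w k, OF w_pos] by simp
  hence "(gam w k)\<^sup>2 * (gam w (k + 1))\<^sup>2 = (w k)\<^sup>2" by (metis power_mult_distrib)
  thus ?thesis unfolding X_def times_divide_times_eq of_real_mult[symmetric] by simp
qed

text \<open>Transfers the condition from \<open>z0\<close> to \<open>z\<close>: if the diagonal
  stays at distance d and \<open>z\<close> within R of \<open>z0\<close>, then |lam - z0| \<le> |lam
  - z| + R \<le> (1 + R/d) |lam - z|. The constant is squared because each term has two such
  factors.\<close>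

lemma majorant:
  assumes d: "0 < d" "\<And>z k. z \<in> S \<Longrightarrow> k \<ge> N \<Longrightarrow> d \<le> cmod (of_real (lam k) - z)"
    and R: "\<And>z. z \<in> S \<Longrightarrow> cmod (z - z0) \<le> R"
  shows "\<exists>b. summable b \<and> (\<forall>z\<in>S. \<forall>k\<ge>N. cmod (X z k * X z (k + 1)) \<le> b k)"
proof (intro exI conjI ballI allI impI)
  define C where "C = 1 + R / d"
  define b where "b n = C\<^sup>2 * ((w n)\<^sup>2 /
            cmod ((complex_of_real (lam n) - z0) * (complex_of_real (lam (n + 1)) - z0)))" for n
  show "summable b" unfolding b_def using summable_z0 by (rule summable_mult)
  fix z k assume z: "z \<in> S" and k: "k \<ge> N"
  have R0: "0 \<le> R" using R[OF z] norm_ge_zero order_trans by blast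
  have C0: "0 < C" using R0 d(1) by (simp add: C_def add_pos_nonneg)
  have le: "cmod (of_real (lam i) - z0) \<le> C * cmod (of_real (lam i) - z)" if "i \<ge> N" for i
  proof -
    have "cmod (of_real (lam i) - z0) \<le> cmod (of_real (lam i) - z) + cmod (z - z0)"
      using norm_triangle_ineq[of "of_real (lam i) - z" "z - z0"] by simp
    also have "cmod (z - z0) \<le> R / d * cmod (of_real (lam i) - z)"
    proof -
      have "R \<le> R / d * cmod (of_real (lam i) - z)"
        using mult_left_mono[OF d(2)[OF z that], of "R / d"] R0 d(1) by simp
      thus ?thesis using R[OF z] by linarith
    qed
    finally show ?thesis by (simp add: C_def algebra_simps)
  qed
  have nz: "0 < cmod (of_real (lam i) - z)" if "i \<ge> N" for i using d(1) d(2)[OF z that] by linarith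
  have nz0: "0 < cmod (of_real (lam i) - z0)" for i using lam_z0[of i] by simp
  have "cmod (of_real (lam k) - z0) * cmod (of_real (lam (k + 1)) - z0)
      \<le> (C * cmod (of_real (lam k) - z)) * (C * cmod (of_real (lam (k + 1)) - z))"
    using k C0 by (intro mult_mono le) auto
  hence "(w k)\<^sup>2 * (cmod (of_real (lam k) - z0) * cmod (of_real (lam (k + 1)) - z0))
      \<le> (w k)\<^sup>2 * (C\<^sup>2 * (cmod (of_real (lam k) - z) * cmod (of_real (lam (k + 1)) - z)))"
    by (intro mult_left_mono) (auto simp: power2_eq_square algebra_simps)
  hence "(w k)\<^sup>2 / (cmod (of_real (lam k) - z) * cmod (of_real (lam (k + 1)) - z)) \<le> b k"
    using nz[of k] nz[of "k + 1"] nz0[of k] nz0[of "k + 1"] k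
    by (simp add: b_def norm_mult divide_simps) (simp add: algebra_simps)
  thus "cmod (X z k * X z (k + 1)) \<le> b k"
    unfolding X_mult by (simp add: norm_divide norm_mult norm_power)
qed

lemma summable_X:
  assumes "z \<notin> of_real ` der lam"
  shows "summable (\<lambda>k. cmod (X z k * X z (k + 1)))"
proof -
  obtain d N where d: "0 < d" "\<And>k. k \<ge> N \<Longrightarrow> d \<le> cmod (complex_of_real (lam k) - z)"
    using eventually_away_from_non_cluster_point[OF assms] by blast
  have "\<exists>b. summable b \<and> (\<forall>y\<in>{z}. \<forall>k\<ge>N. cmod (X y k * X y (k + 1)) \<le> b k)"
    by (rule majorant[OF d(1)]) (use d(2) in auto)
  then obtain b where b: "summable b" "\<And>k. k \<ge> N \<Longrightarrow> cmod (X z k * X z (k + 1)) \<le> b k"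
    by blast
  show ?thesis
    by (rule summable_comparison_test'[where N = N, OF b(1)]) (simp only: real_norm_def abs_norm_cancel b(2))
qed

lemmas F_rec = tailF_rec[OF order_refl summable_X, folded F_def]
lemmas F_tendsto_1 = tailF_tendsto_1[OF order_refl summable_X, folded F_def[abs_def]]

lemma char_fun_eq_F: "z \<notin> of_real ` der lam \<Longrightarrow> char_fun lam w z = F z 0"
  using frakF_eq_tailF[OF order_refl summable_X, of z]
  unfolding char_fun_def F_def X_def .

lemma frakF_shift_eq_F:
  "z \<notin> of_real ` der lam \<Longrightarrow>
     frakF (\<lambda>k. of_real ((gam w (k + 1))\<^sup>2) / (of_real (lam (k + 1)) - z)) = F z 1"
  using frakF_shift[OF order_refl summable_X, of z 1]
  unfolding F_def X_def .

lemma F_not_both_0: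
  assumes "z \<notin> of_real ` der lam" "F z j = 0" "F z (Suc j) = 0" "\<And>k. k \<ge> j \<Longrightarrow> of_real (lam k) \<noteq> z"
  shows False
  using tailF_eq_0_propagates[OF order_refl summable_X, of z j] assms by (auto simp: F_def X_eq_0_iff)

lemma nonreal_not_der: "Im z \<noteq> 0 \<Longrightarrow> z \<notin> of_real ` der lam"
  by auto

text \<open>Discrete Gronwall argument: the larger of two consecutive moduli grows by at most the
  factor exp |a n| per step.\<close>

lemma recurrence_bounded:
  fixes y a :: "nat \<Rightarrow> complex"
  assumes "summable (\<lambda>k. cmod (a k))" "\<And>n. y (n + 2) = y (n + 1) - a n * y n"
  shows "Bseq y"
proof -
  define M where "M n = max (cmod (y n)) (cmod (y (n + 1)))" for n
  have step: "M (Suc n) \<le> M n * exp (cmod (a n))" for n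
  proof -
    have "cmod (y (n + 2)) \<le> cmod (y (n + 1)) + cmod (a n) * cmod (y n)"
      using norm_triangle_ineq4[of "y (n + 1)" "a n * y n"] by (simp only: assms(2) norm_mult)
    also have "\<dots> \<le> M n + cmod (a n) * M n"
      unfolding M_def by (intro add_mono mult_left_mono) auto
    also have "\<dots> = M n * (1 + cmod (a n))" by (simp add: algebra_simps)
    also have "\<dots> \<le> M n * exp (cmod (a n))"
      by (intro mult_left_mono exp_ge_add_one_self) (auto simp: M_def le_max_iff_disj)
    finally have 1: "cmod (y (n + 2)) \<le> M n * exp (cmod (a n))" .
    have "cmod (y (n + 1)) \<le> M n * 1" by (simp add: M_def)
    also have "\<dots> \<le> M n * exp (cmod (a n))" by (intro mult_left_mono) (auto simp: M_def le_max_iff_disj)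
    finally show ?thesis using 1 by (simp add: M_def[of "Suc n"])
  qed
  have M_le: "M n \<le> M 0 * exp (\<Sum>k<n. cmod (a k))" for n
  proof (induction n)
    case (Suc n)
    have "M (Suc n) \<le> (M 0 * exp (\<Sum>k<n. cmod (a k))) * exp (cmod (a n))"
      using order_trans[OF step mult_right_mono[OF Suc]] by simp
    thus ?case by (simp add: exp_add)
  qed simp
  have M_nonneg: "0 \<le> M n" for n by (simp add: M_def le_max_iff_disj)
  have "cmod (y n) \<le> M 0 * exp (\<Sum>k. cmod (a k))" for n
  proof -
    have "cmod (y n) \<le> M n" by (simp add: M_def)
    also note M_le[of n]
    also have "M 0 * exp (\<Sum>k<n. cmod (a k)) \<le> M 0 * exp (\<Sum>k. cmod (a k))"
      using sum_le_suminf[OF assms(1), of "{..<n}"] by (intro mult_left_mono M_nonneg) simp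
    finally show ?thesis .
  qed
  thus ?thesis by (rule BseqI')
qed

text \<open>The Casoratian of the normalised forward solution \<open>y\<close> and the backward solution \<open>F z\<close>
  is constant; evaluating it at infinity gives the limit of \<open>y\<close>.\<close>

lemma solution_limit:
  fixes u :: "nat \<Rightarrow> complex"
  assumes z: "z \<notin> of_real ` der lam" "\<And>k. of_real (lam k) \<noteq> z"
    and u: "\<And>k. w k * u k + (of_real (lam (k + 1)) - z) * u (k + 1) + w (k + 1) * u (k + 2) = 0"
  shows "(\<lambda>n. u n / (\<Prod>k<n. (z - of_real (lam k)) / of_real (w k))) \<longlonglongrightarrow>
     u 1 * of_real (w 0) / (z - of_real (lam 0)) * F z 1 - X z 0 * X z 1 * u 0 * F z 2"
proof -
  define \<pi> where "\<pi> n = (\<Prod>k<n. (z - of_real (lam k)) / of_real (w k))" for n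
  define y where "y n = u n / \<pi> n" for n
  define a where "a n = X z n * X z (n + 1)" for n
  have zl: "z - of_real (lam k) \<noteq> 0" for k using z(2)[of k] by simp
  have wc: "complex_of_real (w k) \<noteq> 0" for k using w_pos[of k] by simp
  have \<pi>0: "\<pi> n \<noteq> 0" for n using zl wc by (simp add: \<pi>_def)
  \<comment> \<open>Division by \<pi> leaves a summable perturbation of
    \<open>y (n + 2) = y (n + 1)\<close>, with the same coefficients as
    \<open>F_rec\<close>.\<close>
  have rec: "y (n + 2) = y (n + 1) - a n * y n" for n
  proof -
    have "u (n + 2) = ((z - of_real (lam (n + 1))) * u (n + 1) - w n * u n) / w (n + 1)"
      using u[of n] wc[of "n + 1"] by (simp add: field_simps)
    moreover have "\<pi> (n + 1) = \<pi> n * ((z - of_real (lam n)) / of_real (w n))"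
      "\<pi> (n + 2) = \<pi> n * ((z - of_real (lam n)) / of_real (w n)) * ((z - of_real (lam (n + 1))) / of_real (w (n + 1)))"
      by (simp_all add: \<pi>_def)
    moreover have "a n = of_real ((w n)\<^sup>2) / ((z - of_real (lam n)) * (z - of_real (lam (n + 1))))"
      unfolding a_def X_mult by (simp add: algebra_simps)
    moreover have "((B * v - q * t) / r) / (p * (A / q) * (B / r)) = v / (p * (A / q)) - q\<^sup>2 / (A * B) * (t / p)"
      if "A \<noteq> 0" "B \<noteq> 0" "q \<noteq> 0" "r \<noteq> 0" "p \<noteq> 0" for A B q r p v t :: complex
      using that by (simp add: field_simps power2_eq_square)
    moreover note this[OF zl[of n] zl[of "n + 1"] wc[of n] wc[of "n + 1"] \<pi>0[of n]]
    ultimately show ?thesis unfolding y_def of_real_power by simp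
  qed
  have sa: "summable (\<lambda>n. cmod (a n))" unfolding a_def by (rule summable_X[OF z(1)])
  have By: "Bseq y" by (rule recurrence_bounded[OF sa rec])
  have a0: "a \<longlonglongrightarrow> 0" using summable_LIMSEQ_zero[OF sa] by (simp add: tendsto_norm_zero_iff)
  define C where "C n = y (n + 1) * F z (n + 1) - a n * y n * F z (n + 2)" for n
  have "C (Suc n) = C n" for n
    using arg_cong[OF F_rec[OF z(1), of "n + 1"], of "(*) (y (n + 1))"] unfolding C_def
    by (simp add: rec[of n, simplified] a_def[of "Suc n"] algebra_simps)
  hence C: "C n = C 0" for n by (induction n) auto
  have F1: "(\<lambda>n. F z (n + i)) \<longlonglongrightarrow> 1" for i
    unfolding F_def by (rule LIMSEQ_ignore_initial_segment[OF F_tendsto_1[OF z(1)]])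
  \<comment> \<open>The second Casoratian term drops out because \<open>a\<close> tends to 0 and
    \<open>y\<close> is bounded; the first then determines the limit of \<open>y\<close>, as
    \<open>F z (n + 1)\<close> tends to 1.\<close>
  have "(\<lambda>n. a n * F z (n + 2) * y n) \<longlonglongrightarrow> 0"
  proof -
    obtain K where "\<And>n. norm (y n) \<le> K" using By by (auto simp: Bseq_def)
    moreover have "(\<lambda>n. a n * F z (n + 2)) \<longlonglongrightarrow> 0"
      using tendsto_mult[OF a0 F1[of 2]] by simp
    ultimately show ?thesis
      using lim_null_mult_right_bounded[OF _ always_eventually] by blast
  qed
  hence "(\<lambda>n. C 0 + a n * y n * F z (n + 2)) \<longlonglongrightarrow> C 0 + 0"
    by (intro tendsto_intros) (simp add: mult.assoc mult.left_commute mult.commute)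
  moreover have "y (n + 1) * F z (n + 1) = C 0 + a n * y n * F z (n + 2)" for n
    using C[of n, unfolded C_def[of n]] by (simp only: diff_eq_eq)
  ultimately have "(\<lambda>n. y (n + 1) * F z (n + 1)) \<longlonglongrightarrow> C 0" by simp
  from tendsto_divide[OF this F1[of 1]] have "(\<lambda>n. y (n + 1) * F z (n + 1) / F z (n + 1)) \<longlonglongrightarrow> C 0"
    by simp
  moreover have "\<forall>\<^sub>F n in sequentially. F z (n + 1) \<noteq> 0"
    by (rule tendsto_imp_eventually_ne[OF F1 zero_neq_one[symmetric]])
  hence "\<forall>\<^sub>F n in sequentially. y (n + 1) * F z (n + 1) / F z (n + 1) = y (n + 1)"
    by eventually_elim simp
  ultimately have "(\<lambda>n. y (n + 1)) \<longlonglongrightarrow> C 0" by (rule Lim_transform_eventually)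
  hence "y \<longlonglongrightarrow> C 0" using LIMSEQ_imp_Suc[of y] by simp
  moreover have "C 0 = u 1 * of_real (w 0) / (z - of_real (lam 0)) * F z 1 - X z 0 * X z 1 * u 0 * F z 2"
    by (simp add: C_def y_def \<pi>_def a_def numeral_2_eq_2)
  ultimately show ?thesis unfolding y_def \<pi>_def by simp
qed

text \<open>Row 0 of the matrix is not imposed, which leaves two free initial values. The values 1
  and (z - lam 0) / w 0 give the polynomials of the first kind, 0 and 1 / w 0 those of the second
  kind.\<close>

fun sol :: "complex \<Rightarrow> complex \<Rightarrow> complex \<Rightarrow> nat \<Rightarrow> complex" where
  "sol z c d 0 = c"
| "sol z c d (Suc 0) = d"
| "sol z c d (Suc (Suc n)) =
    ((z - of_real (lam (Suc n))) * sol z c d (Suc n) - of_real (w n) * sol z c d n) / of_real (w (Suc n))"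

lemma sol_rec:
  "w k * sol z c d k + (of_real (lam (k + 1)) - z) * sol z c d (k + 1) + w (k + 1) * sol z c d (k + 2) = 0"
  using w_pos[of "Suc k"] by (simp add: field_simps)

text \<open>Markov's argument without a quotient: divided by the same product, both kinds of
  polynomials converge, so the linear relation passes to the limit. There \<open>F z 0 = 0\<close>
  would force \<open>F z 1 = 0\<close>, hence two adjacent zeros. \<open>m\<close> will run through
  the degrees of a weakly convergent subsequence.\<close>

lemma quotient_limit:
  assumes z: "Im z \<noteq> 0" and s: "s \<longlonglongrightarrow> l"
    and eq: "\<And>n. s n * sol z 1 ((z - of_real (lam 0)) / w 0) (m n) + sol z 0 (1 / of_real (w 0)) (m n) = 0"
    and m: "filterlim m at_top sequentially"
  shows "(of_real (lam 0) - z) * l * F z 0 = F z 1" "F z 0 \<noteq> 0"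
proof -
  note zd = nonreal_not_der[OF z]
  have zl: "of_real (lam k) \<noteq> z" for k using z by auto
  have w0: "w 0 \<noteq> 0" using w_pos[of 0] by simp
  define \<pi> where "\<pi> n = (\<Prod>k<n. (z - of_real (lam k)) / complex_of_real (w k))" for n
  let ?P = "\<lambda>n. sol z 1 ((z - of_real (lam 0)) / w 0) n / \<pi> n"
  let ?Q = "\<lambda>n. sol z 0 (1 / of_real (w 0)) n / \<pi> n"
  have "?P \<longlonglongrightarrow> F z 0"
    using solution_limit[OF zd zl sol_rec[where c = 1 and d = "(z - of_real (lam 0)) / w 0"]] zl[of 0] w0 F_rec[OF zd, of 0]
    by (simp add: \<pi>_def numeral_2_eq_2)
  hence P: "(\<lambda>n. ?P (m n)) \<longlonglongrightarrow> F z 0" using m by (rule filterlim_compose)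
  have "?Q \<longlonglongrightarrow> F z 1 / (z - of_real (lam 0))"
    using solution_limit[OF zd zl sol_rec[where c = 0 and d = "1 / of_real (w 0)"]] zl[of 0] w0
    by (simp add: \<pi>_def)
  hence Q: "(\<lambda>n. ?Q (m n)) \<longlonglongrightarrow> F z 1 / (z - of_real (lam 0))" using m by (rule filterlim_compose)
  have "s n * ?P (m n) + ?Q (m n) = 0" for n
    using eq[of n] by (metis add_divide_distrib div_0 times_divide_eq_right)
  hence "(\<lambda>n. s n * ?P (m n) + ?Q (m n)) \<longlonglongrightarrow> 0" by simp
  with tendsto_add[OF tendsto_mult[OF s P] Q] have "l * F z 0 + F z 1 / (z - of_real (lam 0)) = 0"
    by (rule LIMSEQ_unique)
  thus 1: "(of_real (lam 0) - z) * l * F z 0 = F z 1"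
    using zl[of 0] by (simp add: field_simps)
  show "F z 0 \<noteq> 0"
    using 1 F_not_both_0[OF zd, of 0] zl by auto
qed

end

section \<open>Removing the poles at diagonal entries\<close>

lemma three_term_scaling:
  fixes L M p q :: "'a :: field"
  assumes "L \<noteq> 0" "M \<noteq> 0" "p \<noteq> 0"
  shows "(f - W / (L * M) * g) * q / p = L * (f * q / (p * L)) - W * (g * q / (p * L * M))"
  using assms by (simp add: field_simps)

context jacobi begin

text \<open>\<open>F z j\<close> divided by \<open>\<Prod>k<j. lam k - z\<close> solves the three-term recurrence; multiplying by the
  common factor \<open>\<Prod>k<N. lam k - z\<close> removes the poles at the first \<open>N\<close> diagonal entries.\<close>

function G :: "nat \<Rightarrow> nat \<Rightarrow> complex \<Rightarrow> complex" where
  "G N j z = (if N \<le> j then F z j / (\<Prod>k=N..<j. of_real (lam k) - z)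
     else (of_real (lam j) - z) * G N (j + 1) z - of_real ((w j)\<^sup>2) * G N (j + 2) z)"
  by auto
termination by (relation "Wellfounded.measure (\<lambda>(N, j, z). N - j)") auto

declare G.simps[simp del]

text \<open>One number serves both as the radius and as the distance to the diagonal from
  \<open>N\<close> on. Entries before \<open>N\<close> may lie in the ball, even at its
  centre.\<close>

definition clear_ball :: "complex \<Rightarrow> real \<Rightarrow> nat \<Rightarrow> bool" where
  "clear_ball x d N \<longleftrightarrow> 0 < d \<and> (\<forall>z\<in>ball x d. \<forall>k\<ge>N. d \<le> cmod (of_real (lam k) - z))"

context
  fixes x :: complex and d :: real and N :: nat
  assumes clear: "clear_ball x d N"
begin

lemma clear_ball_pos: "0 < d"
  and clear_ball_away: "z \<in> ball x d \<Longrightarrow> k \<ge> N \<Longrightarrow> d \<le> cmod (of_real (lam k) - z)"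
  using clear by (auto simp: clear_ball_def)

lemma ball_not_eq_lam: "z \<in> ball x d \<Longrightarrow> k \<ge> N \<Longrightarrow> of_real (lam k) \<noteq> z"
  using clear_ball_away[of z k] clear_ball_pos by auto

lemma ball_not_der: "z \<in> ball x d \<Longrightarrow> z \<notin> of_real ` der lam"
proof
  assume z: "z \<in> ball x d" "z \<in> of_real ` der lam"
  then obtain l s where l: "z = of_real l" "strict_mono s" "(lam \<circ> s) \<longlonglongrightarrow> l" by (auto simp: der_def)
  from LIMSEQ_D[OF l(3) clear_ball_pos] obtain n where n: "\<And>m. m \<ge> n \<Longrightarrow> norm (lam (s m) - l) < d" by auto
  have "s (max n N) \<ge> N" using seq_suble[OF l(2), of "max n N"] by linarith
  from clear_ball_away[OF z(1) this] n[of "max n N"] show False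
    unfolding l(1) of_real_diff[symmetric] norm_of_real by simp
qed

lemma G_rec:
  assumes z: "z \<in> ball x d"
  shows "G N j z = (of_real (lam j) - z) * G N (j + 1) z - of_real ((w j)\<^sup>2) * G N (j + 2) z"
proof (cases "N \<le> j")
  case True
  define p where "p = (\<Prod>k=N..<j. of_real (lam k) - z)"
  have nz: "of_real (lam j) - z \<noteq> 0" "of_real (lam (j + 1)) - z \<noteq> 0"
    using ball_not_eq_lam[OF z, of j] ball_not_eq_lam[OF z, of "j + 1"] True by auto
  have p: "p \<noteq> 0" using ball_not_eq_lam[OF z] by (auto simp: p_def)
  have "G N j z = F z j / p" "G N (j + 1) z = F z (j + 1) / (p * (of_real (lam j) - z))"
    "G N (j + 2) z = F z (j + 2) / (p * (of_real (lam j) - z) * (of_real (lam (j + 1)) - z))"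
    using True by (simp_all add: G.simps p_def)
  with three_term_scaling[OF nz p, of "F z (j + 1)" "of_real ((w j)\<^sup>2)" "F z (j + 2)" 1] show ?thesis
    unfolding F_rec[OF ball_not_der[OF z], of j] X_mult by simp
qed (simp add: G.simps)

text \<open>From \<open>N\<close> on the denominators have no zeros in the ball; below
  \<open>N\<close> the recurrence runs backwards with polynomial coefficients.\<close>

lemma G_holomorphic: "G N j holomorphic_on ball x d"
proof -
  have F_hol: "(\<lambda>z. F z j) holomorphic_on ball x d" if "j \<ge> N" for j
  proof -
    have "\<exists>b. summable b \<and> (\<forall>z\<in>ball x d. \<forall>k\<ge>N. cmod (X z k * X z (k + 1)) \<le> b k)"
    proof (rule majorant[OF clear_ball_pos clear_ball_away])
      show "cmod (z - z0) \<le> d + cmod (x - z0)" if "z \<in> ball x d" for z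
        using that norm_triangle_ineq[of "z - x" "x - z0"] by (simp add: dist_norm norm_minus_commute)
    qed auto
    then obtain b where b: "summable b" "\<forall>z\<in>ball x d. \<forall>k\<ge>N. cmod (X z k * X z (k + 1)) \<le> b k" by blast
    show ?thesis unfolding F_def
    proof (rule holomorphic_tailF[where b = b])
      show "(\<lambda>z. X z k) holomorphic_on ball x d" if "k \<ge> j" for k
        unfolding X_def using that \<open>j \<ge> N\<close> ball_not_eq_lam by (intro holomorphic_intros) force
    qed (use b that in auto)
  qed
  show ?thesis
  proof (induction "N - j" arbitrary: j rule: less_induct)
    case less
    show ?case
    proof (cases "N \<le> j")
      case True
      have "(\<lambda>z. F z j / (\<Prod>k=N..<j. of_real (lam k) - z)) holomorphic_on ball x d"
        using ball_not_eq_lam by (intro holomorphic_intros F_hol True) force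
      thus ?thesis using True by (simp add: G.simps[abs_def])
    next
      case False
      have "(\<lambda>z. (of_real (lam j) - z) * G N (j + 1) z - of_real ((w j)\<^sup>2) * G N (j + 2) z) holomorphic_on ball x d"
        using False by (intro holomorphic_intros less) auto
      thus ?thesis using False by (subst holomorphic_cong[OF refl G.simps]) (simp_all del: of_real_power)
    qed
  qed
qed

lemma G_eq_F:
  assumes z: "z \<in> ball x d" "\<And>k. of_real (lam k) \<noteq> z"
  shows "G N j z = F z j * (\<Prod>k<N. of_real (lam k) - z) / (\<Prod>k<j. of_real (lam k) - z)"
proof (induction "N - j" arbitrary: j rule: less_induct)
  case less
  have nz: "of_real (lam k) - z \<noteq> 0" for k using z(2) by simp
  show ?case
  proof (cases "N \<le> j")
    case True
    have "{..<j} = {..<N} \<union> {N..<j}" "{..<N} \<inter> {N..<j} = {}" using True by auto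
    hence "(\<Prod>k<j. of_real (lam k) - z) = (\<Prod>k<N. of_real (lam k) - z) * (\<Prod>k=N..<j. of_real (lam k) - z)"
      by (simp add: prod.union_disjoint)
    thus ?thesis using True nz by (simp add: G.simps)
  next
    case False
    define p where "p = (\<Prod>k<j. of_real (lam k) - z)"
    define q where "q = (\<Prod>k<N. of_real (lam k) - z)"
    have p: "p \<noteq> 0" using nz by (simp add: p_def)
    have IH: "G N (j + 1) z = F z (j + 1) * q / (p * (of_real (lam j) - z))"
      "G N (j + 2) z = F z (j + 2) * q / (p * (of_real (lam j) - z) * (of_real (lam (j + 1)) - z))"
      using less[of "j + 1"] less[of "j + 2"] False by (simp_all add: p_def q_def)
    have "G N j z = F z j * q / p"
      unfolding G_rec[OF z(1), of j] IH F_rec[OF ball_not_der[OF z(1)], of j] X_mult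
      by (rule three_term_scaling[OF nz nz p, symmetric])
    thus ?thesis by (simp add: p_def q_def)
  qed
qed

text \<open>Since every \<open>w j\<close> is nonzero, two zeros at the start climb up to index
  \<open>N\<close>, where \<open>G\<close> is a multiple of \<open>F\<close>. Thus a zero of
  \<open>G N 0\<close> is never cancelled in the quotient \<open>G N 1 / G N 0\<close>.\<close>

lemma G_not_both_0:
  assumes z: "z \<in> ball x d" and 0: "G N 0 z = 0" "G N 1 z = 0"
  shows False
proof -
  have "G N j z = 0 \<and> G N (Suc j) z = 0" for j
  proof (induction j)
    case (Suc j)
    thus ?case using G_rec[OF z, of j] w_pos[of j] by auto
  qed (use 0 in auto)
  from this[of N] have "F z N = 0" "F z (Suc N) = 0"
    using ball_not_eq_lam[OF z, of N] by (auto simp: G.simps)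
  thus False using F_not_both_0[OF ball_not_der[OF z]] ball_not_eq_lam[OF z] by blast
qed

lemma finite_occurrences:
  assumes "z \<in> ball x d"
  shows "{k. of_real (lam k) = z} = {k\<in>{..<N}. of_real (lam k) = z}"
  using ball_not_eq_lam[OF assms] by (auto simp: not_less[symmetric])

text \<open>The power of \<open>u - x\<close> in \<open>frakZ\<close> cancels exactly those factors
  of the cleared denominator that vanish at \<open>x\<close>; what remains of it, \<open>R\<close>,
  is nonzero there.\<close>

lemma frakZ_iff: "x \<in> frakZ lam w \<longleftrightarrow> G N 0 x = 0"
proof -
  have xb: "x \<in> ball x d" using clear_ball_pos by simp
  define A where "A = {k\<in>{..<N}. complex_of_real (lam k) = x}"
  define B where "B = {k\<in>{..<N}. complex_of_real (lam k) \<noteq> x}"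
  define r where "r = occurrences lam x"
  define R where "R u = (\<Prod>k\<in>B. complex_of_real (lam k) - u)" for u
  have r: "r = card A" unfolding r_def occurrences_def A_def finite_occurrences[OF xb] ..
  have prod: "(\<Prod>k<N. complex_of_real (lam k) - u) = (x - u) ^ r * R u" for u
  proof -
    have AB: "{..<N} = A \<union> B" "A \<inter> B = {}" "finite A" "finite B" by (auto simp: A_def B_def)
    have "(\<Prod>k<N. complex_of_real (lam k) - u) = (\<Prod>k\<in>A. complex_of_real (lam k) - u) * R u"
      unfolding R_def AB(1) by (rule prod.union_disjoint[OF AB(3,4,2)])
    also have "(\<Prod>k\<in>A. complex_of_real (lam k) - u) = (\<Prod>k\<in>A. x - u)"
      by (intro prod.cong) (auto simp: A_def)
    finally show ?thesis by (simp add: r)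
  qed
  have Rx: "R x \<noteq> 0" by (simp add: R_def B_def)
  have "isCont R x" unfolding R_def by (intro continuous_intros)
  hence R: "R \<midarrow>x\<rightarrow> R x" by (simp add: isCont_def)
  have "isCont (G N 0) x" using G_holomorphic xb
    by (meson continuous_on_eq_continuous_at holomorphic_on_imp_continuous_on open_ball)
  hence G: "G N 0 \<midarrow>x\<rightarrow> G N 0 x" by (simp add: isCont_def)
  \<comment> \<open>The sign is there because the cleared denominator has factors
    \<open>x - u\<close>, while \<open>frakZ\<close> uses \<open>u - x\<close>.\<close>
  have lim: "(\<lambda>u. (-1) ^ r * (G N 0 u / R u)) \<midarrow>x\<rightarrow> (-1) ^ r * (G N 0 x / R x)"
    by (intro tendsto_intros R G Rx)
  have ev: "\<forall>\<^sub>F u in at x. (-1) ^ r * (G N 0 u / R u) = (u - x) ^ occurrences lam x * char_fun lam w u"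
  proof -
    have "\<forall>\<^sub>F u in at x. u \<in> ball x d" using clear_ball_pos by (intro eventually_at_in_open') auto
    moreover have "\<forall>\<^sub>F u in at x. u \<noteq> x" by (simp add: eventually_at_filter)
    moreover have "\<forall>\<^sub>F u in at x. R u \<noteq> 0" using tendsto_imp_eventually_ne[OF R Rx] .
    ultimately show ?thesis
    proof eventually_elim
      case (elim u)
      have ne: "of_real (lam k) \<noteq> u" for k
      proof (cases "k < N")
        case True
        have "(\<Prod>k<N. complex_of_real (lam k) - u) \<noteq> 0" unfolding prod using elim by simp
        thus ?thesis using True by (auto simp: prod_zero_iff)
      qed (use ball_not_eq_lam elim in auto)
      have "G N 0 u = F u 0 * ((x - u) ^ r * R u)"
        using G_eq_F[OF elim(1) ne, of 0] by (simp add: prod)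
      hence "(-1) ^ r * (G N 0 u / R u) = ((-1) * (x - u)) ^ r * F u 0"
        using elim(3) by (simp only: power_mult_distrib) simp
      thus ?case using char_fun_eq_F[OF ball_not_der[OF elim(1)]] by (simp add: r_def)
    qed
  qed
  have "((\<lambda>u. (u - x) ^ occurrences lam x * char_fun lam w u) \<longlongrightarrow> 0) (at x) \<longleftrightarrow> (-1) ^ r * (G N 0 x / R x) = 0"
    using Lim_transform_eventually[OF lim ev] tendsto_unique[OF trivial_limit_at] by metis
  thus ?thesis using ball_not_der[OF xb] Rx by (simp add: frakZ_def)
qed

end

lemma clear_ball_exists:
  assumes "x \<notin> of_real ` der lam"
  shows "\<exists>d N. clear_ball x d N"
proof -
  obtain d N where d: "0 < d" "\<And>k. k \<ge> N \<Longrightarrow> d \<le> cmod (complex_of_real (lam k) - x)"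
    using eventually_away_from_non_cluster_point[OF assms] by blast
  have "d / 2 \<le> cmod (of_real (lam k) - z)" if "z \<in> ball x (d / 2)" "k \<ge> N" for z k
    using d(2)[OF that(2)] that(1) norm_triangle_ineq[of "of_real (lam k) - z" "z - x"]
    by (simp add: dist_norm norm_minus_commute)
  hence "clear_ball x (d / 2) N" using d(1) by (auto simp: clear_ball_def)
  thus ?thesis by blast
qed

end

section \<open>Gauss quadrature\<close>

text \<open>Square matrices with orthonormal rows have orthonormal columns: the Hilbert--Schmidt norm of
  \<open>U\<^sup>T U - 1\<close> only depends on \<open>U U\<^sup>T\<close>.\<close>

lemma orthonormal_rows_imp_columns:
  fixes U :: "'a \<Rightarrow> 'b \<Rightarrow> real"
  assumes fin: "finite A" "finite B" "card A = card B"
    and rows: "\<And>i j. i \<in> A \<Longrightarrow> j \<in> A \<Longrightarrow> (\<Sum>k\<in>B. U i k * U j k) = (if i = j then 1 else 0)"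
    and kl: "k \<in> B" "l \<in> B"
  shows "(\<Sum>i\<in>A. U i k * U i l) = (if k = l then 1 else 0)"
proof -
  \<comment> \<open>The Gram matrix of the columns. Its trace and the sum of its squared entries are
    both \<open>card A\<close>, so its squared distance to the identity is card A - 2 card A + card
    B = 0.\<close>
  define D where "D k l = (\<Sum>i\<in>A. U i k * U i l)" for k l
  define I where "I k l = (if k = l then 1 else 0 :: real)" for k l :: 'b
  have tr: "(\<Sum>k\<in>B. D k k) = card A"
  proof -
    have "(\<Sum>k\<in>B. D k k) = (\<Sum>i\<in>A. \<Sum>k\<in>B. U i k * U i k)" unfolding D_def by (rule sum.swap)
    also have "\<dots> = (\<Sum>i\<in>A. 1)" by (intro sum.cong refl) (simp add: rows)
    finally show ?thesis by simp
  qed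
  have sq: "(\<Sum>k\<in>B. \<Sum>l\<in>B. (D k l)\<^sup>2) = card A"
  proof -
    have "(\<Sum>k\<in>B. \<Sum>l\<in>B. (D k l)\<^sup>2) = (\<Sum>k\<in>B. \<Sum>l\<in>B. \<Sum>i\<in>A. \<Sum>j\<in>A. (U i k * U j k) * (U i l * U j l))"
      by (simp add: D_def power2_eq_square sum_product ac_simps)
    also have "\<dots> = (\<Sum>k\<in>B. \<Sum>i\<in>A. \<Sum>l\<in>B. \<Sum>j\<in>A. (U i k * U j k) * (U i l * U j l))"
      by (intro sum.cong refl sum.swap)
    also have "\<dots> = (\<Sum>i\<in>A. \<Sum>k\<in>B. \<Sum>j\<in>A. \<Sum>l\<in>B. (U i k * U j k) * (U i l * U j l))"
      by (subst sum.swap) (intro sum.cong refl sum.swap)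
    also have "\<dots> = (\<Sum>i\<in>A. \<Sum>j\<in>A. \<Sum>k\<in>B. \<Sum>l\<in>B. (U i k * U j k) * (U i l * U j l))"
      by (intro sum.cong refl sum.swap)
    also have "\<dots> = (\<Sum>i\<in>A. \<Sum>j\<in>A. (\<Sum>k\<in>B. U i k * U j k) * (\<Sum>l\<in>B. U i l * U j l))"
      by (simp add: sum_product)
    also have "\<dots> = (\<Sum>i\<in>A. \<Sum>j\<in>A. if i = j then 1 else 0)"
      by (intro sum.cong refl) (simp add: rows)
    finally show ?thesis using fin by simp
  qed
  have "(\<Sum>k\<in>B. \<Sum>l\<in>B. (D k l - I k l)\<^sup>2) =
      (\<Sum>k\<in>B. \<Sum>l\<in>B. (D k l)\<^sup>2) - 2 * (\<Sum>k\<in>B. \<Sum>l\<in>B. D k l * I k l) + (\<Sum>k\<in>B. \<Sum>l\<in>B. (I k l)\<^sup>2)"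
    by (simp add: power2_diff sum.distrib sum_subtractf sum_distrib_left algebra_simps)
  also have "(\<Sum>k\<in>B. \<Sum>l\<in>B. D k l * I k l) = (\<Sum>k\<in>B. D k k)"
    using fin(2) by (intro sum.cong refl) (simp add: I_def if_distrib cong: if_cong)
  also have "(\<Sum>k\<in>B. \<Sum>l\<in>B. (I k l)\<^sup>2) = (\<Sum>k\<in>B. 1)"
    using fin(2) by (intro sum.cong refl) (simp add: I_def if_distrib[of "\<lambda>t. t\<^sup>2"] cong: if_cong)
  finally have "(\<Sum>k\<in>B. \<Sum>l\<in>B. (D k l - I k l)\<^sup>2) = 0" using tr sq fin(3) by simp
  hence "\<forall>k\<in>B. (\<Sum>l\<in>B. (D k l - I k l)\<^sup>2) = 0"
    using fin by (subst (asm) sum_nonneg_eq_0_iff) (auto intro: sum_nonneg)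
  hence "(\<Sum>l\<in>B. (D k l - I k l)\<^sup>2) = 0" using kl by blast
  hence "\<forall>l\<in>B. (D k l - I k l)\<^sup>2 = 0"
    using fin by (subst (asm) sum_nonneg_eq_0_iff) auto
  thus ?thesis using kl by (simp add: D_def I_def)
qed

lemma finite_discrete_measure:
  fixes c :: "real \<Rightarrow> real"
  assumes R: "finite R" "\<And>x. x \<in> R \<Longrightarrow> 0 \<le> c x" "(\<Sum>x\<in>R. c x) = 1"
  obtains M where "real_distribution M" "AE x in M. x \<in> R"
    "\<And>f :: real \<Rightarrow> real. f \<in> borel_measurable borel \<Longrightarrow> integrable M f \<and> (\<integral>x. f x \<partial>M) = (\<Sum>x\<in>R. c x * f x)"
proof -
  \<comment> \<open>\<open>point_measure\<close> lives on \<open>R\<close> with all subsets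
    measurable; the push-forward below moves it to the Borel line, as
    \<open>real_distribution\<close> demands.\<close>
  define N where "N = point_measure R (\<lambda>x. ennreal (c x))"
  have "emeasure N (space N) = ennreal (\<Sum>x\<in>R. c x)"
    using R(1,2) unfolding N_def space_point_measure
    by (subst emeasure_point_measure_finite) (auto simp: sum_ennreal)
  hence "prob_space N" using R(3) by (intro prob_spaceI) simp
  have meas: "(\<lambda>x. x) \<in> measurable N borel"
    by (auto simp: N_def measurable_def space_point_measure sets_point_measure)
  show thesis
  proof
    show "real_distribution (distr N borel (\<lambda>x. x))"
      by (rule prob_space.real_distribution_distr[OF \<open>prob_space N\<close> meas])
    have "{x \<in> space borel. x \<in> R} \<in> sets borel" using R(1) by (simp add: finite_imp_closed borel_closed)
    thus "AE x in distr N borel (\<lambda>x. x). x \<in> R"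
      by (subst AE_distr_iff[OF meas]) (auto simp: N_def space_point_measure intro: AE_I2)
    fix f :: "real \<Rightarrow> real" assume f: "f \<in> borel_measurable borel"
    show "integrable (distr N borel (\<lambda>x. x)) f \<and> (\<integral>x. f x \<partial>distr N borel (\<lambda>x. x)) = (\<Sum>x\<in>R. c x * f x)"
      unfolding integrable_distr_eq[OF meas f] integral_distr[OF meas f]
      unfolding N_def using R by (simp add: integrable_point_measure_finite lebesgue_integral_point_measure_finite)
  qed
qed

section \<open>Orthogonal polynomials and their zeros\<close>

context jacobi begin

text \<open>Complex coefficients, so that the factorisation into linear factors can count the zeros;
  \<open>p\<close> below is the restriction to the real line.\<close>

fun Pc :: "nat \<Rightarrow> complex poly" where
  "Pc 0 = 1"
| "Pc (Suc 0) = smult (1 / of_real (w 0)) [:- of_real (lam 0), 1:]"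
| "Pc (Suc (Suc n)) = smult (1 / of_real (w (Suc n)))
     ([:- of_real (lam (Suc n)), 1:] * Pc (Suc n) - smult (of_real (w n)) (Pc n))"

lemma w_nz [simp]: "w n \<noteq> 0"
  using w_pos[of n] by simp

abbreviation "Pz n z \<equiv> poly (Pc n) z"

lemma Pz_rec:
  "of_real (w (Suc n)) * Pz (Suc (Suc n)) z = (z - of_real (lam (Suc n))) * Pz (Suc n) z - of_real (w n) * Pz n z"
  by (simp add: algebra_simps)

lemma Pz_rec_0: "of_real (w 0) * Pz (Suc 0) z = z - of_real (lam 0)"
  by (simp add: field_simps)

lemma cnj_Pz: "cnj (Pz n z) = Pz n (cnj z)"
  by (induction n rule: Pc.induct) simp_all

lemma degree_Pc: "degree (Pc n) = n"
proof -
  have "degree (Pc n) \<le> n \<and> coeff (Pc n) n \<noteq> 0"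
  proof (induction n rule: Pc.induct)
    case (3 n)
    have "degree ([:- of_real (lam (Suc n)), 1:] * Pc (Suc n)) \<le> Suc (Suc n)"
      using 3(1) by (intro order_trans[OF degree_mult_le]) (simp add: degree_pCons_eq_if)
    moreover have "degree (smult (of_real (w n)) (Pc n)) \<le> Suc (Suc n)"
      using 3(2) by (intro order_trans[OF degree_smult_le]) simp
    ultimately have "degree ([:- of_real (lam (Suc n)), 1:] * Pc (Suc n) - smult (of_real (w n)) (Pc n)) \<le> Suc (Suc n)"
      by (rule degree_diff_le)
    moreover have "coeff (Pc (Suc n)) (Suc (Suc n)) = 0" "coeff (Pc n) (Suc (Suc n)) = 0"
      using 3 by (simp_all add: coeff_eq_0)
    ultimately show ?case using 3 by simp
  qed auto
  thus ?thesis by (simp add: le_antisym le_degree)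
qed

text \<open>At two zeros of \<open>Pc (Suc n)\<close> the right-hand side vanishes. For distinct
  real zeros this is orthogonality of the rows of the quadrature matrix; for a zero and its
  conjugate it forces reality.\<close>

lemma christoffel_darboux:
  "(x - y) * (\<Sum>k\<le>n. Pz k x * Pz k y) = of_real (w n) * (Pz (Suc n) x * Pz n y - Pz n x * Pz (Suc n) y)"
proof (induction n)
  case 0
  show ?case using Pz_rec_0[of x] Pz_rec_0[of y] by (simp add: right_diff_distrib)
next
  case (Suc n)
  have "of_real (w (Suc n)) * (Pz (Suc (Suc n)) x * Pz (Suc n) y - Pz (Suc n) x * Pz (Suc (Suc n)) y)
     = (of_real (w (Suc n)) * Pz (Suc (Suc n)) x) * Pz (Suc n) y - Pz (Suc n) x * (of_real (w (Suc n)) * Pz (Suc (Suc n)) y)"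
    by (simp only: ring_distribs mult_ac)
  also have "\<dots> = (x - y) * (Pz (Suc n) x * Pz (Suc n) y) + of_real (w n) * (Pz (Suc n) x * Pz n y - Pz n x * Pz (Suc n) y)"
    unfolding Pz_rec by (simp only: ring_distribs mult_ac) simp
  also have "\<dots> = (x - y) * (\<Sum>k\<le>Suc n. Pz k x * Pz k y)"
    unfolding Suc.IH[symmetric] by (simp only: sum.atMost_Suc ring_distribs) simp
  finally show ?case ..
qed

text \<open>The diagonal case y = x, with derivatives; it excludes double zeros.\<close>

lemma christoffel_darboux_confluent:
  "(\<Sum>k\<le>n. (Pz k x)\<^sup>2) = of_real (w n) * (poly (pderiv (Pc (Suc n))) x * Pz n x - poly (pderiv (Pc n)) x * Pz (Suc n) x)"
proof (induction n)
  case 0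
  show ?case by (simp add: pderiv_smult pderiv_pCons)
next
  case (Suc n)
  have d: "of_real (w (Suc n)) * poly (pderiv (Pc (Suc (Suc n)))) x =
     Pz (Suc n) x + (x - of_real (lam (Suc n))) * poly (pderiv (Pc (Suc n))) x - of_real (w n) * poly (pderiv (Pc n)) x"
    by (simp del: Pc.simps(2) mult_pCons_left add: pderiv_smult pderiv_diff pderiv_add pderiv_mult pderiv_pCons algebra_simps)
  have "of_real (w (Suc n)) * (poly (pderiv (Pc (Suc (Suc n)))) x * Pz (Suc n) x - poly (pderiv (Pc (Suc n))) x * Pz (Suc (Suc n)) x)
     = (of_real (w (Suc n)) * poly (pderiv (Pc (Suc (Suc n)))) x) * Pz (Suc n) x
       - poly (pderiv (Pc (Suc n))) x * (of_real (w (Suc n)) * Pz (Suc (Suc n)) x)"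
    by (simp only: ring_distribs mult_ac)
  also have "\<dots> = (Pz (Suc n) x)\<^sup>2 + of_real (w n) * (poly (pderiv (Pc (Suc n))) x * Pz n x - poly (pderiv (Pc n)) x * Pz (Suc n) x)"
    unfolding Pz_rec d power2_eq_square by (simp only: ring_distribs mult_ac) simp
  also have "\<dots> = (\<Sum>k\<le>Suc n. (Pz k x)\<^sup>2)"
    unfolding Suc.IH[symmetric] by (simp only: sum.atMost_Suc add.commute)
  finally show ?case ..
qed

text \<open>Taking the second point to be \<open>cnj z\<close> turns the kernel into a sum of
  squared moduli, at least 1 because of the constant polynomial; so the factor
  \<open>z - cnj z\<close> must vanish.\<close>

lemma real_root_Pc:
  assumes "Pz (Suc n) z = 0"
  shows "Im z = 0"
proof -
  have "(z - cnj z) * (\<Sum>k\<le>n. Pz k z * Pz k (cnj z)) = 0"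
    unfolding christoffel_darboux using assms cnj_Pz[of "Suc n" z] by simp
  moreover have "(\<Sum>k\<le>n. Pz k z * Pz k (cnj z)) = of_real (\<Sum>k\<le>n. (cmod (Pz k z))\<^sup>2)"
    by (simp add: cnj_Pz[symmetric] complex_norm_square del: of_real_power)
  moreover have "(\<Sum>k\<le>n. (cmod (Pz k z))\<^sup>2) \<ge> (cmod (Pz 0 z))\<^sup>2"
    by (intro member_le_sum) auto
  ultimately have "z - cnj z = 0" by (auto simp: of_real_eq_0_iff simp del: of_real_sum)
  thus ?thesis by (simp add: complex_eq_iff)
qed

lemma real_Pz: "\<exists>y::real. Pz k (of_real x) = of_real y"
  using cnj_Pz[of k "of_real x"] by (metis complex_cnj_complex_of_real complex_is_Real_iff Reals_cnj_iff Reals_cases)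

definition p :: "nat \<Rightarrow> real \<Rightarrow> real" where
  "p k x = Re (Pz k (of_real x))"

lemma Pz_of_real: "Pz k (of_real x) = of_real (p k x)"
  using real_Pz[of k x] by (auto simp: p_def)

lemma p_simps: "p 0 x = 1" "p (Suc 0) x = (x - lam 0) / w 0"
  "p (Suc (Suc n)) x = ((x - lam (Suc n)) * p (Suc n) x - w n * p n x) / w (Suc n)"
  using Pz_rec[of n "of_real x"]
  by (simp_all add: p_def add.commute Re_divide_of_real diff_divide_distrib del: Pc.simps(3))
     (simp add: Pz_of_real field_simps flip: of_real_mult of_real_diff of_real_add)

lemma card_roots: "card {x. p (Suc n) x = 0} = Suc n" "finite {x. p (Suc n) x = 0}"
proof -
  let ?R = "{z. Pz (Suc n) z = 0}"
  have nz: "Pc (Suc n) \<noteq> 0" using degree_Pc[of "Suc n"] by fastforce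
  have fin: "finite ?R" by (rule poly_roots_finite[OF nz])
  \<comment> \<open>At a double zero the confluent formula would make a sum of real squares vanish,
    although \<open>p 0\<close> is 1.\<close>
  have "rsquarefree (Pc (Suc n))"
    unfolding rsquarefree_roots
  proof (intro allI notI)
    fix a assume a: "Pz (Suc n) a = 0 \<and> poly (pderiv (Pc (Suc n))) a = 0"
    hence "Im a = 0" using real_root_Pc by blast
    hence ar: "a = of_real (Re a)" by (simp add: complex_eq_iff)
    have "(\<Sum>k\<le>n. (Pz k a)\<^sup>2) = 0" using christoffel_darboux_confluent[of a n] a by simp
    hence "(\<Sum>k\<le>n. (p k (Re a))\<^sup>2) = 0"
      by (subst (asm) ar) (simp only: Pz_of_real of_real_power[symmetric] of_real_sum[symmetric] of_real_eq_0_iff)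
    moreover have "(\<Sum>k\<le>n. (p k (Re a))\<^sup>2) \<ge> (p 0 (Re a))\<^sup>2" by (intro member_le_sum) auto
    ultimately show False by (simp add: p_simps)
  qed
  from complex_poly_decompose_rsquarefree[OF this]
  have "degree (smult (lead_coeff (Pc (Suc n))) (\<Prod>z\<in>?R. [:- z, 1:])) = Suc n"
    using degree_Pc[of "Suc n"] by simp
  hence "card ?R = Suc n" using nz by (simp add: degree_prod_eq_sum_degree)
  moreover have "?R = of_real ` {x. p (Suc n) x = 0}"
  proof (intro equalityI subsetI)
    fix z assume z: "z \<in> ?R"
    hence "z = of_real (Re z)" using real_root_Pc[of n z] by (simp add: complex_eq_iff)
    moreover from this z have "p (Suc n) (Re z) = 0" using Pz_of_real[of "Suc n" "Re z"] by simp
    ultimately show "z \<in> of_real ` {x. p (Suc n) x = 0}" by blast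
  qed (auto simp: Pz_of_real simp del: Pc.simps)
  ultimately show "card {x. p (Suc n) x = 0} = Suc n" "finite {x. p (Suc n) x = 0}"
    using fin by (simp_all add: card_image inj_on_def finite_image_iff)
qed

lemma p_measurable [measurable]: "p k \<in> borel_measurable borel"
proof -
  have "continuous_on UNIV (p k)" unfolding p_def by (intro continuous_intros)
  thus ?thesis by (rule borel_measurable_continuous_onI)
qed

text \<open>The nodes are the zeros of \<open>p (Suc n)\<close>, the weights the Christoffel numbers
  \<open>1 / S x\<close>. The matrix \<open>U\<close>, with one row per node, has orthonormal rows
  by Christoffel-Darboux; orthonormality of its columns is the claimed orthogonality.\<close>

lemma gauss_quadrature:
  obtains M where "real_distribution M" "AE x in M. p (Suc n) x = 0"
    "\<And>f :: real \<Rightarrow> real. f \<in> borel_measurable borel \<Longrightarrow> integrable M f"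
    "\<And>i j. i \<le> n \<Longrightarrow> j \<le> n \<Longrightarrow> (\<integral>x. p i x * p j x \<partial>M) = (if i = j then 1 else 0)"
proof -
  let ?R = "{x. p (Suc n) x = 0}"
  define S where "S x = (\<Sum>k\<le>n. (p k x)\<^sup>2)" for x
  have S: "S x > 0" for x
  proof -
    have "S x \<ge> (p 0 x)\<^sup>2" unfolding S_def by (intro member_le_sum) auto
    thus ?thesis by (simp add: p_simps)
  qed
  have CD: "(\<Sum>k\<le>n. p k x * p k y) = 0" if "x \<in> ?R" "y \<in> ?R" "x \<noteq> y" for x y
  proof -
    have "(of_real x - of_real y) * (\<Sum>k\<le>n. Pz k (of_real x) * Pz k (of_real y)) = 0"
      unfolding christoffel_darboux using that by (simp add: Pz_of_real del: Pc.simps)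
    hence "of_real (\<Sum>k\<le>n. p k x * p k y) = (0::complex)" using that by (simp add: Pz_of_real)
    thus ?thesis by (simp only: of_real_eq_0_iff)
  qed
  define U where "U x k = p k x / sqrt (S x)" for x k
  have rows: "(\<Sum>k\<in>{..n}. U x k * U y k) = (if x = y then 1 else 0)" if "x \<in> ?R" "y \<in> ?R" for x y
  proof -
    have "(\<Sum>k\<in>{..n}. U x k * U y k) = (\<Sum>k\<le>n. p k x * p k y) / (sqrt (S x) * sqrt (S y))"
      by (simp add: U_def sum_divide_distrib)
    thus ?thesis using CD[OF that] S[of x]
      by (auto simp: power2_eq_square[symmetric] S_def[symmetric])
  qed
  have cols: "(\<Sum>x\<in>?R. 1 / S x * (p i x * p j x)) = (if i = j then 1 else 0)" if "i \<le> n" "j \<le> n" for i j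
  proof -
    have "(\<Sum>x\<in>?R. U x i * U x j) = (if i = j then 1 else 0)"
      using that card_roots by (intro orthonormal_rows_imp_columns[where B = "{..n}"] rows) auto
    moreover have "U x i * U x j = 1 / S x * (p i x * p j x)" for x
      using S[of x] by (simp add: U_def)
    ultimately show ?thesis by simp
  qed
  obtain M where M: "real_distribution M" "AE x in M. x \<in> ?R"
    "\<And>f :: real \<Rightarrow> real. f \<in> borel_measurable borel \<Longrightarrow> integrable M f \<and> (\<integral>x. f x \<partial>M) = (\<Sum>x\<in>?R. 1 / S x * f x)"
  proof (rule finite_discrete_measure[of ?R "\<lambda>x. 1 / S x"])
    show "(\<Sum>x\<in>?R. 1 / S x) = 1" using cols[of 0 0] by (simp add: p_simps)
  qed (use card_roots S in \<open>auto simp: less_imp_le\<close>)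
  show thesis
  proof
    show "real_distribution M" by fact
    show "AE x in M. p (Suc n) x = 0" using M(2) by simp
    show "integrable M f" if "f \<in> borel_measurable borel" for f :: "real \<Rightarrow> real" using M(3)[OF that] by blast
    show "(\<integral>x. p i x * p j x \<partial>M) = (if i = j then 1 else 0)" if "i \<le> n" "j \<le> n" for i j
    proof -
      have "(\<lambda>x. p i x * p j x) \<in> borel_measurable borel" by measurable
      from conjunct2[OF M(3)[OF this]] show ?thesis using cols[OF that] by simp
    qed
  qed
qed

end

section \<open>The limit measure\<close>

text \<open>A bound on \<open>\<integral>q\<^sup>2\<close> makes \<open>q\<close> uniformly integrable: it differs from the bounded function
  \<open>q / (1 + (\<delta> q)\<^sup>2)\<close> by at most \<open>\<delta> q\<^sup>2\<close>.\<close>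

lemma weak_conv_integral_of_bounded_square:
  fixes M :: "nat \<Rightarrow> real measure" and q :: "real \<Rightarrow> real"
  assumes M: "\<And>n. real_distribution (M n)" and \<mu>: "real_distribution \<mu>" and conv: "weak_conv_m M \<mu>"
    and q: "\<And>x. isCont q x"
    and int: "\<And>n. integrable (M n) (\<lambda>x. (q x)\<^sup>2)" and C: "\<And>n. (\<integral>x. (q x)\<^sup>2 \<partial>M n) \<le> C"
  shows "integrable \<mu> q" "(\<lambda>n. \<integral>x. q x \<partial>M n) \<longlonglongrightarrow> (\<integral>x. q x \<partial>\<mu>)"
proof -
  interpret M: real_distribution "M n" for n by (rule M)
  interpret \<mu>: real_distribution \<mu> by (rule \<mu>)
  have qm: "q \<in> borel_measurable borel"
    using q by (intro borel_measurable_continuous_onI continuous_at_imp_continuous_on) auto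
  have qM [measurable]: "q \<in> borel_measurable (M n)" "q \<in> borel_measurable \<mu>" for n
    using qm by simp_all
  note lim = weak_conv_imp_integral_bdd_continuous_conv[OF M \<mu> conv]
  have C0: "0 \<le> C" using order_trans[OF integral_nonneg_AE C[of 0]] by simp
  \<comment> \<open>The truncated squares are bounded and continuous, so the bound C passes to the
    weak limit for each k; Fatou's lemma then removes the truncation.\<close>
  have trunc: "(\<integral>x. min ((q x)\<^sup>2) (real k) \<partial>\<mu>) \<le> C" for k
  proof (rule LIMSEQ_le_const2)
    show "(\<lambda>n. \<integral>x. min ((q x)\<^sup>2) (real k) \<partial>M n) \<longlonglongrightarrow> (\<integral>x. min ((q x)\<^sup>2) (real k) \<partial>\<mu>)"
      by (rule lim[where B = "real k"]) (auto intro!: continuous_intros q)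
    show "\<exists>N. \<forall>n\<ge>N. (\<integral>x. min ((q x)\<^sup>2) (real k) \<partial>M n) \<le> C"
    proof (intro exI allI impI order_trans[OF integral_mono C])
      show "integrable (M n) (\<lambda>x. min ((q x)\<^sup>2) (real k))" for n
        by (rule M.integrable_const_bound[of _ "real k"]) auto
    qed (use int in auto)
  qed
  have tint: "integrable \<mu> (\<lambda>x. min ((q x)\<^sup>2) (real k))" for k
    by (rule \<mu>.integrable_const_bound[of _ "real k"]) auto
  have nn: "(\<integral>\<^sup>+x. ennreal ((q x)\<^sup>2) \<partial>\<mu>) \<le> ennreal C"
  proof -
    have "(\<integral>\<^sup>+x. ennreal ((q x)\<^sup>2) \<partial>\<mu>) = (\<integral>\<^sup>+x. liminf (\<lambda>k. ennreal (min ((q x)\<^sup>2) (real k))) \<partial>\<mu>)"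
    proof (intro nn_integral_cong)
      fix x
      have "\<forall>\<^sub>F k in sequentially. ennreal ((q x)\<^sup>2) = ennreal (min ((q x)\<^sup>2) (real k))"
        using eventually_ge_at_top[of "nat \<lceil>(q x)\<^sup>2\<rceil>"] by eventually_elim (simp add: min_def nat_ceiling_le_eq)
      hence "(\<lambda>k. ennreal (min ((q x)\<^sup>2) (real k))) \<longlonglongrightarrow> ennreal ((q x)\<^sup>2)"
        by (rule Lim_transform_eventually[OF tendsto_const])
      thus "ennreal ((q x)\<^sup>2) = liminf (\<lambda>k. ennreal (min ((q x)\<^sup>2) (real k)))"
        by (rule lim_imp_Liminf[OF sequentially_bot, symmetric])
    qed
    also have "\<dots> \<le> liminf (\<lambda>k. \<integral>\<^sup>+x. ennreal (min ((q x)\<^sup>2) (real k)) \<partial>\<mu>)"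
      by (rule nn_integral_liminf) measurable
    also have "\<dots> \<le> liminf (\<lambda>k. ennreal C)"
      using trunc tint by (intro Liminf_mono always_eventually allI)
        (simp add: nn_integral_eq_integral ennreal_leI)
    finally show ?thesis by (simp add: Liminf_const)
  qed
  have q2: "integrable \<mu> (\<lambda>x. (q x)\<^sup>2)"
  proof (rule integrableI_nonneg)
    show "(\<integral>\<^sup>+x. ennreal ((q x)\<^sup>2) \<partial>\<mu>) < \<infinity>"
      using le_less_trans[OF nn ennreal_less_top] by simp
  qed auto
  have q2C: "(\<integral>x. (q x)\<^sup>2 \<partial>\<mu>) \<le> C"
    using nn nn_integral_eq_integral[OF q2] C0 by simp
  have int1: "integrable N q" if "real_distribution N" "integrable N (\<lambda>x. (q x)\<^sup>2)" for N
  proof -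
    interpret N: real_distribution N by fact
    show ?thesis
    proof (rule Bochner_Integration.integrable_bound)
      show "integrable N (\<lambda>x. 1 + (q x)\<^sup>2)" using that(2) by auto
      have "\<bar>q x\<bar> \<le> 1 + (q x)\<^sup>2" for x
        using sum_squares_ge_zero[of "\<bar>q x\<bar> - 1" 0] zero_le_power2[of "q x"] by (simp add: power2_eq_square algebra_simps)
      thus "AE x in N. norm (q x) \<le> norm (1 + (q x)\<^sup>2)" by simp
    qed (use qm in simp)
  qed
  show iq: "integrable \<mu> q" by (rule int1[OF \<mu> q2])
  have close: "\<bar>(\<integral>x. q x \<partial>N) - (\<integral>x. q x / (1 + (\<delta> * q x)\<^sup>2) \<partial>N)\<bar> \<le> \<delta> * C"
    if N: "real_distribution N" "integrable N (\<lambda>x. (q x)\<^sup>2)" "(\<integral>x. (q x)\<^sup>2 \<partial>N) \<le> C" and \<delta>: "0 < \<delta>" for N \<delta>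
  proof -
    interpret N: real_distribution N by fact
    have qN [measurable]: "q \<in> borel_measurable N" using qm by simp
    have le: "\<bar>q x / (1 + (\<delta> * q x)\<^sup>2)\<bar> \<le> \<bar>q x\<bar>" for x
      using divide_left_mono[of 1 "1 + (\<delta> * q x)\<^sup>2" "\<bar>q x\<bar>"] by (simp add: add_pos_nonneg)
    have i2: "integrable N (\<lambda>x. q x / (1 + (\<delta> * q x)\<^sup>2))"
      by (rule Bochner_Integration.integrable_bound[OF int1[OF N(1,2)]]) (use le in auto)
    have diff: "\<bar>q x - q x / (1 + (\<delta> * q x)\<^sup>2)\<bar> \<le> \<delta> * (q x)\<^sup>2" for x
    proof -
      define t where "t = \<bar>\<delta> * q x\<bar>"
      have p: "0 < 1 + t\<^sup>2" by (simp add: add_pos_nonneg)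
      have t2: "(\<delta> * q x)\<^sup>2 = t\<^sup>2" by (simp add: t_def)
      have "q x - q x / (1 + t\<^sup>2) = q x * (t\<^sup>2 / (1 + t\<^sup>2))" using p by (simp add: field_simps)
      hence "\<bar>q x - q x / (1 + t\<^sup>2)\<bar> = \<bar>q x\<bar> * (t\<^sup>2 / (1 + t\<^sup>2))" using p by (simp add: abs_mult)
      also have "t\<^sup>2 / (1 + t\<^sup>2) \<le> t"
      proof -
        have "t * t \<le> t * (1 + t * t)"
          using zero_le_power2[of "t - 1"] by (intro mult_left_mono) (auto simp: t_def power2_eq_square algebra_simps)
        thus ?thesis using p by (simp add: divide_le_eq power2_eq_square)
      qed
      also have "\<bar>q x\<bar> * t = \<delta> * (q x)\<^sup>2" using \<delta> by (simp add: t_def abs_mult power2_eq_square)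
      finally show ?thesis unfolding t2 by (simp add: mult_left_mono)
    qed
    have "\<bar>(\<integral>x. q x \<partial>N) - (\<integral>x. q x / (1 + (\<delta> * q x)\<^sup>2) \<partial>N)\<bar> = \<bar>\<integral>x. q x - q x / (1 + (\<delta> * q x)\<^sup>2) \<partial>N\<bar>"
      using int1[OF N(1,2)] i2 by simp
    also have "\<dots> \<le> (\<integral>x. \<bar>q x - q x / (1 + (\<delta> * q x)\<^sup>2)\<bar> \<partial>N)" by (rule integral_abs_bound)
    also have "\<dots> \<le> (\<integral>x. \<delta> * (q x)\<^sup>2 \<partial>N)"
      using int1[OF N(1,2)] i2 N(2) diff by (intro integral_mono) auto
    also have "\<dots> \<le> \<delta> * C" using N(3) \<delta> by simp
    finally show ?thesis .
  qed
  show "(\<lambda>n. \<integral>x. q x \<partial>M n) \<longlonglongrightarrow> (\<integral>x. q x \<partial>\<mu>)"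
  proof (rule LIMSEQ_I)
    fix r :: real assume r: "0 < r"
    \<comment> \<open>Replacing q by its bounded version costs at most r/4 for \<open>M n\<close>
      and again for \<mu>, leaving r/2 for weak convergence. C + 1 avoids a zero
      denominator.\<close>
    define \<delta> where "\<delta> = r / (4 * (C + 1))"
    have \<delta>: "0 < \<delta>" using r C0 by (simp add: \<delta>_def)
    have \<delta>C: "\<delta> * C \<le> r / 4"
    proof -
      have "\<delta> * C \<le> \<delta> * (C + 1)" using \<delta> by simp
      also have "\<dots> = r / 4" using C0 by (simp add: \<delta>_def field_simps)
      finally show ?thesis .
    qed
    have "(\<lambda>n. \<integral>x. q x / (1 + (\<delta> * q x)\<^sup>2) \<partial>M n) \<longlonglongrightarrow> (\<integral>x. q x / (1 + (\<delta> * q x)\<^sup>2) \<partial>\<mu>)"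
    proof (rule lim)
      show "isCont (\<lambda>x. q x / (1 + (\<delta> * q x)\<^sup>2)) x" for x
        using q by (intro continuous_intros) (auto simp: add_pos_nonneg add_nonneg_eq_0_iff)
      show "norm (q x / (1 + (\<delta> * q x)\<^sup>2)) \<le> 1 / \<delta>" for x
      proof -
        have "2 * (\<delta> * \<bar>q x\<bar>) \<le> 1 + (\<delta> * q x)\<^sup>2"
          using zero_le_power2[of "\<delta> * \<bar>q x\<bar> - 1"] by (simp add: power2_diff power_mult_distrib)
        moreover have "0 \<le> (\<delta> * q x)\<^sup>2" by simp
        ultimately have "\<delta> * \<bar>q x\<bar> \<le> 1 + (\<delta> * q x)\<^sup>2" by linarith
        moreover have "0 < 1 + (\<delta> * q x)\<^sup>2" by (simp add: add_pos_nonneg)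
        ultimately show ?thesis using \<delta> by (simp add: divide_simps mult.commute)
      qed
    qed
    from LIMSEQ_D[OF this, of "r / 2"] r obtain N where N: "\<And>n. n \<ge> N \<Longrightarrow>
        \<bar>(\<integral>x. q x / (1 + (\<delta> * q x)\<^sup>2) \<partial>M n) - (\<integral>x. q x / (1 + (\<delta> * q x)\<^sup>2) \<partial>\<mu>)\<bar> < r / 2" by auto
    show "\<exists>N. \<forall>n\<ge>N. norm ((\<integral>x. q x \<partial>M n) - (\<integral>x. q x \<partial>\<mu>)) < r"
    proof (intro exI allI impI)
      fix n assume "n \<ge> N"
      thus "norm ((\<integral>x. q x \<partial>M n) - (\<integral>x. q x \<partial>\<mu>)) < r"
        using N[of n] close[OF M[of n] int C \<delta>] close[OF \<mu> q2 q2C \<delta>] \<delta>C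
        unfolding real_norm_def by linarith
    qed
  qed
qed

lemma borel_measurable_poly [measurable]: "poly q \<in> borel_measurable borel" for q :: "real poly"
  by (intro borel_measurable_continuous_onI continuous_intros)

lemma nonreal_Cauchy_kernel_bound:
  assumes "Im z \<noteq> 0"
  shows "cmod (1 / (complex_of_real t - z)) \<le> 1 / \<bar>Im z\<bar>"
  using abs_Im_le_cmod[of "complex_of_real t - z"] assms by (simp add: norm_divide frac_le)

lemma tight_of_bounded_second_moment:
  assumes M: "\<And>n. real_distribution (M n)" and int: "\<And>n. integrable (M n) (\<lambda>x. x\<^sup>2)"
    and C: "\<And>n. (\<integral>x. x\<^sup>2 \<partial>M n) \<le> C"
  shows "tight M"
  unfolding tight_def
proof (intro conjI allI impI M)
  fix \<epsilon> :: real assume \<epsilon>: "0 < \<epsilon>"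
  interpret M: real_distribution "M n" for n by (rule M)
  have C0: "0 \<le> C" using order_trans[OF integral_nonneg_AE C[of 0]] by simp
  \<comment> \<open>Chebyshev's inequality bounds the mass outside by C / K^2; with C + 1 in place
    of C this is strictly below \<epsilon>.\<close>
  define K where "K = sqrt ((C + 1) / \<epsilon>) "
  have K: "0 < K" "K\<^sup>2 = (C + 1) / \<epsilon>" using C0 \<epsilon> by (simp_all add: K_def)
  show "\<exists>a b. a < b \<and> (\<forall>n. 1 - \<epsilon> < measure (M n) {a<..b})"
  proof (rule exI[of _ "- K"], rule exI[of _ K], intro conjI allI)
    fix n
    have "measure (M n) {x \<in> space (M n). K\<^sup>2 \<le> x\<^sup>2} \<le> (\<integral>x. x\<^sup>2 \<partial>M n) / K\<^sup>2"
      using K(1) int by (intro integral_Markov_inequality_measure[where A = "{}"]) auto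
    also have "\<dots> \<le> C / K\<^sup>2" using C[of n] by (intro divide_right_mono) auto
    also have "\<dots> < \<epsilon>" using K C0 \<epsilon> by (simp add: field_simps)
    finally have "measure (M n) {x. K\<^sup>2 \<le> x\<^sup>2} < \<epsilon>" by simp
    moreover have "1 - measure (M n) {-K<..K} \<le> measure (M n) {x. K\<^sup>2 \<le> x\<^sup>2}"
    proof -
      have "1 - measure (M n) {-K<..K} = measure (M n) (space (M n) - {-K<..K})"
        by (rule M.prob_compl[symmetric]) auto
      also have "\<dots> \<le> measure (M n) {x. K\<^sup>2 \<le> x\<^sup>2}"
      proof (rule M.finite_measure_mono)
        show "space (M n) - {-K<..K} \<subseteq> {x. K\<^sup>2 \<le> x\<^sup>2}"
          using K(1) by (auto simp: abs_le_square_iff[symmetric])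
      qed auto
      finally show ?thesis .
    qed
    ultimately show "1 - \<epsilon> < measure (M n) {-K<..K}" by linarith
  qed (use K in auto)
qed

section \<open>Moments and Cauchy transforms of the quadrature measures\<close>

context jacobi begin

lemma p_mult:
  "t * p 0 t = lam 0 * p 0 t + w 0 * p 1 t"
  "t * p (Suc k) t = w k * p k t + lam (Suc k) * p (Suc k) t + w (Suc k) * p (Suc (Suc k)) t"
  by (simp_all add: p_simps field_simps)

text \<open>Each factor x of \<open>q\<close> is moved onto \<open>p i\<close> by the recurrence,
  which changes the index by at most one. In the end only integrals of single \<open>p i\<close>
  remain, and these are settled once n reaches i.\<close>

lemma quadrature_moments_eventually_const:
  assumes M: "\<And>n f. f \<in> borel_measurable borel \<Longrightarrow> integrable (M n) (f :: real \<Rightarrow> real)"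
    and orth: "\<And>n i j. i \<le> n \<Longrightarrow> j \<le> n \<Longrightarrow> (\<integral>x. p i x * p j x \<partial>M n) = (if i = j then 1 else 0)"
  shows "\<exists>c. \<forall>\<^sub>F n in sequentially. (\<integral>x. poly q x * p i x \<partial>M n) = c"
proof (induction q arbitrary: i)
  case (pCons a q)
  have int: "integrable (M n) (\<lambda>x. poly q x * p i x)" for q i n
    by (rule M) measurable
  have intp: "integrable (M n) (p i)" for i n by (rule M) measurable
  have base: "\<forall>\<^sub>F n in sequentially. (\<integral>x. p i x \<partial>M n) = (if i = 0 then 1 else 0)" for i
    using eventually_ge_at_top[of i] by eventually_elim (use orth[of i _ 0] in \<open>simp add: p_simps\<close>)
  show ?case
  proof (cases i)
    case 0
    obtain c0 c1 where c: "\<forall>\<^sub>F n in sequentially. (\<integral>x. poly q x * p 0 x \<partial>M n) = c0"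
      "\<forall>\<^sub>F n in sequentially. (\<integral>x. poly q x * p 1 x \<partial>M n) = c1" using pCons.IH by meson
    have eq: "poly (pCons a q) x * p i x = a * p 0 x + lam 0 * (poly q x * p 0 x) + w 0 * (poly q x * p 1 x)" for x
    proof -
      have "poly (pCons a q) x * p i x = a * p 0 x + poly q x * (x * p 0 x)" by (simp add: 0 algebra_simps)
      also have "\<dots> = a * p 0 x + lam 0 * (poly q x * p 0 x) + w 0 * (poly q x * p 1 x)"
        unfolding p_mult by (simp add: algebra_simps)
      finally show ?thesis .
    qed
    have "\<forall>\<^sub>F n in sequentially. (\<integral>x. poly (pCons a q) x * p i x \<partial>M n) = a + lam 0 * c0 + w 0 * c1"
      unfolding eq using base[of 0] c by eventually_elim (simp add: int intp)
    thus ?thesis by blast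
  next
    case (Suc k)
    obtain c0 c1 c2 where c: "\<forall>\<^sub>F n in sequentially. (\<integral>x. poly q x * p k x \<partial>M n) = c0"
      "\<forall>\<^sub>F n in sequentially. (\<integral>x. poly q x * p (Suc k) x \<partial>M n) = c1"
      "\<forall>\<^sub>F n in sequentially. (\<integral>x. poly q x * p (Suc (Suc k)) x \<partial>M n) = c2" using pCons.IH by meson
    have eq: "poly (pCons a q) x * p i x = a * p (Suc k) x + w k * (poly q x * p k x)
        + lam (Suc k) * (poly q x * p (Suc k) x) + w (Suc k) * (poly q x * p (Suc (Suc k)) x)" for x
    proof -
      have "poly (pCons a q) x * p i x = a * p (Suc k) x + poly q x * (x * p (Suc k) x)" by (simp add: Suc algebra_simps)
      also have "\<dots> = a * p (Suc k) x + w k * (poly q x * p k x)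
        + lam (Suc k) * (poly q x * p (Suc k) x) + w (Suc k) * (poly q x * p (Suc (Suc k)) x)"
        unfolding p_mult by (simp only: ring_distribs) (simp add: algebra_simps del: p_simps)
      finally show ?thesis .
    qed
    have "\<forall>\<^sub>F n in sequentially. (\<integral>x. poly (pCons a q) x * p i x \<partial>M n) = w k * c0 + lam (Suc k) * c1 + w (Suc k) * c2"
      unfolding eq using base[of "Suc k"] c by eventually_elim (simp add: int intp)
    thus ?thesis by blast
  qed
qed simp

text \<open>For the spectral measure these are formally the coordinates of the resolvent at
  \<open>z\<close> applied to the first basis vector.\<close>

definition cauchy_moment :: "real measure \<Rightarrow> complex \<Rightarrow> nat \<Rightarrow> complex" where
  "cauchy_moment M z k = (\<integral>t. complex_of_real (p k t) * (1 / (complex_of_real t - z)) \<partial>M)"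

text \<open>Integrates the recurrence against t/(t - z) = 1 + z/(t - z). The integrals of
  \<open>p k\<close> stay unevaluated because a quadrature measure is orthonormal only up to degree
  n; for the limit measure the two equations say (J - z) g = e_0.\<close>

lemma cauchy_moment_rec:
  assumes M: "real_distribution M" and int: "\<And>k. integrable M (p k)" and z: "Im z \<noteq> 0"
  shows "z * cauchy_moment M z 0 + of_real (\<integral>t. p 0 t \<partial>M) =
      of_real (lam 0) * cauchy_moment M z 0 + of_real (w 0) * cauchy_moment M z 1"
    and "z * cauchy_moment M z (Suc k) + of_real (\<integral>t. p (Suc k) t \<partial>M) =
      of_real (w k) * cauchy_moment M z k + of_real (lam (Suc k)) * cauchy_moment M z (Suc k)
      + of_real (w (Suc k)) * cauchy_moment M z (Suc (Suc k))"
proof -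
  interpret real_distribution M by fact
  have nz: "complex_of_real t - z \<noteq> 0" for t using z by (auto simp: complex_eq_iff)
  have pint: "integrable M (\<lambda>t. complex_of_real (p k t))" for k using int[of k] by simp
  have fint: "integrable M (\<lambda>t. complex_of_real (p k t) * (1 / (complex_of_real t - z)))" for k
  proof (rule Bochner_Integration.integrable_bound)
    show "integrable M (\<lambda>t. \<bar>p k t\<bar> * (1 / \<bar>Im z\<bar>))" using int[of k] by simp
    have "cmod (complex_of_real (p k t) * (1 / (complex_of_real t - z))) \<le> \<bar>p k t\<bar> * (1 / \<bar>Im z\<bar>)" for t
      using mult_left_mono[OF nonreal_Cauchy_kernel_bound[OF z, of t] abs_ge_zero[of "p k t"]]
      unfolding norm_mult norm_of_real .
    thus "AE t in M. norm (complex_of_real (p k t) * (1 / (complex_of_real t - z))) \<le> norm (\<bar>p k t\<bar> * (1 / \<bar>Im z\<bar>))"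
      by simp
  qed simp
  have zf: "z * cauchy_moment M z k + of_real (\<integral>t. p k t \<partial>M) =
      (\<integral>t. complex_of_real (t * p k t) * (1 / (complex_of_real t - z)) \<partial>M)" for k
  proof -
    have "complex_of_real (t * p k t) * (1 / (complex_of_real t - z)) =
      of_real (p k t) + z * (complex_of_real (p k t) * (1 / (complex_of_real t - z)))" for t
      using nz[of t] by (simp add: field_simps)
    hence "(\<integral>t. complex_of_real (t * p k t) * (1 / (complex_of_real t - z)) \<partial>M) =
      (\<integral>t. of_real (p k t) + z * (complex_of_real (p k t) * (1 / (complex_of_real t - z))) \<partial>M)"
      by presburger
    also have "\<dots> = (\<integral>t. complex_of_real (p k t) \<partial>M) + z * cauchy_moment M z k"
      unfolding cauchy_moment_def
      by (simp only: Bochner_Integration.integral_add[OF pint integrable_mult_right[OF fint]] integral_mult_right_zero)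
    finally show ?thesis by simp
  qed
  have "complex_of_real (t * p 0 t) * (1 / (complex_of_real t - z)) =
      of_real (lam 0) * (of_real (p 0 t) * (1 / (complex_of_real t - z)))
      + of_real (w 0) * (of_real (p 1 t) * (1 / (complex_of_real t - z)))" for t
    unfolding p_mult of_real_add of_real_mult by (simp only: ring_distribs mult_ac)
  thus "z * cauchy_moment M z 0 + of_real (\<integral>t. p 0 t \<partial>M) =
      of_real (lam 0) * cauchy_moment M z 0 + of_real (w 0) * cauchy_moment M z 1"
    unfolding zf unfolding cauchy_moment_def
    by (simp only: Bochner_Integration.integral_add integrable_mult_right[OF fint] integral_mult_right_zero)
  have "complex_of_real (t * p (Suc k) t) * (1 / (complex_of_real t - z)) =
      of_real (w k) * (of_real (p k t) * (1 / (complex_of_real t - z)))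
      + of_real (lam (Suc k)) * (of_real (p (Suc k) t) * (1 / (complex_of_real t - z)))
      + of_real (w (Suc k)) * (of_real (p (Suc (Suc k)) t) * (1 / (complex_of_real t - z)))" for t
    unfolding p_mult of_real_add of_real_mult by (simp only: ring_distribs mult_ac)
  thus "z * cauchy_moment M z (Suc k) + of_real (\<integral>t. p (Suc k) t \<partial>M) =
      of_real (w k) * cauchy_moment M z k + of_real (lam (Suc k)) * cauchy_moment M z (Suc k)
      + of_real (w (Suc k)) * cauchy_moment M z (Suc (Suc k))"
    unfolding zf unfolding cauchy_moment_def
    by (simp only: Bochner_Integration.integral_add Bochner_Integration.integrable_add
        integrable_mult_right[OF fint] integral_mult_right_zero)
qed

text \<open>\<open>p (Suc n)\<close> vanishes at every node, so the moment of index
  \<open>Suc n\<close> is 0, while the recurrence expresses it by the two kinds of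
  polynomials.\<close>

lemma quadrature_stieltjes:
  assumes M: "real_distribution M" "AE x in M. p (Suc n) x = 0"
    "\<And>f :: real \<Rightarrow> real. f \<in> borel_measurable borel \<Longrightarrow> integrable M f"
    "\<And>i j. i \<le> n \<Longrightarrow> j \<le> n \<Longrightarrow> (\<integral>x. p i x * p j x \<partial>M) = (if i = j then 1 else 0)"
    and z: "Im z \<noteq> 0"
  shows "(\<integral>t. 1 / (complex_of_real t - z) \<partial>M) * sol z 1 ((z - of_real (lam 0)) / w 0) (Suc n)
     + sol z 0 (1 / of_real (w 0)) (Suc n) = 0"
proof -
  interpret real_distribution M by fact
  define f where "f = cauchy_moment M z"
  have int: "integrable M (p k)" for k by (rule M(3)) measurable
  note rec = cauchy_moment_rec[OF M(1) int z, folded f_def]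
  have p0: "(\<integral>t. p k t \<partial>M) = (if k = 0 then 1 else 0)" if "k \<le> n" for k
    using M(4)[OF that, of 0] by (simp add: p_simps)
  have s: "f 0 = (\<integral>t. 1 / (complex_of_real t - z) \<partial>M)" by (simp add: f_def cauchy_moment_def p_simps)
  have main: "f k = f 0 * sol z 1 ((z - of_real (lam 0)) / w 0) k + sol z 0 (1 / of_real (w 0)) k"
    if "k \<le> Suc n" for k
    using that
  proof (induction k rule: Pc.induct)
    case 2
    thus ?case using rec(1) p0[of 0] by (simp add: field_simps)
  next
    case (3 k)
    hence "f (Suc (Suc k)) = ((z - of_real (lam (Suc k))) * f (Suc k) - of_real (w k) * f k) / of_real (w (Suc k))"
      using rec(2)[of k] p0[of "Suc k"] by (simp add: field_simps)
    thus ?case using 3 by (simp add: algebra_simps add_divide_distrib diff_divide_distrib)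
  qed simp
  have "f (Suc n) = (\<integral>t. 0 \<partial>M)"
    unfolding f_def cauchy_moment_def using M(2) by (intro integral_cong_AE) (measurable, auto)
  with main[of "Suc n"] s show ?thesis by simp
qed

lemma spectral_measure_exists:
  obtains \<mu> where "real_distribution \<mu>" "\<And>i j. integrable \<mu> (\<lambda>x. p i x * p j x)"
    "\<And>i j. (\<integral>x. p i x * p j x \<partial>\<mu>) = (if i = j then 1 else 0)"
    "\<And>z. Im z \<noteq> 0 \<Longrightarrow> (of_real (lam 0) - z) * (\<integral>t. 1 / (complex_of_real t - z) \<partial>\<mu>) * F z 0 = F z 1"
    "\<And>z. Im z \<noteq> 0 \<Longrightarrow> F z 0 \<noteq> 0"
proof -
  have "\<exists>M. real_distribution M \<and> (AE x in M. p (Suc n) x = 0) \<and>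
    (\<forall>f :: real \<Rightarrow> real. f \<in> borel_measurable borel \<longrightarrow> integrable M f) \<and>
    (\<forall>i j. i \<le> n \<longrightarrow> j \<le> n \<longrightarrow> (\<integral>x. p i x * p j x \<partial>M) = (if i = j then 1 else 0))" for n
    using gauss_quadrature[of n] by metis
  then obtain M where M: "\<And>n. real_distribution (M n)" "\<And>n. AE x in M n. p (Suc n) x = 0"
    "\<And>n f :: real \<Rightarrow> real. f \<in> borel_measurable borel \<Longrightarrow> integrable (M n) f"
    "\<And>n i j. i \<le> n \<Longrightarrow> j \<le> n \<Longrightarrow> (\<integral>x. p i x * p j x \<partial>M n) = (if i = j then 1 else 0)"
    by metis
  \<comment> \<open>Eventually constant moments are bounded: the second moment gives tightness,
    those of \<open>q * q\<close> give uniform integrability of \<open>q\<close>.\<close>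
  have bdd: "\<exists>C. \<forall>n. (\<integral>x. poly q x \<partial>M n) \<le> C" for q
  proof -
    obtain c where "\<forall>\<^sub>F n in sequentially. (\<integral>x. poly q x * p 0 x \<partial>M n) = c"
      using quadrature_moments_eventually_const[of M q 0, OF M(3,4)] by blast
    hence "(\<lambda>n. \<integral>x. poly q x \<partial>M n) \<longlonglongrightarrow> c"
      by (intro tendsto_eventually) (simp add: p_simps)
    hence "Bseq (\<lambda>n. \<integral>x. poly q x \<partial>M n)" by (rule convergent_imp_Bseq[OF convergentI])
    thus ?thesis by (auto simp: Bseq_def abs_le_iff)
  qed
  have "tight M"
  proof -
    obtain C where "\<And>n. (\<integral>x. poly [:0, 0, 1:] x \<partial>M n) \<le> C" using bdd by blast
    hence "\<And>n. (\<integral>x. x\<^sup>2 \<partial>M n) \<le> C" by (simp add: power2_eq_square)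
    thus ?thesis by (intro tight_of_bounded_second_moment[where C = C] M) auto
  qed
  from tight_imp_convergent_subsubsequence[OF this strict_mono_id] obtain r \<mu>
    where r: "strict_mono r" and \<mu>: "real_distribution \<mu>" and conv: "weak_conv_m (M \<circ> r) \<mu>"
    by (auto simp: o_def)
  have Mr: "real_distribution ((M \<circ> r) n)" for n using M(1) by simp
  have poly_p: "\<exists>q. \<forall>x. p k x = poly q x" for k
  proof (induction k rule: Pc.induct)
    case 1 show ?case by (rule exI[of _ 1]) (simp add: p_simps)
  next
    case 2 show ?case by (rule exI[of _ "smult (1 / w 0) [:- lam 0, 1:]"]) (simp add: p_simps diff_divide_distrib)
  next
    case (3 k)
    then obtain q1 q2 where "\<forall>x. p (Suc k) x = poly q1 x" "\<forall>x. p k x = poly q2 x" by blast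
    thus ?case
      by (intro exI[of _ "smult (1 / w (Suc k)) ([:- lam (Suc k), 1:] * q1 - smult (w k) q2)"])
         (simp add: p_simps algebra_simps diff_divide_distrib add_divide_distrib)
  qed
  have conv_poly: "integrable \<mu> (poly q)" "(\<lambda>n. \<integral>x. poly q x \<partial>(M \<circ> r) n) \<longlonglongrightarrow> (\<integral>x. poly q x \<partial>\<mu>)" for q
  proof -
    obtain C where C: "\<And>n. (\<integral>x. poly (q * q) x \<partial>M n) \<le> C" using bdd by blast
    have C': "(\<integral>x. (poly q x)\<^sup>2 \<partial>(M \<circ> r) n) \<le> C" for n using C[of "r n"] by (simp add: power2_eq_square)
    have int: "integrable ((M \<circ> r) n) (\<lambda>x. (poly q x)\<^sup>2)" for n
      unfolding o_def by (rule M(3)) measurable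
    show "integrable \<mu> (poly q)" "(\<lambda>n. \<integral>x. poly q x \<partial>(M \<circ> r) n) \<longlonglongrightarrow> (\<integral>x. poly q x \<partial>\<mu>)"
      by (rule weak_conv_integral_of_bounded_square[OF Mr \<mu> conv _ int C']; simp)+
  qed
  have pp: "\<exists>q. (\<lambda>x. p i x * p j x) = poly q" for i j
  proof -
    obtain q1 q2 where "\<forall>x. p i x = poly q1 x" "\<forall>x. p j x = poly q2 x" using poly_p by blast
    thus ?thesis by (intro exI[of _ "q1 * q2"]) auto
  qed
  show thesis
  proof
    show "real_distribution \<mu>" by fact
    show "integrable \<mu> (\<lambda>x. p i x * p j x)" for i j using pp[of i j] conv_poly(1) by metis
    show "(\<integral>x. p i x * p j x \<partial>\<mu>) = (if i = j then 1 else 0)" for i j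
    proof (rule LIMSEQ_unique)
      show "(\<lambda>n. \<integral>x. p i x * p j x \<partial>(M \<circ> r) n) \<longlonglongrightarrow> (\<integral>x. p i x * p j x \<partial>\<mu>)"
        using pp[of i j] conv_poly(2) by metis
      have "\<forall>\<^sub>F n in sequentially. (\<integral>x. p i x * p j x \<partial>(M \<circ> r) n) = (if i = j then 1 else 0)"
        using eventually_ge_at_top[of "max i j"]
      proof eventually_elim
        case (elim n)
        thus ?case using seq_suble[OF r, of n] by (simp add: M(4))
      qed
      thus "(\<lambda>n. \<integral>x. p i x * p j x \<partial>(M \<circ> r) n) \<longlonglongrightarrow> (if i = j then 1 else 0)"
        by (rule tendsto_eventually)
    qed
    fix z :: complex assume z: "Im z \<noteq> 0"
    have nz: "complex_of_real t - z \<noteq> 0" for t using z by (auto simp: complex_eq_iff)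
    have lim: "(\<lambda>n. \<integral>t. 1 / (complex_of_real t - z) \<partial>(M \<circ> r) n) \<longlonglongrightarrow> (\<integral>t. 1 / (complex_of_real t - z) \<partial>\<mu>)"
    proof (rule weak_conv_imp_integral_bdd_continuous_conv[OF Mr \<mu> conv, where B = "1 / \<bar>Im z\<bar>"])
      show "isCont (\<lambda>t. 1 / (complex_of_real t - z)) x" for x using nz by (intro continuous_intros)
      show "norm (1 / (complex_of_real t - z)) \<le> 1 / \<bar>Im z\<bar>" for t
        using abs_Im_le_cmod[of "complex_of_real t - z"] z nz[of t]
        by (simp add: norm_divide frac_le)
    qed
    have eq: "(\<integral>t. 1 / (complex_of_real t - z) \<partial>(M \<circ> r) n) * sol z 1 ((z - of_real (lam 0)) / w 0) (Suc (r n))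
     + sol z 0 (1 / of_real (w 0)) (Suc (r n)) = 0" for n
      unfolding o_def by (rule quadrature_stieltjes[OF M(1,2) M(3) M(4) z])
    have m: "filterlim (\<lambda>n. Suc (r n)) at_top sequentially"
      using filterlim_compose[OF filterlim_Suc filterlim_subseq[OF r]] by (simp add: o_def)
    show "(of_real (lam 0) - z) * (\<integral>t. 1 / (complex_of_real t - z) \<partial>\<mu>) * F z 0 = F z 1" "F z 0 \<noteq> 0"
      by (rule quotient_limit[OF z lim eq m])+
  qed
qed

end

section \<open>The measure outside \<open>der lam\<close>\<close>

lemma (in real_distribution) integrable_Cauchy_kernel:
  assumes "Im z \<noteq> 0"
  shows "integrable M (\<lambda>t. 1 / (complex_of_real t - z))"
  using nonreal_Cauchy_kernel_bound[OF assms] by (intro integrable_const_bound[where B = "1 / \<bar>Im z\<bar>"]) auto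

text \<open>On the vertical approach |u - x| = Im u, so the kernel is bounded by 1; it equals -1 at
  \<open>t = x\<close> and tends to 0 elsewhere, and dominated convergence isolates the atom. The
  weight is \<open>h = 1\<close> for residues and \<open>h = p k\<close> for resolvent
  vectors.\<close>

lemma (in real_distribution) Cauchy_kernel_atom_limit:
  fixes h :: "real \<Rightarrow> real" and x :: real
  assumes h: "integrable M h"
  defines "u \<equiv> \<lambda>n. complex_of_real x + \<i> / of_nat (Suc n)"
  shows "(\<lambda>n. \<integral>t. of_real (h t) * ((u n - of_real x) / (complex_of_real t - u n)) \<partial>M)
    \<longlonglongrightarrow> - of_real (h x * measure M {x})"
proof -
  have hm [measurable]: "h \<in> borel_measurable borel" using borel_measurable_integrable[OF h] by simp
  have Im_u: "Im (u n) = 1 / real (Suc n)" for n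
    by (simp add: u_def Im_divide_of_nat del: of_nat_Suc)
  have ux: "u n - of_real x = \<i> / of_nat (Suc n)" for n by (simp add: u_def)
  have bound: "cmod ((u n - of_real x) / (complex_of_real t - u n)) \<le> 1" for n t
  proof -
    have "cmod (1 / (complex_of_real t - u n)) \<le> real (Suc n)"
      using nonreal_Cauchy_kernel_bound[of "u n" t] unfolding Im_u by simp
    from mult_left_mono[OF this, of "cmod (u n - of_real x)"] show ?thesis
      unfolding norm_mult[symmetric] ux by (simp add: norm_divide del: of_nat_Suc)
  qed
  have u_lim: "(\<lambda>n. u n - of_real x) \<longlonglongrightarrow> 0"
    unfolding ux using tendsto_mult[OF tendsto_const[of \<i>] LIMSEQ_Suc[OF lim_1_over_n[where 'a = complex]]]
    by simp
  have "(\<lambda>n. \<integral>t. of_real (h t) * ((u n - of_real x) / (complex_of_real t - u n)) \<partial>M)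
      \<longlonglongrightarrow> (\<integral>t. of_real (- (h x * indicator {x} t)) \<partial>M)"
  proof (rule integral_dominated_convergence[where w = "\<lambda>t. \<bar>h t\<bar>"])
    show "AE t in M. (\<lambda>n. of_real (h t) * ((u n - of_real x) / (complex_of_real t - u n)))
        \<longlonglongrightarrow> of_real (- (h x * indicator {x} t))"
    proof (rule AE_I2)
      fix t
      show "(\<lambda>n. of_real (h t) * ((u n - of_real x) / (complex_of_real t - u n)))
        \<longlonglongrightarrow> of_real (- (h x * indicator {x} t))"
      proof (cases "t = x")
        case True
        have "(u n - of_real x) / (complex_of_real x - u n) = - 1" for n
        proof -
          have "u n - of_real x \<noteq> 0" unfolding ux by (simp del: of_nat_Suc)
          thus ?thesis by (simp add: field_simps)
        qed
        thus ?thesis using True by simp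
      next
        case False
        have "u \<longlonglongrightarrow> of_real x" using u_lim by (simp add: LIM_zero_iff)
        hence "(\<lambda>n. of_real (h t) * ((u n - of_real x) / (complex_of_real t - u n)))
            \<longlonglongrightarrow> of_real (h t) * (0 / (of_real t - of_real x))"
          using False by (intro tendsto_intros u_lim) auto
        thus ?thesis using False by simp
      qed
    qed
    show "AE t in M. norm (of_real (h t) * ((u n - of_real x) / (complex_of_real t - u n))) \<le> \<bar>h t\<bar>" for n
    proof (rule AE_I2)
      fix t
      show "norm (of_real (h t) * ((u n - of_real x) / (complex_of_real t - u n))) \<le> \<bar>h t\<bar>"
        using mult_left_mono[OF bound[of n t] abs_ge_zero[of "h t"]]
        unfolding norm_mult norm_of_real by simp
    qed
  qed (use h in \<open>auto simp: u_def\<close>)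
  also have "(\<integral>t. of_real (- (h x * indicator {x} t)) \<partial>M) = - complex_of_real (h x * measure M {x})"
    by (subst integral_complex_of_real) simp
  finally show ?thesis .
qed

lemma (in real_distribution) Cauchy_transform_cnj:
  "cnj (\<integral>t. 1 / (complex_of_real t - z) \<partial>M) = (\<integral>t. 1 / (complex_of_real t - cnj z) \<partial>M)"
  by (subst Bochner_Integration.integral_cnj[symmetric]) simp

text \<open>The imaginary part of the Cauchy kernel at y + i e is the Poisson kernel e / ((t - y)^2
  + e^2), which is at least 1 / (2 e) on the interval.\<close>

lemma (in real_distribution) measure_interval_le_Cauchy_transform:
  assumes "0 < e"
  shows "measure M {y - e..y + e} \<le> 2 * e * Im (\<integral>t. 1 / (complex_of_real t - Complex y e) \<partial>M)"
proof -
  have K: "Im (1 / (complex_of_real t - Complex y e)) = e / ((t - y)\<^sup>2 + e\<^sup>2)" for t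
    by (simp add: Im_divide power2_eq_square)
  have int: "integrable M (\<lambda>t. 1 / (complex_of_real t - Complex y e))"
    using assms by (intro integrable_Cauchy_kernel) simp
  have "measure M {y - e..y + e} = (\<integral>t. indicator {y - e..y + e} t \<partial>M)" by simp
  also have "\<dots> \<le> (\<integral>t. 2 * e * Im (1 / (complex_of_real t - Complex y e)) \<partial>M)"
  proof (rule integral_mono)
    show "integrable M (\<lambda>t. 2 * e * Im (1 / (complex_of_real t - Complex y e)))"
      using int by (intro integrable_mult_right integrable_Im)
    fix t
    have pos: "0 < (t - y)\<^sup>2 + e\<^sup>2" using assms by (simp add: add_nonneg_pos)
    show "indicator {y - e..y + e} t \<le> 2 * e * Im (1 / (complex_of_real t - Complex y e))"
    proof (cases "t \<in> {y - e..y + e}")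
      case True
      hence "\<bar>t - y\<bar> \<le> \<bar>e\<bar>" using assms by auto
      hence "(t - y)\<^sup>2 \<le> e\<^sup>2" by (simp add: abs_le_square_iff)
      thus ?thesis unfolding K using True pos by (simp add: le_divide_eq power2_eq_square)
    next
      case False
      thus ?thesis unfolding K using pos assms by simp
    qed
  qed (auto simp: emeasure_eq_measure)
  also have "\<dots> = 2 * e * Im (\<integral>t. 1 / (complex_of_real t - Complex y e) \<partial>M)"
    using integral_Im[OF int] by simp
  finally show ?thesis .
qed

text \<open>If the Cauchy transform continues analytically across a real interval, then its values at
  \<open>u\<close> and \<open>cnj u\<close> differ by \<open>O(Im u)\<close>, so intervals of length \<open>e\<close> have measure \<open>O(e\<^sup>2)\<close>.\<close>

lemma (in real_distribution) null_near_regular_point: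
  assumes m: "m holomorphic_on ball (complex_of_real y) r" and r: "0 < r"
    and eq: "\<And>u. u \<in> ball (complex_of_real y) r \<Longrightarrow> Im u \<noteq> 0 \<Longrightarrow> m u = (\<integral>t. 1 / (complex_of_real t - u) \<partial>M)"
  shows "\<exists>\<delta>>0. measure M {y - \<delta>..y + \<delta>} = 0"
proof -
  define S where "S = cball (complex_of_real y) (r / 2)"
  have S: "S \<subseteq> ball (complex_of_real y) r" using r by (auto simp: S_def)
  have "continuous_on S (deriv m)"
    using holomorphic_on_imp_continuous_on[OF holomorphic_deriv[OF m open_ball]] S continuous_on_subset by blast
  hence "bounded (deriv m ` S)"
    by (intro compact_imp_bounded compact_continuous_image) (auto simp: S_def)
  then obtain L where L: "\<And>u. u \<in> S \<Longrightarrow> cmod (deriv m u) \<le> L" by (auto simp: bounded_iff)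
  have lip: "cmod (m u - m v) \<le> L * cmod (u - v)" if "u \<in> S" "v \<in> S" for u v
  proof (rule field_differentiable_bound[of S m "deriv m"])
    show "convex S" by (simp add: S_def)
    show "(m has_field_derivative deriv m z) (at z within S)" if "z \<in> S" for z
      using holomorphic_derivI[OF m open_ball] S that has_field_derivative_at_within by blast
  qed (use L that in auto)
  \<comment> \<open>Then |y' - y| + e \<le> r/2, so \<open>u\<close> and \<open>cnj u\<close> stay
    in \<open>S\<close>, where the derivative is bounded.\<close>
  define \<delta> where "\<delta> = r / 4"
  have \<delta>: "0 < \<delta>" using r by (simp add: \<delta>_def)
  have small: "measure M {y' - e..y' + e} \<le> 2 * L * e\<^sup>2" if y': "\<bar>y' - y\<bar> \<le> \<delta>" and e: "0 < e" "e \<le> \<delta>" for y' e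
  proof -
    define u where "u = Complex y' e"
    have uS: "u \<in> S" "cnj u \<in> S"
    proof -
      have "cmod (u - of_real y) \<le> \<bar>y' - y\<bar> + \<bar>e\<bar>"
        using cmod_le[of "u - of_real y"] by (simp add: u_def)
      also have "\<dots> \<le> r / 2" using y' e by (simp add: \<delta>_def)
      finally have *: "cmod (u - of_real y) \<le> r / 2" .
      thus "u \<in> S" by (simp add: S_def dist_norm norm_minus_commute)
      have "cmod (cnj u - of_real y) = cmod (u - of_real y)"
        by (metis complex_cnj_complex_of_real complex_cnj_diff complex_mod_cnj)
      with * show "cnj u \<in> S" by (simp add: S_def dist_norm norm_minus_commute)
    qed
    have "m (cnj u) = cnj (m u)"
    proof -
      have "u \<in> ball (complex_of_real y) r" "cnj u \<in> ball (complex_of_real y) r" using uS S by blast+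
      thus ?thesis using eq[of u] eq[of "cnj u"] e Cauchy_transform_cnj[of u] by (simp add: u_def)
    qed
    \<comment> \<open>Conjugation symmetry turns the Lipschitz bound into 2 |Im (m u)| \<le> L * 2
      e.\<close>
    hence "cmod (m u - m (cnj u)) = 2 * \<bar>Im (m u)\<bar>"
      by (simp add: complex_diff_cnj norm_mult)
    moreover have "cmod (u - cnj u) = 2 * e"
      using e by (simp add: complex_diff_cnj norm_mult u_def)
    ultimately have "Im (m u) \<le> L * e" using lip[OF uS] by simp
    hence "2 * e * Im (m u) \<le> 2 * e * (L * e)" using e by (intro mult_left_mono) auto
    moreover have "m u = (\<integral>t. 1 / (complex_of_real t - Complex y' e) \<partial>M)"
      using eq[of u] uS S e by (auto simp: u_def)
    ultimately show ?thesis
      using measure_interval_le_Cauchy_transform[OF e(1), of y'] by (simp add: power2_eq_square mult_ac)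
  qed
  have "measure M {y - \<delta>..y + \<delta>} \<le> 2 * L * \<delta>\<^sup>2 / real (Suc n)" for n
  proof -
    define e where "e = \<delta> / real (Suc n)"
    \<comment> \<open>Centres of n + 1 abutting intervals of length 2 e that fill the interval of
      length 2 \<delta>. Each has mass at most 2 L e^2, so the total is of order 1/(n + 1).\<close>
    define c where "c k = y - \<delta> + (2 * real k + 1) * e" for k
    have e: "0 < e" "e \<le> \<delta>" using \<delta> by (simp_all add: e_def field_simps)
    have ne: "real (Suc n) * e = \<delta>" by (simp add: e_def)
    have sub: "{y - \<delta>..y + \<delta>} \<subseteq> (\<Union>k\<le>n. {c k - e..c k + e})"
    proof
      fix t assume t: "t \<in> {y - \<delta>..y + \<delta>}"
      define q where "q = (t - (y - \<delta>)) / (2 * e)"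
      define k where "k = min n (nat \<lfloor>q\<rfloor>)"
      have q0: "0 \<le> q" using t e by (simp add: q_def)
      have q1: "q \<le> real (Suc n)" using t e ne by (simp add: q_def field_simps)
      have "real k \<le> q" using q0 by (simp add: k_def min_def) linarith
      moreover have "q \<le> real k + 1"
      proof (cases "n \<le> nat \<lfloor>q\<rfloor>")
        case True thus ?thesis using q1 by (simp add: k_def)
      next
        case False
        hence "k = nat \<lfloor>q\<rfloor>" by (simp add: k_def)
        thus ?thesis using q0 by linarith
      qed
      moreover have "t = y - \<delta> + 2 * e * q" using e by (simp add: q_def)
      ultimately have "t \<in> {c k - e..c k + e}"
        using e mult_left_mono[of "real k" q "2 * e"] mult_left_mono[of q "real k + 1" "2 * e"]
        by (simp add: c_def algebra_simps)
      moreover have "k \<le> n" by (simp add: k_def)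
      ultimately show "t \<in> (\<Union>k\<le>n. {c k - e..c k + e})" by blast
    qed
    have "measure M {y - \<delta>..y + \<delta>} \<le> measure M (\<Union>k\<le>n. {c k - e..c k + e})"
      by (rule finite_measure_mono[OF sub]) auto
    also have "\<dots> \<le> (\<Sum>k\<le>n. measure M {c k - e..c k + e})"
      by (rule finite_measure_subadditive_finite) auto
    also have "\<dots> \<le> (\<Sum>k\<le>n. 2 * L * e\<^sup>2)"
    proof (intro sum_mono small e)
      fix k assume k: "k \<in> {..n}"
      have "0 \<le> (2 * real k + 1) * e" using e by simp
      moreover have "(2 * real k + 1) * e \<le> (2 * real n + 1) * e" using k e by (intro mult_right_mono) auto
      moreover have "(2 * real n + 1) * e + e = 2 * \<delta>" using ne by (simp add: algebra_simps)
      ultimately show "\<bar>c k - y\<bar> \<le> \<delta>" using e unfolding c_def by linarith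
    qed
    also have "\<dots> = real (Suc n) * (2 * L * e\<^sup>2)" by simp
    also have "\<dots> = 2 * L * \<delta>\<^sup>2 / real (Suc n)"
      by (simp add: e_def power2_eq_square del: of_nat_Suc)
    finally show ?thesis .
  qed
  moreover have "(\<lambda>n. 2 * L * \<delta>\<^sup>2 / real (Suc n)) \<longlonglongrightarrow> 0"
    using tendsto_mult[OF tendsto_const LIMSEQ_Suc[OF lim_1_over_n]] by simp
  ultimately have "measure M {y - \<delta>..y + \<delta>} \<le> 0"
    by (intro LIMSEQ_le_const) auto
  thus ?thesis using \<delta> measure_nonneg[of M] by (intro exI[of _ \<delta>]) (simp add: antisym)
qed

context jacobi begin

context
  fixes \<mu> :: "real measure"
  assumes \<mu>: "real_distribution \<mu>"
    and F_stieltjes: "\<And>z. Im z \<noteq> 0 \<Longrightarrow>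
      (of_real (lam 0) - z) * (\<integral>t. 1 / (complex_of_real t - z) \<partial>\<mu>) * F z 0 = F z 1"
    and F_nz: "\<And>z. Im z \<noteq> 0 \<Longrightarrow> F z 0 \<noteq> 0"
begin

interpretation \<mu>: real_distribution \<mu> by (rule \<mu>)

context
  fixes x d :: real and N :: nat
  assumes clear: "clear_ball (complex_of_real x) d N"
begin

lemma G_stieltjes:
  assumes u: "u \<in> ball (of_real x) d" "Im u \<noteq> 0"
  shows "G N 1 u = (\<integral>t. 1 / (complex_of_real t - u) \<partial>\<mu>) * G N 0 u" "G N 0 u \<noteq> 0"
proof -
  have ne: "of_real (lam k) \<noteq> u" for k using u(2) by auto
  note G = G_eq_F[OF clear u(1) ne]
  have "of_real (lam 0) - u \<noteq> 0" using ne[of 0] by simp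
  thus "G N 1 u = (\<integral>t. 1 / (complex_of_real t - u) \<partial>\<mu>) * G N 0 u"
    unfolding G F_stieltjes[OF u(2), symmetric] by simp
  show "G N 0 u \<noteq> 0" unfolding G using F_nz[OF u(2)] ne by auto
qed

lemma isCont_G: "isCont (G N j) (of_real x)"
  using G_holomorphic[OF clear, of j] clear_ball_pos[OF clear]
  by (meson centre_in_ball continuous_on_eq_continuous_at holomorphic_on_imp_continuous_on open_ball)

text \<open>Multiply the relation between \<open>G N 1\<close> and \<open>G N 0\<close> by u - x and
  let u tend to x vertically: the Cauchy transform times u - x tends to minus the atom. Where
  \<open>G N 0\<close> vanishes, its difference quotient takes over and yields the residue, without
  assuming a simple zero.\<close>

lemma measure_atom_G:
  "of_real (measure \<mu> {x}) * G N 0 (of_real x) = 0"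
  "G N 0 (of_real x) = 0 \<Longrightarrow> of_real (measure \<mu> {x}) * deriv (G N 0) (of_real x) = - G N 1 (of_real x)"
proof -
  define u where "u n = complex_of_real x + \<i> / of_nat (Suc n)" for n
  define s where "s z = (\<integral>t. 1 / (complex_of_real t - z) \<partial>\<mu>)" for z
  have ux: "u n - of_real x = \<i> / of_nat (Suc n)" for n by (simp add: u_def)
  have ux0: "u n - of_real x \<noteq> 0" for n unfolding ux by (simp del: of_nat_Suc)
  have Im_u: "Im (u n) \<noteq> 0" for n by (simp add: u_def Im_divide_of_nat del: of_nat_Suc)
  have u_lim0: "(\<lambda>n. u n - of_real x) \<longlonglongrightarrow> 0"
    unfolding ux using tendsto_mult[OF tendsto_const[of \<i>] LIMSEQ_Suc[OF lim_1_over_n[where 'a = complex]]]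
    by simp
  hence u_lim: "u \<longlonglongrightarrow> of_real x" by (simp add: LIM_zero_iff)
  have ub: "\<forall>\<^sub>F n in sequentially. u n \<in> ball (of_real x) d"
    using clear_ball_pos[OF clear] by (intro topological_tendstoD[OF u_lim]) auto
  have "(\<lambda>n. \<integral>t. of_real 1 * ((u n - of_real x) / (complex_of_real t - u n)) \<partial>\<mu>) \<longlonglongrightarrow> - of_real (1 * measure \<mu> {x})"
    unfolding u_def by (rule \<mu>.Cauchy_kernel_atom_limit) simp
  moreover have "(\<integral>t. of_real 1 * ((u n - of_real x) / (complex_of_real t - u n)) \<partial>\<mu>) = (u n - of_real x) * s (u n)" for n
    using integral_mult_right_zero[of \<mu> "u n - of_real x" "\<lambda>t. 1 / (complex_of_real t - u n)"]
    by (simp add: s_def)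
  ultimately have s_lim: "(\<lambda>n. (u n - of_real x) * s (u n)) \<longlonglongrightarrow> - of_real (measure \<mu> {x})" by simp
  have G_lim: "(\<lambda>n. G N j (u n)) \<longlonglongrightarrow> G N j (of_real x)" for j
    using isCont_tendsto_compose[OF isCont_G u_lim] .
  have "(\<lambda>n. (u n - of_real x) * s (u n) * G N 0 (u n)) \<longlonglongrightarrow> - of_real (measure \<mu> {x}) * G N 0 (of_real x)"
    by (intro tendsto_intros s_lim G_lim)
  moreover have "\<forall>\<^sub>F n in sequentially. (u n - of_real x) * s (u n) * G N 0 (u n) = (u n - of_real x) * G N 1 (u n)"
    using ub by eventually_elim (simp add: G_stieltjes(1)[unfolded One_nat_def, OF _ Im_u] s_def)
  ultimately have "(\<lambda>n. (u n - of_real x) * G N 1 (u n)) \<longlonglongrightarrow> - of_real (measure \<mu> {x}) * G N 0 (of_real x)"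
    by (rule Lim_transform_eventually)
  moreover have "(\<lambda>n. (u n - of_real x) * G N 1 (u n)) \<longlonglongrightarrow> 0 * G N 1 (of_real x)"
    by (intro tendsto_intros u_lim0 G_lim)
  ultimately show "of_real (measure \<mu> {x}) * G N 0 (of_real x) = 0"
    using LIMSEQ_unique by fastforce
  assume G0: "G N 0 (of_real x) = 0"
  have "(G N 0 has_field_derivative deriv (G N 0) (of_real x)) (at (of_real x))"
    using clear_ball_pos[OF clear] by (intro holomorphic_derivI[OF G_holomorphic[OF clear]]) auto
  hence "((\<lambda>z. (G N 0 z - G N 0 (of_real x)) / (z - of_real x)) \<longlongrightarrow> deriv (G N 0) (of_real x)) (at (of_real x))"
    by (simp add: has_field_derivative_iff)
  moreover have "filterlim u (at (of_real x)) sequentially"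
    using u_lim ux0 by (intro filterlim_atI) auto
  ultimately have "(\<lambda>n. (G N 0 (u n) - G N 0 (of_real x)) / (u n - of_real x)) \<longlonglongrightarrow> deriv (G N 0) (of_real x)"
    by (rule filterlim_compose)
  hence q_lim: "(\<lambda>n. G N 0 (u n) / (u n - of_real x)) \<longlonglongrightarrow> deriv (G N 0) (of_real x)" by (simp add: G0)
  have "(\<lambda>n. (u n - of_real x) * s (u n) * (G N 0 (u n) / (u n - of_real x)))
      \<longlonglongrightarrow> - of_real (measure \<mu> {x}) * deriv (G N 0) (of_real x)"
    by (intro tendsto_intros s_lim q_lim)
  moreover have "\<forall>\<^sub>F n in sequentially. (u n - of_real x) * s (u n) * (G N 0 (u n) / (u n - of_real x)) = G N 1 (u n)"
    using ub by eventually_elim (use ux0 in \<open>simp add: G_stieltjes(1)[unfolded One_nat_def, OF _ Im_u] s_def\<close>)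
  ultimately have "(\<lambda>n. G N 1 (u n)) \<longlonglongrightarrow> - of_real (measure \<mu> {x}) * deriv (G N 0) (of_real x)"
    by (rule Lim_transform_eventually)
  from LIMSEQ_unique[OF G_lim this]
  show "of_real (measure \<mu> {x}) * deriv (G N 0) (of_real x) = - G N 1 (of_real x)" by simp
qed

lemma atom_iff_G: "0 < measure \<mu> {x} \<longleftrightarrow> G N 0 (of_real x) = 0"
proof
  assume "0 < measure \<mu> {x}"
  thus "G N 0 (of_real x) = 0" using measure_atom_G(1) by simp
next
  assume 0: "G N 0 (of_real x) = 0"
  have "G N 1 (of_real x) \<noteq> 0"
    using G_not_both_0[OF clear _ 0] clear_ball_pos[OF clear] by force
  hence "measure \<mu> {x} \<noteq> 0" using measure_atom_G(2)[OF 0] by auto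
  thus "0 < measure \<mu> {x}" using measure_nonneg[of \<mu> "{x}"] by linarith
qed

text \<open>There \<open>G N 1 / G N 0\<close> continues the Cauchy transform analytically across
  the real line.\<close>

lemma null_near_G_nonzero:
  assumes "G N 0 (of_real x) \<noteq> 0"
  shows "\<exists>\<delta>>0. measure \<mu> {x - \<delta>..x + \<delta>} = 0"
proof -
  have "\<forall>\<^sub>F z in nhds (complex_of_real x). G N 0 z \<noteq> 0"
    using isCont_G[of 0] assms
    by (intro tendsto_imp_eventually_ne) (auto simp: isCont_def tendsto_at_iff_tendsto_nhds)
  then obtain r0 where r0: "0 < r0" "\<And>z. z \<in> ball (complex_of_real x) r0 \<Longrightarrow> G N 0 z \<noteq> 0"
    by (auto simp: eventually_nhds_metric dist_commute)
  define r where "r = min r0 d"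
  have sub: "ball (complex_of_real x) r \<subseteq> ball (of_real x) d" "ball (complex_of_real x) r \<subseteq> ball (of_real x) r0"
    by (auto simp: r_def)
  show ?thesis
  proof (rule \<mu>.null_near_regular_point[of "\<lambda>z. G N 1 z / G N 0 z" x r])
    show "(\<lambda>z. G N 1 z / G N 0 z) holomorphic_on ball (complex_of_real x) r"
      using G_holomorphic[OF clear] sub r0
      by (intro holomorphic_intros holomorphic_on_subset[OF _ sub(1)]) auto
    show "0 < r" using r0 clear_ball_pos[OF clear] by (simp add: r_def)
    show "G N 1 u / G N 0 u = (\<integral>t. 1 / (complex_of_real t - u) \<partial>\<mu>)"
      if "u \<in> ball (complex_of_real x) r" "Im u \<noteq> 0" for u
      using G_stieltjes[of u] that sub by (auto simp: nonzero_divide_eq_eq)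
  qed
qed

end

lemma atom_iff_frakZ:
  assumes x: "x \<notin> der lam"
  shows "0 < measure \<mu> {x} \<longleftrightarrow> complex_of_real x \<in> frakZ lam w"
proof -
  have xc: "complex_of_real x \<notin> of_real ` der lam" using x by auto
  obtain d N where c: "clear_ball (complex_of_real x) d N"
    using clear_ball_exists[OF xc] by blast
  show ?thesis using atom_iff_G[OF c] frakZ_iff[OF c] by simp
qed

text \<open>Every point of the complement has a null neighbourhood, and by Lindelof countably many
  of these cover it.\<close>

lemma AE_der_or_frakZ: "AE x in \<mu>. x \<in> der lam \<or> complex_of_real x \<in> frakZ lam w"
proof -
  define U where "U = {x. x \<notin> der lam \<and> complex_of_real x \<notin> frakZ lam w}"
  have "\<exists>\<delta>>0. measure \<mu> {x - \<delta>..x + \<delta>} = 0" if "x \<in> U" for x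
  proof -
    have x: "x \<notin> der lam" and xc: "complex_of_real x \<notin> of_real ` der lam" using that by (auto simp: U_def)
    obtain d N where c: "clear_ball (complex_of_real x) d N"
      using clear_ball_exists[OF xc] by blast
    show ?thesis using null_near_G_nonzero[OF c] frakZ_iff[OF c] that by (auto simp: U_def)
  qed
  then obtain \<delta> where \<delta>: "\<And>x. x \<in> U \<Longrightarrow> 0 < \<delta> x \<and> measure \<mu> {x - \<delta> x..x + \<delta> x} = 0" by metis
  define I where "I x = {x - \<delta> x<..<x + \<delta> x}" for x
  have "\<And>S. S \<in> I ` U \<Longrightarrow> open S" by (auto simp: I_def)
  from Lindelof[OF this] obtain \<F>' where F': "\<F>' \<subseteq> I ` U" "countable \<F>'" "\<Union>\<F>' = \<Union>(I ` U)"
    by blast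
  have "AE x in \<mu>. \<forall>S\<in>\<F>'. x \<notin> S"
  proof (subst AE_ball_countable[OF F'(2)], intro ballI)
    fix S assume "S \<in> \<F>'"
    then obtain x where x: "x \<in> U" "S = I x" using F'(1) by auto
    have "measure \<mu> S \<le> measure \<mu> {x - \<delta> x..x + \<delta> x}"
      unfolding x(2) I_def by (intro \<mu>.finite_measure_mono) auto
    hence "measure \<mu> S = 0" using \<delta>[OF x(1)] measure_nonneg[of \<mu> S] by simp
    hence "S \<in> null_sets \<mu>" by (intro null_setsI) (auto simp: \<mu>.emeasure_eq_measure x(2) I_def)
    thus "AE x in \<mu>. x \<notin> S" by (rule AE_not_in)
  qed
  moreover have "U \<subseteq> \<Union>\<F>'" unfolding F'(3) using \<delta> by (force simp: I_def)
  ultimately show ?thesis by (auto simp: U_def elim!: eventually_mono)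
qed

text \<open>Off the range of \<open>lam\<close> some ball avoids every diagonal entry, so
  \<open>N = 0\<close> is allowed: no pole has to be removed and \<open>G 0 0\<close> is the
  characteristic function. The residue relation with \<open>G 0 1\<close> nonzero shows that its
  zero is simple.\<close>

lemma jump_formula:
  assumes xZ: "complex_of_real x \<in> frakZ lam w" and xr: "x \<notin> range lam"
  shows "char_fun lam w field_differentiable at (complex_of_real x)"
    and "deriv (char_fun lam w) (complex_of_real x) \<noteq> 0"
    and "complex_of_real (measure \<mu> {x}) = 1 / complex_of_real (x - lam 0) *
          frakF (\<lambda>k. of_real ((gam w (k + 1))\<^sup>2) / of_real (lam (k + 1) - x)) *
          inverse (deriv (char_fun lam w) (complex_of_real x))"
proof -
  have xc: "complex_of_real x \<notin> of_real ` der lam" and x: "x \<notin> der lam" using xZ by (auto simp: frakZ_def)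
  have "\<exists>d>0. \<forall>k. d \<le> cmod (complex_of_real (lam k) - of_real x)"
  proof -
    obtain d N where dN: "0 < d" "\<And>k. k \<ge> N \<Longrightarrow> d \<le> cmod (complex_of_real (lam k) - of_real x)"
      using eventually_away_from_non_cluster_point[OF xc] by blast
    define d' where "d' = Min (insert d ((\<lambda>k. cmod (complex_of_real (lam k) - of_real x)) ` {..<N}))"
    have "0 < d'" unfolding d'_def using dN(1) xr by (subst Min_gr_iff) auto
    moreover have "d' \<le> cmod (complex_of_real (lam k) - of_real x)" for k
    proof (cases "k < N")
      case True thus ?thesis unfolding d'_def by (intro Min_le) auto
    next
      case False
      have "d' \<le> d" unfolding d'_def by (intro Min_le) auto
      thus ?thesis using dN(2)[of k] False by simp
    qed
    ultimately show ?thesis by blast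
  qed
  then obtain d where d: "0 < d" "\<And>k. d \<le> cmod (complex_of_real (lam k) - of_real x)" by blast
  have away: "d / 2 \<le> cmod (of_real (lam k) - z)" if "z \<in> ball (complex_of_real x) (d / 2)" for z k
    using d(2)[of k] that norm_triangle_ineq[of "of_real (lam k) - z" "z - of_real x"]
    by (simp add: dist_norm norm_minus_commute)
  have d2: "0 < d / 2" using d by simp
  have c: "clear_ball (of_real x) (d / 2) 0" using d2 away by (simp add: clear_ball_def)
  have G0: "G 0 0 (of_real x) = 0"
    using frakZ_iff[OF c] xZ by blast
  note meas = measure_atom_G(2)[OF c G0]
  have pos: "0 < measure \<mu> {x}" using atom_iff_frakZ[OF x] xZ by simp
  have G1: "G 0 1 (of_real x) = F (of_real x) 1 / (of_real (lam 0) - of_real x)"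
    by (simp add: G.simps)
  have hol: "G 0 0 holomorphic_on ball (of_real x) (d / 2)"
    by (rule G_holomorphic[OF c])
  have char: "char_fun lam w z = G 0 0 z" if "z \<in> ball (complex_of_real x) (d / 2)" for z
  proof -
    have "z \<notin> of_real ` der lam" by (rule ball_not_der[OF c that])
    thus ?thesis by (simp add: char_fun_eq_F G.simps)
  qed
  have "(G 0 0 has_field_derivative deriv (G 0 0) (of_real x)) (at (of_real x))"
    using d by (intro holomorphic_derivI[OF hol]) auto
  hence der: "(char_fun lam w has_field_derivative deriv (G 0 0) (of_real x)) (at (of_real x))"
    by (rule has_field_derivative_transform_within_open[of _ _ _ "ball (of_real x) (d / 2)"]) (use d char in auto)
  hence der_eq: "deriv (char_fun lam w) (of_real x) = deriv (G 0 0) (of_real x)" by (rule DERIV_imp_deriv)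
  show "char_fun lam w field_differentiable at (complex_of_real x)"
    using der field_differentiable_def by blast
  have "G 0 1 (of_real x) \<noteq> 0"
    using G_not_both_0[OF c _ G0] d2 by force
  hence D0: "deriv (G 0 0) (of_real x) \<noteq> 0" using meas by auto
  thus "deriv (char_fun lam w) (complex_of_real x) \<noteq> 0" by (simp add: der_eq)
  have x0: "complex_of_real (lam 0) - of_real x \<noteq> 0" using xr by auto
  have Fr: "frakF (\<lambda>k. of_real ((gam w (k + 1))\<^sup>2) / of_real (lam (k + 1) - x)) = F (of_real x) 1"
    using frakF_shift_eq_F[OF xc] by simp
  have "complex_of_real (measure \<mu> {x}) = - G 0 1 (of_real x) / deriv (G 0 0) (of_real x)"
    using arg_cong[OF meas, of "\<lambda>t. t / deriv (G 0 0) (of_real x)"] D0 by simp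
  also have "\<dots> = 1 / complex_of_real (x - lam 0) * F (of_real x) 1 * inverse (deriv (G 0 0) (of_real x))"
    unfolding G1 using x0 D0 by (simp add: divide_simps) (simp add: algebra_simps)
  finally show "complex_of_real (measure \<mu> {x}) = 1 / complex_of_real (x - lam 0) *
          frakF (\<lambda>k. of_real ((gam w (k + 1))\<^sup>2) / of_real (lam (k + 1) - x)) *
          inverse (deriv (char_fun lam w) (complex_of_real x))"
    unfolding Fr der_eq .
qed

end
end

section \<open>The maximal operator\<close>

text \<open>Let A be the sum of q over a window whose end points satisfy q \<le> B. Shifting the
  index adds at most one end point, so summing the inequality gives 8 A \<le> 8 suminf b + 2 B + 4
  A, a bound independent of the window. Such windows exhaust the indices.\<close>

lemma summable_of_recurrent_small_bound:
  fixes q b :: "nat \<Rightarrow> real"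
  assumes q: "\<And>n. 0 \<le> q n" and b: "\<And>n. 0 \<le> b n" "summable b"
    and rec: "\<And>n. n > N \<Longrightarrow> q n \<le> b n + (q (n - 1) + 2 * q n + q (n + 1)) / 8"
    and inf: "\<And>n. \<exists>m\<ge>n. q m \<le> B"
  shows "summable q"
proof -
  obtain N' where N': "N' \<ge> N" "q N' \<le> B" using inf by blast
  have B0: "0 \<le> B" using q[of N'] N' by linarith
  define C where "C = 2 * suminf b + B / 2"
  have inner: "(\<Sum>n\<in>{N'<..<m}. q n) \<le> C" if m: "m > N'" "q m \<le> B" for m
  proof -
    define A where "A = (\<Sum>n\<in>{N'<..<m}. q n)"
    have "A \<le> (\<Sum>n\<in>{N'<..<m}. b n + (q (n - 1) + 2 * q n + q (n + 1)) / 8)"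
      unfolding A_def using N'(1) by (intro sum_mono rec) auto
    also have "\<dots> = (\<Sum>n\<in>{N'<..<m}. b n) + ((\<Sum>n\<in>{N'<..<m}. q (n - 1)) + 2 * A + (\<Sum>n\<in>{N'<..<m}. q (n + 1))) / 8"
      by (simp add: A_def sum.distrib sum_divide_distrib[symmetric] sum_distrib_left[symmetric])
    also have "(\<Sum>n\<in>{N'<..<m}. b n) \<le> suminf b"
      using b by (intro sum_le_suminf) auto
    also have "(\<Sum>n\<in>{N'<..<m}. q (n - 1)) \<le> q N' + A"
    proof -
      have "(\<Sum>n\<in>{N'<..<m}. q (n - 1)) = (\<Sum>n\<in>(\<lambda>n. n - 1) ` {N'<..<m}. q n)"
        by (subst sum.reindex) (auto simp: inj_on_def)
      also have "\<dots> \<le> (\<Sum>n\<in>insert N' {N'<..<m}. q n)"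
        by (intro sum_mono2 q) auto
      finally show ?thesis by (simp add: A_def)
    qed
    also have "(\<Sum>n\<in>{N'<..<m}. q (n + 1)) \<le> q m + A"
    proof -
      have "(\<Sum>n\<in>{N'<..<m}. q (n + 1)) = (\<Sum>n\<in>(\<lambda>n. n + 1) ` {N'<..<m}. q n)"
        by (subst sum.reindex) auto
      also have "\<dots> \<le> (\<Sum>n\<in>insert m {N'<..<m}. q n)"
        by (intro sum_mono2 q) auto
      finally show ?thesis by (simp add: A_def)
    qed
    finally have "A \<le> suminf b + (q N' + A + 2 * A + (q m + A)) / 8" by simp
    hence "8 * A \<le> 8 * suminf b + q N' + q m + 4 * A" by (simp add: field_simps)
    hence "4 * A \<le> 8 * suminf b + 2 * B" using N'(2) m(2) by linarith
    thus ?thesis unfolding A_def[symmetric] C_def by simp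
  qed
  show ?thesis
  proof (rule summableI_nonneg_bounded[OF q])
    fix n
    obtain m where m: "m \<ge> max n (Suc N')" "q m \<le> B" using inf by blast
    have "sum q {..<n} \<le> sum q ({..N'} \<union> {N'<..<m})"
      using m by (intro sum_mono2 q) auto
    also have "\<dots> = sum q {..N'} + sum q {N'<..<m}" by (rule sum.union_disjoint) auto
    also have "\<dots> \<le> sum q {..N'} + C" using inner[of m] m by simp
    finally show "sum q {..<n} \<le> sum q {..N'} + C" .
  qed
qed

section \<open>Square summable sequences\<close>

lemma l2_cmult: "f \<in> l2 \<Longrightarrow> (\<lambda>n. c * f n) \<in> l2"
  by (simp add: l2_def norm_mult power_mult_distrib summable_mult)

lemma l2_add:
  assumes "f \<in> l2" "g \<in> l2"
  shows "(\<lambda>n. f n + g n) \<in> l2"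
proof -
  have le: "(cmod (f n + g n))\<^sup>2 \<le> 2 * (cmod (f n))\<^sup>2 + 2 * (cmod (g n))\<^sup>2" for n
  proof -
    have "(cmod (f n + g n))\<^sup>2 \<le> (cmod (f n) + cmod (g n))\<^sup>2"
      by (intro power_mono norm_triangle_ineq) auto
    also have "\<dots> \<le> 2 * (cmod (f n))\<^sup>2 + 2 * (cmod (g n))\<^sup>2"
      using zero_le_power2[of "cmod (f n) - cmod (g n)"] by (simp add: power2_sum power2_diff)
    finally show ?thesis .
  qed
  have "summable (\<lambda>n. 2 * (cmod (f n))\<^sup>2 + 2 * (cmod (g n))\<^sup>2)"
    using assms by (intro summable_add summable_mult) (auto simp: l2_def)
  thus ?thesis unfolding l2_def mem_Collect_eq
    by (rule summable_comparison_test'[where N = 0]) (use le in simp)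
qed

lemma mult_le_sum_squares:
  fixes x y :: real
  assumes "0 \<le> x" "0 \<le> y"
  shows "x * y \<le> x\<^sup>2 + y\<^sup>2"
  using sum_squares_bound[of x y] mult_nonneg_nonneg[OF assms] by linarith

lemma l2_summable_mult:
  assumes "f \<in> l2" "g \<in> l2"
  shows "summable (\<lambda>n. f n * g n)"
proof -
  have le: "cmod (f n * g n) \<le> (cmod (f n))\<^sup>2 + (cmod (g n))\<^sup>2" for n
    unfolding norm_mult by (intro mult_le_sum_squares norm_ge_zero)
  have "summable (\<lambda>n. (cmod (f n))\<^sup>2 + (cmod (g n))\<^sup>2)"
    using assms by (intro summable_add) (auto simp: l2_def)
  thus ?thesis
    by (rule summable_comparison_test'[where N = 0]) (rule le)
qed

lemma l2_cnj: "(\<lambda>n. cnj (f n)) \<in> l2 \<longleftrightarrow> f \<in> l2"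
  by (simp add: l2_def)

lemma l2_finite_support: "(\<And>n. n \<ge> N \<Longrightarrow> f n = 0) \<Longrightarrow> f \<in> l2"
  unfolding l2_def mem_Collect_eq by (rule summable_finite[of "{..<N}"]) auto

lemma l2_inner_unit_seq: "l2_inner f (unit_seq n) = cnj (f n)" "l2_inner (unit_seq n) f = f n"
  unfolding l2_inner_def unit_seq_def
  by (subst suminf_finite[of "{n}"]; simp)+

section \<open>The formal Jacobi expression and its self-adjoint realisation\<close>

context jacobi begin

definition Jac :: "(nat \<Rightarrow> complex) \<Rightarrow> nat \<Rightarrow> complex" where
  "Jac f n = (case n of 0 \<Rightarrow> 0 | Suc k \<Rightarrow> of_real (w k) * f k) + of_real (lam n) * f n + of_real (w n) * f (n + 1)"

lemma Jac_simps:
  "Jac f 0 = of_real (lam 0) * f 0 + of_real (w 0) * f 1"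
  "Jac f (Suc k) = of_real (w k) * f k + of_real (lam (Suc k)) * f (Suc k) + of_real (w (Suc k)) * f (Suc (Suc k))"
  by (simp_all add: Jac_def)

lemma green:
  "(\<Sum>k\<le>n. u k * Jac v k - Jac u k * v k) = of_real (w n) * (u n * v (Suc n) - u (Suc n) * v n)"
  by (induction n) (simp_all add: Jac_simps algebra_simps)

lemma Jac_lincomb: "Jac (\<lambda>n. a * f n + b * g n) = (\<lambda>n. a * Jac f n + b * Jac g n)"
proof
  fix n show "Jac (\<lambda>n. a * f n + b * g n) n = a * Jac f n + b * Jac g n"
    by (cases n) (simp_all add: Jac_simps algebra_simps)
qed

lemma Jac_cnj: "Jac (\<lambda>n. cnj (f n)) = (\<lambda>n. cnj (Jac f n))"
proof
  fix n show "Jac (\<lambda>n. cnj (f n)) n = cnj (Jac f n)" by (cases n) (simp_all add: Jac_simps)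
qed

lemma Jac_unit_seq: "Jac (unit_seq n) = (\<lambda>m. jacobi_matrix lam w m n)"
proof
  fix m show "Jac (unit_seq n) m = jacobi_matrix lam w m n"
    by (cases m) (auto simp: Jac_simps unit_seq_def jacobi_matrix_def)
qed

lemma Jac_eigen_iff:
  "Jac f = (\<lambda>n. z * f n) \<longleftrightarrow> f = (\<lambda>n. f 0 * Pz n z)"
proof
  assume J: "Jac f = (\<lambda>n. z * f n)"
  show "f = (\<lambda>n. f 0 * Pz n z)"
  proof
    fix n show "f n = f 0 * Pz n z"
    proof (induction n rule: Pc.induct)
      case 2
      have "of_real (w 0) * f (Suc 0) = f 0 * (of_real (w 0) * Pz (Suc 0) z)"
        unfolding Pz_rec_0 using fun_cong[OF J, of 0] by (simp add: Jac_simps algebra_simps)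
      hence "of_real (w 0) * f (Suc 0) = of_real (w 0) * (f 0 * Pz (Suc 0) z)" by (simp only: mult_ac)
      thus ?case by (simp del: Pc.simps)
    next
      case (3 k)
      have "of_real (w (Suc k)) * f (Suc (Suc k)) = (z - of_real (lam (Suc k))) * f (Suc k) - of_real (w k) * f k"
        using fun_cong[OF J, of "Suc k"] by (simp add: Jac_simps algebra_simps)
      also have "\<dots> = f 0 * (of_real (w (Suc k)) * Pz (Suc (Suc k)) z)"
        unfolding Pz_rec 3 by (simp add: algebra_simps del: Pc.simps)
      finally have "of_real (w (Suc k)) * f (Suc (Suc k)) = of_real (w (Suc k)) * (f 0 * Pz (Suc (Suc k)) z)"
        by (simp only: mult_ac)
      thus ?case by (simp del: Pc.simps)
    qed simp
  qed
next
  assume f: "f = (\<lambda>n. f 0 * Pz n z)"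
  have "Jac (\<lambda>n. c * Pz n z) = (\<lambda>n. z * (c * Pz n z))" for c
  proof
    fix n show "Jac (\<lambda>n. c * Pz n z) n = z * (c * Pz n z)"
    proof (cases n)
      case 0
      have "Jac (\<lambda>n. c * Pz n z) 0 = c * (of_real (lam 0) + of_real (w 0) * Pz (Suc 0) z)"
        by (simp add: Jac_simps algebra_simps del: Pc.simps(2))
      thus ?thesis unfolding Pz_rec_0 by (simp add: 0)
    next
      case (Suc k)
      have "Jac (\<lambda>n. c * Pz n z) (Suc k) = c * (of_real (w k) * Pz k z + of_real (lam (Suc k)) * Pz (Suc k) z
          + of_real (w (Suc k)) * Pz (Suc (Suc k)) z)"
        by (simp add: Jac_simps algebra_simps del: Pc.simps)
      thus ?thesis unfolding Pz_rec by (simp add: Suc algebra_simps del: Pc.simps)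
    qed
  qed
  thus "Jac f = (\<lambda>n. z * f n)" using f by metis
qed

text \<open>The largest domain on which the formal expression stays in \<open>l2\<close>, with no
  boundary condition at infinity.\<close>

definition max_op :: l2_graph where
  "max_op = {(f, g). f \<in> l2 \<and> g \<in> l2 \<and> g = Jac f}"

text \<open>A finite cluster point of the diagonal puts \<open>J\<close> in the limit point case: between consecutive
  indices at which \<open>lam\<close> is bounded, the smallness of \<open>w\<close> relative to the diagonal controls
  \<open>\<Sum>\<bar>lam n - \<i>\<bar> \<bar>f n\<bar>\<^sup>2\<close>.\<close>

lemma summable_weighted:
  assumes der: "der lam \<noteq> {}" and f: "f \<in> l2" "Jac f \<in> l2"
  shows "summable (\<lambda>n. cmod (of_real (lam n) - \<i>) * (cmod (f n))\<^sup>2)"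
    and "\<exists>N. \<forall>n\<ge>N. (w n)\<^sup>2 \<le> cmod (of_real (lam n) - \<i>) * cmod (of_real (lam (n + 1)) - \<i>) / 16"
proof -
  \<comment> \<open>The nonreal point keeps the weight at least 1, whatever the diagonal, and
    \<open>summable_X\<close> applies there.\<close>
  define c where "c n = cmod (of_real (lam n) - \<i>)" for n
  have c1: "1 \<le> c n" for n using abs_Im_le_cmod[of "of_real (lam n) - \<i>"] by (simp add: c_def)
  have c0: "0 < c n" for n using c1[of n] by linarith
  have "summable (\<lambda>k. cmod (X \<i> k * X \<i> (k + 1)))" by (rule summable_X, rule nonreal_not_der) simp
  hence "(\<lambda>k. cmod (X \<i> k * X \<i> (k + 1))) \<longlonglongrightarrow> 0" by (rule summable_LIMSEQ_zero)
  \<comment> \<open>The value 1/16 makes \<open>w n\<close> at most a quarter of the geometric mean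
    of the adjacent weights; the arithmetic-geometric inequality then yields the factor 1/8 of
    \<open>summable_of_recurrent_small_bound\<close>.\<close>
  from LIMSEQ_D[OF this, of "1 / 16"] obtain N where N: "\<And>n. n \<ge> N \<Longrightarrow> cmod (X \<i> n * X \<i> (n + 1)) < 1 / 16" by auto
  have w16: "(w n)\<^sup>2 \<le> c n * c (n + 1) / 16" if "n \<ge> N" for n
    using N[OF that] c0[of n] c0[of "n + 1"] unfolding X_mult norm_divide norm_mult c_def[symmetric]
    by (simp add: field_simps norm_power)
  thus "\<exists>N. \<forall>n\<ge>N. (w n)\<^sup>2 \<le> cmod (of_real (lam n) - \<i>) * cmod (of_real (lam (n + 1)) - \<i>) / 16"
    unfolding c_def by blast
  have w4: "w n * cmod (f n) * cmod (f (n + 1)) \<le> (c n * (cmod (f n))\<^sup>2 + c (n + 1) * (cmod (f (n + 1)))\<^sup>2) / 8"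
    if "n \<ge> N" for n
  proof -
    define s where "s = sqrt (c n) * cmod (f n)"
    define t where "t = sqrt (c (n + 1)) * cmod (f (n + 1))"
    have "w n \<le> sqrt (c n * c (n + 1) / 16)" using w16[OF that] by (rule real_le_rsqrt)
    also have "\<dots> = sqrt (c n) * sqrt (c (n + 1)) / 4" by (simp add: real_sqrt_divide real_sqrt_mult)
    finally have "w n * (cmod (f n) * cmod (f (n + 1))) \<le> sqrt (c n) * sqrt (c (n + 1)) / 4 * (cmod (f n) * cmod (f (n + 1)))"
      by (intro mult_right_mono) auto
    also have "\<dots> = s * t / 4" by (simp add: s_def t_def)
    also have "\<dots> \<le> (s\<^sup>2 + t\<^sup>2) / 8" using zero_le_power2[of "s - t"] by (simp add: power2_diff)
    also have "s\<^sup>2 + t\<^sup>2 = c n * (cmod (f n))\<^sup>2 + c (n + 1) * (cmod (f (n + 1)))\<^sup>2"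
      using c0[of n] c0[of "n + 1"] by (simp add: s_def t_def power_mult_distrib)
    finally show ?thesis by (simp add: mult.assoc)
  qed
  define q where "q n = c n * (cmod (f n))\<^sup>2" for n
  define b where "b n = (cmod (Jac f n))\<^sup>2 + 2 * (cmod (f n))\<^sup>2" for n
  have b: "summable b" unfolding b_def using f by (intro summable_add summable_mult) (auto simp: l2_def)
  obtain l s where s: "strict_mono s" "(lam \<circ> s) \<longlonglongrightarrow> l" using der by (auto simp: der_def)
  have "Bseq (\<lambda>k. lam (s k))" using convergent_imp_Bseq[OF convergentI[OF s(2)]] by (simp add: o_def)
  then obtain K where K: "\<And>k. \<bar>lam (s k)\<bar> \<le> K" by (auto simp: Bseq_def)
  have f2: "summable (\<lambda>n. (cmod (f n))\<^sup>2)" using f by (simp add: l2_def)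
  have "summable q"
  proof (rule summable_of_recurrent_small_bound[where b = b and N = N])
    show "0 \<le> q n" "0 \<le> b n" for n using c0[of n] by (simp_all add: q_def b_def)
    show "q n \<le> b n + (q (n - 1) + 2 * q n + q (n + 1)) / 8" if n: "n > N" for n
    proof -
      obtain k where k: "n = Suc k" "k \<ge> N" using n by (cases n) auto
      \<comment> \<open>Row n of \<open>Jac f\<close>, multiplied by |f n| below: the diagonal term
        becomes \<open>q n\<close>, and each off-diagonal product is shared between two
        neighbours.\<close>
      have "(of_real (lam n) - \<i>) * f n = Jac f n - \<i> * f n - of_real (w k) * f k - of_real (w n) * f (n + 1)"
        unfolding k Jac_simps by (simp add: algebra_simps)
      hence "cmod ((of_real (lam n) - \<i>) * f n) \<le> cmod (Jac f n) + cmod (f n) + w k * cmod (f k) + w n * cmod (f (n + 1))"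
        using norm_triangle_ineq4[of "Jac f n - \<i> * f n - of_real (w k) * f k" "of_real (w n) * f (n + 1)"]
          norm_triangle_ineq4[of "Jac f n - \<i> * f n" "of_real (w k) * f k"]
          norm_triangle_ineq4[of "Jac f n" "\<i> * f n"] w_pos[of k] w_pos[of n]
        by (simp add: norm_mult)
      hence "c n * cmod (f n) * cmod (f n) \<le> (cmod (Jac f n) + cmod (f n) + w k * cmod (f k) + w n * cmod (f (n + 1))) * cmod (f n)"
        unfolding norm_mult c_def by (intro mult_right_mono) auto
      hence "q n \<le> cmod (Jac f n) * cmod (f n) + (cmod (f n))\<^sup>2 + w k * cmod (f k) * cmod (f (k + 1)) + w n * cmod (f n) * cmod (f (n + 1))"
        by (simp add: q_def k power2_eq_square algebra_simps)
      moreover have "cmod (Jac f n) * cmod (f n) \<le> (cmod (Jac f n))\<^sup>2 + (cmod (f n))\<^sup>2"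
        by (intro mult_le_sum_squares norm_ge_zero)
      moreover have "w k * cmod (f k) * cmod (f (k + 1)) \<le> (q (n - 1) + q n) / 8"
        using w4[of k] k by (simp add: q_def)
      moreover have "w n * cmod (f n) * cmod (f (n + 1)) \<le> (q n + q (n + 1)) / 8"
        using w4[of n] k by (simp add: q_def)
      ultimately show ?thesis by (simp add: b_def add_divide_distrib)
    qed
    \<comment> \<open>Here the finite cluster point enters: along its subsequence the weight is at
      most K + 1.\<close>
    show "\<exists>m\<ge>n. q m \<le> (K + 1) * (\<Sum>n. (cmod (f n))\<^sup>2)" for n
    proof (intro exI conjI)
      show "s n \<ge> n" by (rule seq_suble[OF s(1)])
      have "c (s n) \<le> cmod (of_real (lam (s n))) + cmod \<i>" unfolding c_def by (rule norm_triangle_ineq4)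
      also have "\<dots> \<le> K + 1" using K[of n] by simp
      finally show "q (s n) \<le> (K + 1) * (\<Sum>n. (cmod (f n))\<^sup>2)"
        unfolding q_def using sum_le_suminf[OF f2, of "{s n}"] c0[of "s n"]
        by (intro mult_mono) auto
    qed
  qed (rule b)
  thus "summable (\<lambda>n. cmod (of_real (lam n) - \<i>) * (cmod (f n))\<^sup>2)" by (simp add: q_def[abs_def] c_def)
qed

text \<open>Eventually \<open>w n\<close> is at most the geometric mean of the adjacent weights, so
  the boundary form is dominated by products of weighted entries, which tend to 0 by
  \<open>summable_weighted\<close>.\<close>

lemma boundary_form_tendsto_0:
  assumes der: "der lam \<noteq> {}" and u: "u \<in> l2" "Jac u \<in> l2" and v: "v \<in> l2" "Jac v \<in> l2"
  shows "(\<lambda>n. of_real (w n) * (u n * v (Suc n) - u (Suc n) * v n)) \<longlonglongrightarrow> 0"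
proof -
  define c where "c n = cmod (of_real (lam n) - \<i>)" for n
  define s where "s f n = sqrt (c n) * cmod (f n)" for f and n
  have s0: "(\<lambda>n. s f n) \<longlonglongrightarrow> 0" if "f \<in> l2" "Jac f \<in> l2" for f
  proof -
    have "(\<lambda>n. c n * (cmod (f n))\<^sup>2) \<longlonglongrightarrow> 0"
      unfolding c_def by (rule summable_LIMSEQ_zero[OF summable_weighted(1)[OF der that]])
    from tendsto_real_sqrt[OF this] show ?thesis by (simp add: s_def real_sqrt_mult)
  qed
  obtain N where N: "\<And>n. n \<ge> N \<Longrightarrow> (w n)\<^sup>2 \<le> c n * c (n + 1) / 16"
    using summable_weighted(2)[OF der u] unfolding c_def by blast
  have le: "cmod (of_real (w n) * (u n * v (Suc n) - u (Suc n) * v n)) \<le> s u n * s v (Suc n) + s u (Suc n) * s v n"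
    if "n \<ge> N" for n
  proof -
    have "w n \<le> sqrt (c n * c (n + 1) / 16)" using N[OF that] by (rule real_le_rsqrt)
    also have "\<dots> \<le> sqrt (c n * c (n + 1))" by (simp add: c_def)
    finally have wn: "w n \<le> sqrt (c n) * sqrt (c (n + 1))" by (simp add: real_sqrt_mult)
    have "cmod (of_real (w n) * (u n * v (Suc n) - u (Suc n) * v n))
        \<le> w n * (cmod (u n) * cmod (v (Suc n)) + cmod (u (Suc n)) * cmod (v n))"
      using norm_triangle_ineq4[of "u n * v (Suc n)" "u (Suc n) * v n"] w_pos[of n]
      by (simp add: norm_mult mult_left_mono)
    also have "\<dots> \<le> (sqrt (c n) * sqrt (c (n + 1))) * (cmod (u n) * cmod (v (Suc n)) + cmod (u (Suc n)) * cmod (v n))"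
      using wn by (intro mult_right_mono) auto
    also have "\<dots> = s u n * s v (Suc n) + s u (Suc n) * s v n" by (simp add: s_def algebra_simps)
    finally show ?thesis .
  qed
  have "(\<lambda>n. s u n * s v (Suc n) + s u (Suc n) * s v n) \<longlonglongrightarrow> 0 * 0 + 0 * 0"
    by (intro tendsto_intros s0 u v LIMSEQ_Suc[OF s0])
  hence lim: "(\<lambda>n. s u n * s v (Suc n) + s u (Suc n) * s v n) \<longlonglongrightarrow> 0" by simp
  show ?thesis
    by (rule Lim_null_comparison[OF _ lim]) (use le in \<open>auto simp: eventually_sequentially\<close>)
qed

lemma Jac_symmetric:
  assumes der: "der lam \<noteq> {}" and u: "u \<in> l2" "Jac u \<in> l2" and v: "v \<in> l2" "Jac v \<in> l2"
  shows "(\<Sum>k. u k * Jac v k) = (\<Sum>k. Jac u k * v k)"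
proof -
  have s: "summable (\<lambda>k. u k * Jac v k)" "summable (\<lambda>k. Jac u k * v k)"
    using u v by (auto intro: l2_summable_mult)
  have "(\<lambda>n. \<Sum>k\<le>n. u k * Jac v k - Jac u k * v k) \<longlonglongrightarrow> (\<Sum>k. u k * Jac v k - Jac u k * v k)"
    using s by (intro summable_LIMSEQ' summable_diff)
  moreover have "(\<lambda>n. \<Sum>k\<le>n. u k * Jac v k - Jac u k * v k) \<longlonglongrightarrow> 0"
    unfolding green by (rule boundary_form_tendsto_0[OF assms])
  ultimately have "(\<Sum>k. u k * Jac v k - Jac u k * v k) = 0" by (rule LIMSEQ_unique)
  thus ?thesis using s by (simp add: suminf_diff[symmetric])
qed

lemma finite_support_max_op:
  assumes "\<And>n. n \<ge> N \<Longrightarrow> f n = 0"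
  shows "(f, Jac f) \<in> max_op"
proof -
  have "Jac f n = 0" if "n \<ge> Suc N" for n using that assms by (cases n) (auto simp: Jac_simps)
  hence "Jac f \<in> l2" by (rule l2_finite_support)
  thus ?thesis using l2_finite_support[of N f] assms by (auto simp: max_op_def)
qed

lemma unit_seq_max_op: "(unit_seq n, Jac (unit_seq n)) \<in> max_op"
  by (rule finite_support_max_op[of "Suc n"]) (simp add: unit_seq_def)

lemma represents_matrix_iff:
  assumes "T \<subseteq> l2 \<times> l2"
  shows "represents_matrix T (jacobi_matrix lam w) \<longleftrightarrow> (\<forall>n. (unit_seq n, Jac (unit_seq n)) \<in> T)"
proof -
  have "(\<exists>g. (unit_seq n, g) \<in> T \<and> (\<forall>m. l2_inner (unit_seq m) g = jacobi_matrix lam w m n)) \<longleftrightarrow>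
      (unit_seq n, Jac (unit_seq n)) \<in> T" for n
  proof -
    have "(\<forall>m. g m = jacobi_matrix lam w m n) \<longleftrightarrow> g = Jac (unit_seq n)" for g
      unfolding Jac_unit_seq by auto
    thus ?thesis unfolding l2_inner_unit_seq by auto
  qed
  thus ?thesis unfolding represents_matrix_def by simp
qed

lemma l2_inner_Jac_unit_seq: "l2_inner g (Jac (unit_seq n)) = cnj (Jac g n)"
proof -
  \<comment> \<open>Stopping at n + 1 puts the boundary term at n + 1 and n + 2, where the unit
    sequence vanishes.\<close>
  have "(\<Sum>k\<le>Suc n. cnj (g k) * Jac (unit_seq n) k - Jac (\<lambda>k. cnj (g k)) k * unit_seq n k) = 0"
    unfolding green by (simp add: unit_seq_def)
  hence "(\<Sum>k\<le>Suc n. cnj (g k) * Jac (unit_seq n) k) = (\<Sum>k\<le>Suc n. Jac (\<lambda>k. cnj (g k)) k * unit_seq n k)"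
    by (simp add: sum_subtractf)
  also have "\<dots> = cnj (Jac g n)" by (simp add: unit_seq_def Jac_cnj if_distrib cong: if_cong)
  also have "(\<Sum>k\<le>Suc n. cnj (g k) * Jac (unit_seq n) k) = l2_inner g (Jac (unit_seq n))"
    unfolding l2_inner_def
    by (rule suminf_finite[symmetric]) (auto simp: Jac_unit_seq jacobi_matrix_def)
  finally show ?thesis .
qed

text \<open>Testing the adjoint relation on the unit sequences alone already reads off every
  coordinate of \<open>Jac g\<close>.\<close>

lemma operator_adjoint_subset_max_op:
  assumes "\<And>n. (unit_seq n, Jac (unit_seq n)) \<in> T"
  shows "operator_adjoint T \<subseteq> max_op"
proof
  fix gh assume "gh \<in> operator_adjoint T"
  then obtain g h where gh: "gh = (g, h)" "g \<in> l2" "h \<in> l2"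
    "\<And>f f'. (f, f') \<in> T \<Longrightarrow> l2_inner g f' = l2_inner h f"
    unfolding operator_adjoint_def by blast
  have "cnj (Jac g n) = cnj (h n)" for n
    using gh(4)[OF assms[of n]] by (simp add: l2_inner_Jac_unit_seq l2_inner_unit_seq)
  hence "h = Jac g" by auto
  thus "gh \<in> max_op" using gh by (simp add: max_op_def)
qed

lemma self_adjoint_max_op:
  assumes der: "der lam \<noteq> {}"
  shows "self_adjoint max_op"
  unfolding self_adjoint_def
proof (intro conjI)
  show "linear_operator max_op"
    unfolding linear_operator_def
  proof (intro conjI allI impI)
    show "max_op \<subseteq> l2 \<times> l2" by (auto simp: max_op_def)
    show "single_valued max_op" by (auto simp: max_op_def single_valued_def)
    have "Jac (\<lambda>n. 0) = (\<lambda>n. 0)" using Jac_lincomb[of 0 _ 0] by simp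
    thus "((\<lambda>n. 0), (\<lambda>n. 0)) \<in> max_op" by (simp add: max_op_def l2_def)
    show "((\<lambda>n. a * f n + b * g n), (\<lambda>n. a * f' n + b * g' n)) \<in> max_op"
      if "(f, f') \<in> max_op" "(g, g') \<in> max_op" for f f' g g' a b
      using that by (auto simp: max_op_def Jac_lincomb intro: l2_add l2_cmult)
  qed
  show "densely_defined max_op"
    unfolding densely_defined_def
  proof (intro ballI allI impI)
    fix f :: "nat \<Rightarrow> complex" and \<epsilon> :: real assume f: "f \<in> l2" and \<epsilon>: "0 < \<epsilon>"
    have sf: "summable (\<lambda>n. (cmod (f n))\<^sup>2)" using f by (simp add: l2_def)
    obtain N where N: "norm (\<Sum>i. (cmod (f (i + N)))\<^sup>2) < \<epsilon>\<^sup>2"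
      using suminf_exist_split[OF _ sf, of "\<epsilon>\<^sup>2"] \<epsilon> by auto
    define g where "g n = (if n < N then f n else 0)" for n
    have "(\<Sum>n. (cmod (f n - g n))\<^sup>2) = (\<Sum>i. (cmod (f (i + N)))\<^sup>2)"
    proof -
      have "summable (\<lambda>n. (cmod (f n - g n))\<^sup>2)"
        by (rule summable_comparison_test'[OF sf, of 0]) (simp add: g_def)
      from suminf_split_initial_segment[OF this, of N] show ?thesis by (simp add: g_def)
    qed
    hence "l2_norm (\<lambda>n. f n - g n) < \<epsilon>"
      unfolding l2_norm_def using N \<epsilon> by (intro real_less_lsqrt) auto
    moreover have "g \<in> Domain max_op"
      using finite_support_max_op[of N g] by (auto simp: g_def)
    ultimately show "\<exists>g\<in>Domain max_op. l2_norm (\<lambda>n. f n - g n) < \<epsilon>" by blast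
  qed
  show "operator_adjoint max_op = max_op"
  proof
    show "operator_adjoint max_op \<subseteq> max_op"
      by (rule operator_adjoint_subset_max_op[OF unit_seq_max_op])
    show "max_op \<subseteq> operator_adjoint max_op"
    proof
      fix gh assume "gh \<in> max_op"
      then obtain g where g: "gh = (g, Jac g)" "g \<in> l2" "Jac g \<in> l2" by (auto simp: max_op_def)
      have "l2_inner g (Jac f) = l2_inner (Jac g) f" if "f \<in> l2" "Jac f \<in> l2" for f
        using Jac_symmetric[OF der, of "\<lambda>n. cnj (g n)" f] g that
        by (simp add: l2_inner_def l2_cnj Jac_cnj)
      thus "gh \<in> operator_adjoint max_op" using g by (auto simp: operator_adjoint_def max_op_def)
    qed
  qed
qed

text \<open>A self-adjoint T with this matrix equals its adjoint and so lies inside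
  \<open>max_op\<close>. Adjoints reverse inclusions and \<open>max_op\<close> is self-adjoint,
  which gives the converse.\<close>

lemma jacobi_operator_eq_max_op:
  assumes der: "der lam \<noteq> {}"
  shows "jacobi_operator lam w = max_op"
  unfolding jacobi_operator_def
proof (rule the_equality)
  have sub: "max_op \<subseteq> l2 \<times> l2" by (auto simp: max_op_def)
  show "self_adjoint max_op \<and> represents_matrix max_op (jacobi_matrix lam w)"
    using self_adjoint_max_op[OF der] represents_matrix_iff[OF sub] unit_seq_max_op by blast
  fix T assume T: "self_adjoint T \<and> represents_matrix T (jacobi_matrix lam w)"
  hence adj: "operator_adjoint T = T" and l2: "T \<subseteq> l2 \<times> l2"
    by (auto simp: self_adjoint_def linear_operator_def)
  have "T \<subseteq> max_op"
    using operator_adjoint_subset_max_op[of T] adj T represents_matrix_iff[OF l2] by simp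
  hence "operator_adjoint max_op \<subseteq> operator_adjoint T" by (fastforce simp: operator_adjoint_def)
  moreover have "operator_adjoint max_op = max_op" using self_adjoint_max_op[OF der] by (simp add: self_adjoint_def)
  ultimately show "T = max_op" using adj \<open>T \<subseteq> max_op\<close> by auto
qed

lemma point_spectrum_iff:
  assumes der: "der lam \<noteq> {}"
  shows "complex_of_real x \<in> point_spectrum (jacobi_operator lam w) \<longleftrightarrow> summable (\<lambda>n. (p n x)\<^sup>2)"
proof
  assume "complex_of_real x \<in> point_spectrum (jacobi_operator lam w)"
  then obtain f where f: "f \<noteq> (\<lambda>n. 0)" "f \<in> l2" "Jac f = (\<lambda>n. of_real x * f n)"
    unfolding jacobi_operator_eq_max_op[OF der] point_spectrum_def max_op_def by auto
  have eq: "f = (\<lambda>n. f 0 * Pz n (of_real x))" using f(3) by (simp add: Jac_eigen_iff)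
  hence f0: "f 0 \<noteq> 0" using f(1) by (metis mult_zero_left)
  have "summable (\<lambda>n. (cmod (f n))\<^sup>2)" using f(2) by (simp add: l2_def)
  hence "summable (\<lambda>n. (cmod (f 0))\<^sup>2 * (p n x)\<^sup>2)"
    by (subst (asm) eq) (simp add: norm_mult power_mult_distrib Pz_of_real)
  thus "summable (\<lambda>n. (p n x)\<^sup>2)" using f0 by (simp add: summable_cmult_iff)
next
  assume s: "summable (\<lambda>n. (p n x)\<^sup>2)"
  let ?f = "\<lambda>n. Pz n (of_real x)"
  have l2: "?f \<in> l2" using s by (simp add: l2_def Pz_of_real)
  have J: "Jac ?f = (\<lambda>n. of_real x * ?f n)" by (subst Jac_eigen_iff) simp
  have "?f \<noteq> (\<lambda>n. 0)" by (metis Pc.simps(1) poly_1 zero_neq_one)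
  moreover have "(?f, (\<lambda>n. of_real x * ?f n)) \<in> max_op"
    using l2 l2_cmult[OF l2] J by (simp add: max_op_def)
  ultimately show "complex_of_real x \<in> point_spectrum (jacobi_operator lam w)"
    unfolding jacobi_operator_eq_max_op[OF der] point_spectrum_def by blast
qed

end

section \<open>The measure on \<open>der lam\<close>\<close>

lemma countable_discrete:
  fixes S :: "'a :: second_countable_topology set"
  assumes "discrete S"
  shows "countable S"
proof -
  have "\<forall>x\<in>S. \<exists>V. open V \<and> V \<inter> S = {x}"
    using assms unfolding discrete_def isolated_in_def by blast
  then obtain V where V: "\<And>x. x \<in> S \<Longrightarrow> open (V x) \<and> V x \<inter> S = {x}" by metis
  have "\<And>T. T \<in> V ` S \<Longrightarrow> open T" using V by auto
  from Lindelof[OF this] obtain \<F> where F: "\<F> \<subseteq> V ` S" "countable \<F>" "\<Union>\<F> = \<Union>(V ` S)" by blast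
  have "S \<subseteq> (\<Union>T\<in>\<F>. T \<inter> S)"
  proof
    fix x assume x: "x \<in> S"
    hence "x \<in> V x" using V[OF x] by auto
    hence "x \<in> \<Union>\<F>" using x F(3) by auto
    thus "x \<in> (\<Union>T\<in>\<F>. T \<inter> S)" using x by auto
  qed
  moreover have "countable (\<Union>T\<in>\<F>. T \<inter> S)"
  proof (intro countable_UN F(2))
    fix T assume "T \<in> \<F>"
    then obtain x where "x \<in> S" "T = V x" using F(1) by auto
    thus "countable (T \<inter> S)" using V by simp
  qed
  ultimately show ?thesis by (rule countable_subset)
qed

text \<open>Restricted to a countable set, the measure has its point masses as density with respect
  to counting measure, so the integral is an unordered sum.\<close>

lemma (in finite_borel_measure) has_sum_set_integral_countable:
  fixes f :: "real \<Rightarrow> real"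
  assumes C: "countable C" and f: "integrable M f"
  shows "((\<lambda>x. measure M {x} * f x) has_sum (\<integral>x. indicator C x * f x \<partial>M)) C"
proof -
  have Cb: "A \<in> sets borel" if "A \<subseteq> C" for A
    by (rule sets.countable[OF _ countable_subset[OF that C]]) simp
  have CM: "C \<inter> space M \<in> sets M" using Cb[of C] by (simp add: M_is_borel borel_UNIV)
  let ?R = "restrict_space M C"
  let ?N = "density (count_space C) (\<lambda>x. ennreal (measure M {x}))"
  have RN: "?R = ?N"
  proof (rule measure_eqI_countable[of _ C])
    show "sets ?R = Pow C"
    proof -
      have "sets ?R = (\<inter>) C ` sets borel" by (simp add: sets_restrict_space M_is_borel)
      also have "\<dots> = Pow C"
      proof
        show "Pow C \<subseteq> (\<inter>) C ` sets borel"
        proof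
          fix A assume "A \<in> Pow C"
          hence "A \<in> sets borel" "A = C \<inter> A" using Cb by auto
          thus "A \<in> (\<inter>) C ` sets borel" by (rule rev_image_eqI)
        qed
      qed auto
      finally show ?thesis .
    qed
    show "emeasure ?R {a} = emeasure ?N {a}" if "a \<in> C" for a
      using that emeasure_point_measure_finite2[of "{a}" C "\<lambda>x. ennreal (measure M {x})"]
      by (simp add: emeasure_restrict_space[OF CM] emeasure_eq_measure point_measure_def)
  qed (use C in auto)
  have int: "integrable ?R f"
    using integrable_mult_indicator[of C M f] f CM
    by (subst integrable_restrict_space[OF CM]) (simp add: borel_UNIV)
  hence "integrable (count_space C) (\<lambda>x. measure M {x} * f x)"
    unfolding RN by (subst (asm) integrable_density) auto
  \<comment> \<open>Integrability for counting measure is absolute summability in the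
    measure-theoretic sense; the lines below convert it to \<open>has_sum\<close>.\<close>
  hence abs: "Infinite_Set_Sum.abs_summable_on (\<lambda>x. measure M {x} * f x) C"
    by (simp add: abs_summable_on_def)
  have "(\<integral>x. indicator C x * f x \<partial>M) = (\<integral>x. f x \<partial>?R)"
    by (subst integral_restrict_space[OF CM]) simp
  also have "\<dots> = (\<integral>x. measure M {x} * f x \<partial>count_space C)"
    unfolding RN by (subst integral_density) auto
  also have "\<dots> = infsetsum (\<lambda>x. measure M {x} * f x) C" by (simp add: infsetsum_def)
  also have "\<dots> = infsum (\<lambda>x. measure M {x} * f x) C" by (rule infsetsum_infsum[OF abs])
  finally show ?thesis
    using has_sum_infsum[OF abs_summable_summable[OF abs[folded abs_summable_equivalent]]] by simp
qed

section \<open>Atoms and eigenvectors\<close>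

context jacobi begin

context
  fixes \<mu> :: "real measure"
  assumes \<mu>: "real_distribution \<mu>"
    and int_pp: "\<And>i j. integrable \<mu> (\<lambda>x. p i x * p j x)"
    and orth: "\<And>i j. (\<integral>x. p i x * p j x \<partial>\<mu>) = (if i = j then 1 else 0)"
begin

interpretation \<mu>: real_distribution \<mu> by (rule \<mu>)

lemma int_p: "integrable \<mu> (p k)"
  using int_pp[of k 0] by (simp add: p_simps)

text \<open>Expands the nonnegative integral of the squared difference between \<open>a\<close> and
  its projection onto the first n polynomials. Boundedness of \<open>a\<close> makes all products
  integrable.\<close>

lemma bessel:
  fixes a :: "real \<Rightarrow> real"
  assumes a: "a \<in> borel_measurable borel" "\<And>t. \<bar>a t\<bar> \<le> B"
  shows "(\<Sum>k<n. (\<integral>t. p k t * a t \<partial>\<mu>)\<^sup>2) \<le> (\<integral>t. (a t)\<^sup>2 \<partial>\<mu>)"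
proof -
  have [measurable]: "a \<in> borel_measurable \<mu>" using a(1) by simp
  define c where "c k = (\<integral>t. p k t * a t \<partial>\<mu>)" for k
  have B0: "0 \<le> B" using a(2)[of 0] by simp
  have ia: "integrable \<mu> (\<lambda>t. (a t)\<^sup>2)"
    by (rule \<mu>.integrable_const_bound[where B = "B\<^sup>2"]) (use a(2) B0 in \<open>auto simp: abs_le_square_iff[symmetric]\<close>)
  have ip: "integrable \<mu> (\<lambda>t. p k t * a t)" for k
  proof (rule Bochner_Integration.integrable_bound)
    show "integrable \<mu> (\<lambda>t. \<bar>p k t\<bar> * B)" using int_p by simp
    show "AE t in \<mu>. norm (p k t * a t) \<le> norm (\<bar>p k t\<bar> * B)"
      using a(2) B0 by (intro AE_I2) (simp add: abs_mult mult_left_mono)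
  qed simp
  have "0 \<le> (\<integral>t. (a t - (\<Sum>k<n. c k * p k t))\<^sup>2 \<partial>\<mu>)" by simp
  also have "(\<lambda>t. (a t - (\<Sum>k<n. c k * p k t))\<^sup>2) = (\<lambda>t. (a t)\<^sup>2 - 2 * (\<Sum>k<n. c k * (p k t * a t))
      + (\<Sum>k<n. \<Sum>l<n. c k * c l * (p k t * p l t)))"
  proof
    fix t
    define s where "s = (\<Sum>k<n. c k * p k t)"
    have "a t * s = (\<Sum>k<n. c k * (p k t * a t))" by (simp add: s_def sum_distrib_left ac_simps)
    moreover have "s * s = (\<Sum>k<n. \<Sum>l<n. c k * c l * (p k t * p l t))"
      by (simp add: s_def sum_product ac_simps)
    moreover have "(a t - s)\<^sup>2 = (a t)\<^sup>2 - 2 * (a t * s) + s * s"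
      by (simp add: power2_eq_square algebra_simps)
    ultimately show "(a t - (\<Sum>k<n. c k * p k t))\<^sup>2 = (a t)\<^sup>2 - 2 * (\<Sum>k<n. c k * (p k t * a t))
      + (\<Sum>k<n. \<Sum>l<n. c k * c l * (p k t * p l t))" by (simp add: s_def)
  qed
  also have "(\<integral>t. (a t)\<^sup>2 - 2 * (\<Sum>k<n. c k * (p k t * a t)) + (\<Sum>k<n. \<Sum>l<n. c k * c l * (p k t * p l t)) \<partial>\<mu>)
      = (\<integral>t. (a t)\<^sup>2 \<partial>\<mu>) - 2 * (\<Sum>k<n. c k * c k) + (\<Sum>k<n. \<Sum>l<n. c k * c l * (if k = l then 1 else 0))"
    by (simp add: ia ip int_pp orth c_def[symmetric] Bochner_Integration.integral_sum)
  also have "(\<Sum>k<n. \<Sum>l<n. c k * c l * (if k = l then 1 else 0)) = (\<Sum>k<n. c k * c k)"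
    by (intro sum.cong refl) (simp add: if_distrib cong: if_cong)
  finally show ?thesis by (simp add: c_def power2_eq_square)
qed

text \<open>The polynomials are real, so real and imaginary parts obey Bessel's inequality
  separately.\<close>

lemma bessel_complex:
  fixes a :: "real \<Rightarrow> complex"
  assumes a: "a \<in> borel_measurable borel" "\<And>t. cmod (a t) \<le> B"
  shows "(\<Sum>k<n. (cmod (\<integral>t. of_real (p k t) * a t \<partial>\<mu>))\<^sup>2) \<le> B\<^sup>2"
proof -
  have [measurable]: "a \<in> borel_measurable \<mu>" using a(1) by simp
  have B0: "0 \<le> B" using order_trans[OF norm_ge_zero a(2)[of 0]] .
  have ip: "integrable \<mu> (\<lambda>t. of_real (p k t) * a t)" for k
  proof (rule Bochner_Integration.integrable_bound)
    show "integrable \<mu> (\<lambda>t. \<bar>p k t\<bar> * B)" using int_p by simp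
    show "AE t in \<mu>. norm (of_real (p k t) * a t) \<le> norm (\<bar>p k t\<bar> * B)"
      using a(2) B0 by (intro AE_I2) (simp add: norm_mult abs_mult mult_left_mono)
  qed simp
  have Re: "\<bar>Re (a t)\<bar> \<le> B" and Im: "\<bar>Im (a t)\<bar> \<le> B" for t
    using abs_Re_le_cmod[of "a t"] abs_Im_le_cmod[of "a t"] a(2)[of t] by linarith+
  have int: "integrable \<mu> (\<lambda>t. (Re (a t))\<^sup>2)" "integrable \<mu> (\<lambda>t. (Im (a t))\<^sup>2)"
    by (rule \<mu>.integrable_const_bound[where B = "B\<^sup>2"];
        use Re Im B0 in \<open>auto simp: abs_le_square_iff[symmetric]\<close>)+
  have "(cmod (\<integral>t. of_real (p k t) * a t \<partial>\<mu>))\<^sup>2 = (\<integral>t. p k t * Re (a t) \<partial>\<mu>)\<^sup>2 + (\<integral>t. p k t * Im (a t) \<partial>\<mu>)\<^sup>2" for k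
    unfolding cmod_power2 integral_Re[OF ip, symmetric] integral_Im[OF ip, symmetric] by simp
  hence "(\<Sum>k<n. (cmod (\<integral>t. of_real (p k t) * a t \<partial>\<mu>))\<^sup>2)
      = (\<Sum>k<n. (\<integral>t. p k t * Re (a t) \<partial>\<mu>)\<^sup>2) + (\<Sum>k<n. (\<integral>t. p k t * Im (a t) \<partial>\<mu>)\<^sup>2)"
    by (simp add: sum.distrib)
  also have "\<dots> \<le> (\<integral>t. (Re (a t))\<^sup>2 \<partial>\<mu>) + (\<integral>t. (Im (a t))\<^sup>2 \<partial>\<mu>)"
    using a(1) Re Im by (intro add_mono bessel[where B = B]) auto
  also have "\<dots> = (\<integral>t. (cmod (a t))\<^sup>2 \<partial>\<mu>)"
    using int by (simp add: cmod_power2)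
  also have "\<dots> \<le> (\<integral>t. B\<^sup>2 \<partial>\<mu>)"
  proof (rule integral_mono)
    show "integrable \<mu> (\<lambda>t. (cmod (a t))\<^sup>2)" using int by (simp add: cmod_power2)
  qed (use a(2) in \<open>auto intro: power_mono\<close>)
  finally show ?thesis using \<mu>.prob_space by simp
qed

text \<open>Bessel's inequality for the indicator of x, with coefficients \<open>p k x\<close> times
  the atom, divided by the atom. So a point of positive mass has a square summable
  eigenvector.\<close>

lemma measure_atom_sum_le_1: "measure \<mu> {x} * (\<Sum>k<n. (p k x)\<^sup>2) \<le> 1"
proof (cases "measure \<mu> {x} = 0")
  case False
  hence pos: "0 < measure \<mu> {x}" using measure_nonneg[of \<mu> "{x}"] by linarith
  have "(\<integral>t. p k t * indicator {x} t \<partial>\<mu>) = p k x * measure \<mu> {x}" for k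
  proof -
    have "(\<integral>t. p k t * indicator {x} t \<partial>\<mu>) = (\<integral>t. p k x * indicator {x} t \<partial>\<mu>)"
      by (intro Bochner_Integration.integral_cong) (auto simp: indicator_def)
    thus ?thesis by simp
  qed
  moreover have "(\<Sum>k<n. (\<integral>t. p k t * indicator {x} t \<partial>\<mu>)\<^sup>2) \<le> (\<integral>t. (indicator {x} t)\<^sup>2 \<partial>\<mu>)"
    by (rule bessel[where B = 1]) (auto simp: indicator_def)
  moreover have "(\<integral>t. (indicator {x} t)\<^sup>2 \<partial>\<mu>) = measure \<mu> {x}"
  proof -
    have "(\<lambda>t. (indicator {x} t :: real)\<^sup>2) = indicator {x}" by (auto simp: indicator_def)
    thus ?thesis by simp
  qed
  ultimately have "measure \<mu> {x} * (measure \<mu> {x} * (\<Sum>k<n. (p k x)\<^sup>2)) \<le> measure \<mu> {x} * 1"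
    by (simp add: power_mult_distrib sum_distrib_left power2_eq_square ac_simps)
  thus ?thesis using pos by (simp only: mult_le_cancel_left_pos)
qed simp

text \<open>Pairing the eigenvector \<open>p k x\<close> with \<open>(x - u)\<close> times the resolvent vector of \<open>e\<^sub>0\<close> at \<open>u\<close> gives
  \<open>1\<close>; as \<open>u \<rightarrow> x\<close> that vector tends to \<open>\<mu> {x}\<close> times the eigenvector.\<close>

lemma one_le_measure_atom:
  assumes der: "der lam \<noteq> {}" and s: "summable (\<lambda>k. (p k x)\<^sup>2)"
  shows "1 \<le> measure \<mu> {x} * (\<Sum>k. (p k x)\<^sup>2)"
proof -
  define u where "u n = complex_of_real x + \<i> / of_nat (Suc n)" for n
  define h where "h n k = (\<integral>t. of_real (p k t) * ((u n - of_real x) / (complex_of_real t - u n)) \<partial>\<mu>)" for n k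
  define S where "S = (\<Sum>k. (p k x)\<^sup>2)"
  have ux: "u n - of_real x = \<i> / of_nat (Suc n)" for n by (simp add: u_def)
  have ux0: "u n - of_real x \<noteq> 0" for n unfolding ux by (simp del: of_nat_Suc)
  have Im_u: "Im (u n) = 1 / real (Suc n)" for n by (simp add: u_def Im_divide_of_nat del: of_nat_Suc)
  have Im_u0: "Im (u n) \<noteq> 0" for n unfolding Im_u by simp
  have h_lim: "(\<lambda>n. h n k) \<longlonglongrightarrow> - of_real (p k x * measure \<mu> {x})" for k
    unfolding h_def u_def by (rule \<mu>.Cauchy_kernel_atom_limit[OF int_p])
  have kernel: "cmod ((u n - of_real x) / (complex_of_real t - u n)) \<le> 1" for n t
  proof -
    have "cmod (1 / (complex_of_real t - u n)) \<le> real (Suc n)"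
      using nonreal_Cauchy_kernel_bound[OF Im_u0[of n], of t] unfolding Im_u by simp
    from mult_left_mono[OF this, of "cmod (u n - of_real x)"] show ?thesis
      unfolding norm_mult[symmetric] ux by (simp add: norm_divide del: of_nat_Suc)
  qed
  \<comment> \<open>The bound does not depend on n, which later controls the tail of the pairing
    uniformly.\<close>
  have h_bessel: "(\<Sum>k<m. (cmod (h n k))\<^sup>2) \<le> 1" for n m
    using bessel_complex[of "\<lambda>t. (u n - of_real x) / (complex_of_real t - u n)" 1 m] kernel
    by (simp add: h_def)
  have h_sum: "summable (\<lambda>k. (cmod (h n k))\<^sup>2)" for n
    using h_bessel by (intro summableI_nonneg_bounded) auto
  define g where "g n = cauchy_moment \<mu> (u n)" for n
  have hg: "h n k = (u n - of_real x) * g n k" for n k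
  proof -
    have "(\<integral>t. (u n - of_real x) * (complex_of_real (p k t) * (1 / (complex_of_real t - u n))) \<partial>\<mu>)
        = (u n - of_real x) * g n k"
      unfolding g_def cauchy_moment_def by (rule integral_mult_right_zero)
    thus ?thesis by (simp add: h_def mult_ac)
  qed
  define v where "v k = complex_of_real (p k x)" for k
  have v_eq: "v = (\<lambda>k. Pz k (of_real x))" by (simp add: v_def[abs_def] Pz_of_real)
  have v: "v \<in> l2" using s by (simp add: l2_def v_def)
  have Jv: "Jac v = (\<lambda>k. of_real x * v k)" unfolding Jac_eigen_iff v_eq by simp
  \<comment> \<open>With g the resolvent vector, Jac g = u g + e_0, and Jac v = x v with v 0 = 1;
    symmetry gives (u - x) times the pairing of v and g equal to -1.\<close>
  have pairing: "(\<Sum>k. v k * h n k) = - 1" for n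
  proof -
    have "summable (\<lambda>k. (cmod (u n - of_real x))\<^sup>2 * (cmod (g n k))\<^sup>2)"
      using h_sum[of n] by (simp add: hg norm_mult power_mult_distrib)
    hence g: "g n \<in> l2" using ux0 by (simp add: l2_def summable_cmult_iff)
    have E: "(\<integral>t. p k t \<partial>\<mu>) = (if k = 0 then 1 else 0)" for k
      using orth[of k 0] by (simp add: p_simps)
    have Jg: "Jac (g n) = (\<lambda>k. u n * g n k + 1 * unit_seq 0 k)"
    proof
      fix k show "Jac (g n) k = u n * g n k + 1 * unit_seq 0 k"
        using cauchy_moment_rec[OF \<mu> int_p Im_u0[of n], folded g_def]
        by (cases k) (simp_all add: Jac_simps unit_seq_def E)
    qed
    have us: "unit_seq 0 \<in> l2" by (rule l2_finite_support[of 1]) (simp add: unit_seq_def)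
    have "Jac (g n) \<in> l2" unfolding Jg by (intro l2_add l2_cmult g us)
    moreover have "Jac v \<in> l2" unfolding Jv by (intro l2_cmult v)
    ultimately have "(\<Sum>k. v k * Jac (g n) k) = (\<Sum>k. Jac v k * g n k)"
      using Jac_symmetric[OF der v _ g] by blast
    also have "(\<Sum>k. v k * Jac (g n) k) = (\<Sum>k. u n * (v k * g n k) + v k * unit_seq 0 k)"
      by (simp add: Jg algebra_simps)
    also have "\<dots> = u n * (\<Sum>k. v k * g n k) + (\<Sum>k. v k * unit_seq 0 k)"
      using l2_summable_mult[OF v g] l2_summable_mult[OF v us]
      by (simp add: suminf_add[symmetric] suminf_mult summable_mult)
    also have "(\<Sum>k. v k * unit_seq 0 k) = 1"
      by (subst suminf_finite[of "{0}"]) (auto simp: unit_seq_def v_def p_simps)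
    also have "(\<Sum>k. Jac v k * g n k) = of_real x * (\<Sum>k. v k * g n k)"
      unfolding Jv using l2_summable_mult[OF v g] by (simp add: suminf_mult mult.assoc)
    finally have "(u n - of_real x) * (\<Sum>k. v k * g n k) = - 1"
      by (simp add: algebra_simps eq_neg_iff_add_eq_0)
    moreover have "(\<Sum>k. v k * h n k) = (u n - of_real x) * (\<Sum>k. v k * g n k)"
      unfolding hg using l2_summable_mult[OF v g] by (simp add: suminf_mult[symmetric] mult_ac)
    ultimately show ?thesis by simp
  qed
  \<comment> \<open>\<open>h n\<close> is known to converge only coordinatewise, so the pairing is
    cut at K and its tail estimated by a \<delta>-weighted inequality with both \<open>l2\<close>
    norms. Limits follow in the order n, K, \<delta>.\<close>
  have tail: "1 \<le> cmod (\<Sum>k<K. v k * h n k) + (\<Sum>k. (p (k + K) x)\<^sup>2) / \<delta> + \<delta>" if \<delta>: "0 < \<delta>" for n K \<delta>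
  proof -
    have hl2: "h n \<in> l2" using h_sum by (simp add: l2_def)
    have svh: "summable (\<lambda>k. v k * h n k)" using l2_summable_mult[OF v hl2] .
    have s1: "summable (\<lambda>k. (p (k + K) x)\<^sup>2 / \<delta> + \<delta> * (cmod (h n (k + K)))\<^sup>2)"
      using s h_sum[of n]
      by (intro summable_add summable_divide summable_mult) (simp_all add: summable_iff_shift[of "\<lambda>k. (p k x)\<^sup>2"] summable_iff_shift[of "\<lambda>k. (cmod (h n k))\<^sup>2"])
    have le: "cmod (v (k + K) * h n (k + K)) \<le> (p (k + K) x)\<^sup>2 / \<delta> + \<delta> * (cmod (h n (k + K)))\<^sup>2" for k
    proof -
      have "(\<bar>p (k + K) x\<bar> / sqrt \<delta>) * (sqrt \<delta> * cmod (h n (k + K)))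
          \<le> (\<bar>p (k + K) x\<bar> / sqrt \<delta>)\<^sup>2 + (sqrt \<delta> * cmod (h n (k + K)))\<^sup>2"
        using \<delta> by (intro mult_le_sum_squares) auto
      thus ?thesis using \<delta> by (simp add: v_def norm_mult power_divide power_mult_distrib)
    qed
    have "cmod (\<Sum>k. v (k + K) * h n (k + K)) \<le> (\<Sum>k. (p (k + K) x)\<^sup>2 / \<delta> + \<delta> * (cmod (h n (k + K)))\<^sup>2)"
      by (rule norm_suminf_le[OF le s1])
    also have "\<dots> = (\<Sum>k. (p (k + K) x)\<^sup>2) / \<delta> + \<delta> * (\<Sum>k. (cmod (h n (k + K)))\<^sup>2)"
    proof -
      have "summable (\<lambda>k. (p (k + K) x)\<^sup>2)" "summable (\<lambda>k. (cmod (h n (k + K)))\<^sup>2)"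
        using s h_sum[of n] by (simp_all add: summable_iff_shift[of "\<lambda>k. (p k x)\<^sup>2"] summable_iff_shift[of "\<lambda>k. (cmod (h n k))\<^sup>2"])
      thus ?thesis by (simp add: suminf_add[symmetric] suminf_divide[symmetric] suminf_mult[symmetric] summable_divide summable_mult)
    qed
    also have "(\<Sum>k. (cmod (h n (k + K)))\<^sup>2) \<le> 1"
    proof -
      have "(\<Sum>k. (cmod (h n (k + K)))\<^sup>2) \<le> (\<Sum>k. (cmod (h n k))\<^sup>2)"
        using suminf_split_initial_segment[OF h_sum[of n], of K] by (simp add: sum_nonneg)
      also have "\<dots> \<le> 1" by (rule suminf_le_const[OF h_sum]) (rule h_bessel)
      finally show ?thesis .
    qed
    finally have t: "cmod (\<Sum>k. v (k + K) * h n (k + K)) \<le> (\<Sum>k. (p (k + K) x)\<^sup>2) / \<delta> + \<delta>"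
      using \<delta> by simp
    have "1 = cmod (\<Sum>k. v k * h n k)" by (simp add: pairing)
    also have "\<dots> \<le> cmod (\<Sum>k. v (k + K) * h n (k + K)) + cmod (\<Sum>k<K. v k * h n k)"
      unfolding suminf_split_initial_segment[OF svh, of K] by (rule norm_triangle_ineq)
    finally show ?thesis using t by linarith
  qed
  have K_bound: "1 \<le> measure \<mu> {x} * S + (\<Sum>k. (p (k + K) x)\<^sup>2) / \<delta> + \<delta>" if \<delta>: "0 < \<delta>" for K \<delta>
  proof -
    have "(\<lambda>n. cmod (\<Sum>k<K. v k * h n k) + (\<Sum>k. (p (k + K) x)\<^sup>2) / \<delta> + \<delta>) \<longlonglongrightarrow>
        cmod (\<Sum>k<K. v k * - of_real (p k x * measure \<mu> {x})) + (\<Sum>k. (p (k + K) x)\<^sup>2) / \<delta> + \<delta>"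
      by (intro tendsto_intros h_lim)
    hence "1 \<le> cmod (\<Sum>k<K. v k * - of_real (p k x * measure \<mu> {x})) + (\<Sum>k. (p (k + K) x)\<^sup>2) / \<delta> + \<delta>"
      by (rule LIMSEQ_le_const) (use tail[OF \<delta>] in auto)
    also have "(\<Sum>k<K. v k * - of_real (p k x * measure \<mu> {x})) = of_real (- (measure \<mu> {x} * (\<Sum>k<K. (p k x)\<^sup>2)))"
      by (simp add: v_def sum_distrib_left sum_negf power2_eq_square mult_ac)
    also have "cmod \<dots> = measure \<mu> {x} * (\<Sum>k<K. (p k x)\<^sup>2)"
      unfolding norm_of_real by (simp add: sum_nonneg)
    also have "(\<Sum>k<K. (p k x)\<^sup>2) \<le> S" unfolding S_def by (rule sum_le_suminf[OF s]) auto
    finally show ?thesis by (simp add: mult_left_mono)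
  qed
  have "1 \<le> measure \<mu> {x} * S + \<delta>" if "0 < \<delta>" for \<delta>
  proof -
    have "(\<lambda>K. \<Sum>k. (p (k + K) x)\<^sup>2) \<longlonglongrightarrow> 0" by (rule suminf_exist_split2[OF s])
    hence "(\<lambda>K. measure \<mu> {x} * S + (\<Sum>k. (p (k + K) x)\<^sup>2) / \<delta> + \<delta>) \<longlonglongrightarrow> measure \<mu> {x} * S + 0 / \<delta> + \<delta>"
      using that by (intro tendsto_intros) auto
    hence "1 \<le> measure \<mu> {x} * S + 0 / \<delta> + \<delta>"
      by (rule LIMSEQ_le_const) (use K_bound[OF that] in auto)
    thus ?thesis by simp
  qed
  thus ?thesis unfolding S_def by (rule field_le_epsilon)
qed

lemma measure_atom_der:
  assumes der: "der lam \<noteq> {}"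
  shows "measure \<mu> {x} =
    (if complex_of_real x \<in> point_spectrum (jacobi_operator lam w) then 1 / (\<Sum>k. (p k x)\<^sup>2) else 0)"
proof (cases "summable (\<lambda>k. (p k x)\<^sup>2)")
  case True
  have S: "1 \<le> (\<Sum>k. (p k x)\<^sup>2)"
    using sum_le_suminf[OF True, of "{0}"] by (simp add: p_simps)
  have "(\<lambda>n. measure \<mu> {x} * (\<Sum>k<n. (p k x)\<^sup>2)) \<longlonglongrightarrow> measure \<mu> {x} * (\<Sum>k. (p k x)\<^sup>2)"
    by (intro tendsto_intros summable_LIMSEQ True)
  hence "measure \<mu> {x} * (\<Sum>k. (p k x)\<^sup>2) \<le> 1"
    by (rule LIMSEQ_le_const2) (use measure_atom_sum_le_1 in auto)
  with one_le_measure_atom[OF der True] have "measure \<mu> {x} * (\<Sum>k. (p k x)\<^sup>2) = 1" by simp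
  thus ?thesis using S True point_spectrum_iff[OF der] by (simp add: field_simps)
next
  case False
  have "measure \<mu> {x} = 0"
  proof (rule ccontr)
    assume "measure \<mu> {x} \<noteq> 0"
    hence pos: "0 < measure \<mu> {x}" using measure_nonneg[of \<mu> "{x}"] by linarith
    hence "(\<Sum>k<n. (p k x)\<^sup>2) \<le> 1 / measure \<mu> {x}" for n
      using measure_atom_sum_le_1[of x n] by (simp add: field_simps)
    hence "summable (\<lambda>k. (p k x)\<^sup>2)" by (intro summableI_nonneg_bounded) auto
    with False show False ..
  qed
  thus ?thesis using False point_spectrum_iff[OF der] by simp
qed

end
end

section \<open>Splitting the spectral measure along the cluster points\<close>

theorem proposition1:
  fixes lam w :: "nat \<Rightarrow> real" and P :: "nat \<Rightarrow> real poly"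
  assumes w_pos: "\<forall>n. w n > 0"
    and isolated: "discrete (der lam)"
    and convergence: "\<exists>z0::complex. (\<forall>n. complex_of_real (lam n) \<noteq> z0) \<and>
          summable (\<lambda>n. (w n)\<^sup>2 /
            cmod ((complex_of_real (lam n) - z0) * (complex_of_real (lam (n + 1)) - z0)))"
    and P_0: "\<forall>x. poly (P 0) x = 1"
    and P_1: "\<forall>x. poly (P 1) x = (x - lam 0) / w 0"
    and P_rec: "\<forall>n\<ge>1. \<forall>x. x * poly (P n) x =
          w (n - 1) * poly (P (n - 1)) x + lam n * poly (P n) x + w n * poly (P (n + 1)) x"
  shows "\<exists>\<nu> :: real measure.
     finite_borel_measure \<nu> \<and>
     purely_discrete \<nu> \<and>
     atoms \<nu> = {x. complex_of_real x \<in> frakZ lam w} \<and>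
     (let D = {x. complex_of_real x \<in> point_spectrum (jacobi_operator lam w)} \<inter> der lam
      in \<forall>m n.
        integrable \<nu> (\<lambda>x. poly (P m) x * poly (P n) x) \<and>
        (\<lambda>x. poly (P m) x * poly (P n) x / (l2_norm (\<lambda>k. poly (P k) x))\<^sup>2) summable_on D \<and>
        (\<integral>x. poly (P m) x * poly (P n) x \<partial>\<nu>) +
          (\<Sum>\<^sub>\<infinity>x\<in>D. poly (P m) x * poly (P n) x / (l2_norm (\<lambda>k. poly (P k) x))\<^sup>2) =
          (if m = n then 1 else 0)) \<and>
     (\<forall>x. complex_of_real x \<in> frakZ lam w \<longrightarrow> x \<notin> range lam \<longrightarrow>
        char_fun lam w field_differentiable at (complex_of_real x) \<and>
        deriv (char_fun lam w) (complex_of_real x) \<noteq> 0 \<and>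
        complex_of_real (cdf \<nu> x - Lim (at_left x) (cdf \<nu>)) =
          1 / complex_of_real (x - lam 0) *
          frakF (\<lambda>k. of_real ((gam w (k + 1))\<^sup>2) / of_real (lam (k + 1) - x)) *
          inverse (deriv (char_fun lam w) (complex_of_real x)))"
proof -
  obtain z0 where z0: "\<And>n. complex_of_real (lam n) \<noteq> z0"
    "summable (\<lambda>n. (w n)\<^sup>2 / cmod ((complex_of_real (lam n) - z0) * (complex_of_real (lam (n + 1)) - z0)))"
    using convergence by blast
  interpret jacobi lam w z0
    using w_pos z0 by unfold_locales auto
  have Pp: "poly (P n) x = p n x" for n x
  proof (induction n rule: Pc.induct)
    case (3 n)
    have "w (Suc n) * poly (P (Suc (Suc n))) x = (x - lam (Suc n)) * poly (P (Suc n)) x - w n * poly (P n) x"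
      using P_rec[rule_format, of "Suc n" x] by (simp add: algebra_simps)
    thus ?case unfolding p_simps 3[symmetric] by (simp add: field_simps)
  qed (use P_0 P_1 in \<open>simp_all add: p_simps\<close>)
  obtain \<mu> where \<mu>: "real_distribution \<mu>" "\<And>i j. integrable \<mu> (\<lambda>x. p i x * p j x)"
    "\<And>i j. (\<integral>x. p i x * p j x \<partial>\<mu>) = (if i = j then 1 else 0)"
    "\<And>z. Im z \<noteq> 0 \<Longrightarrow> (of_real (lam 0) - z) * (\<integral>t. 1 / (complex_of_real t - z) \<partial>\<mu>) * F z 0 = F z 1"
    "\<And>z. Im z \<noteq> 0 \<Longrightarrow> F z 0 \<noteq> 0"
    by (rule spectral_measure_exists) (rule that)
  interpret \<mu>: real_distribution \<mu> by (rule \<mu>)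
  have ctbl: "countable (der lam)" by (rule countable_discrete[OF isolated])
  hence derb: "der lam \<in> sets borel" by (rule sets.countable[rotated]) simp
  hence [measurable]: "der lam \<in> sets \<mu>" by simp
  \<comment> \<open>A density rather than a restricted space, so that \<nu> remains a Borel measure
    on the whole line.\<close>
  define \<nu> where "\<nu> = density \<mu> (indicator (- der lam))"
  have em: "emeasure \<nu> A = emeasure \<mu> (A - der lam)" if "A \<in> sets borel" for A
  proof -
    have "emeasure \<nu> A = (\<integral>\<^sup>+x. indicator (- der lam) x * indicator A x \<partial>\<mu>)"
      unfolding \<nu>_def using that derb by (intro emeasure_density) auto
    also have "(\<lambda>x. indicator (- der lam) x * indicator A x :: ennreal) = indicator (A - der lam)"
      by (auto simp: indicator_def fun_eq_iff)
    finally show ?thesis using that derb by simp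
  qed
  have \<nu>_fin: "finite_borel_measure \<nu>"
  proof (intro finite_borel_measure.intro finite_borel_measure_axioms.intro finite_measureI)
    have "space \<nu> = UNIV" by (simp add: \<nu>_def)
    thus "emeasure \<nu> (space \<nu>) \<noteq> \<infinity>" by (simp add: em \<mu>.emeasure_eq_measure)
  qed (simp add: \<nu>_def)
  interpret \<nu>: finite_borel_measure \<nu> by (rule \<nu>_fin)
  have meas: "measure \<nu> {x} = (if x \<in> der lam then 0 else measure \<mu> {x})" for x
    using em[of "{x}"] by (auto simp: measure_def insert_Diff_if)
  have atom: "0 < measure \<nu> {x} \<longleftrightarrow> complex_of_real x \<in> frakZ lam w" for x
  proof (cases "x \<in> der lam")
    case True
    thus ?thesis by (simp add: meas frakZ_def)
  next
    case False
    thus ?thesis using atom_iff_frakZ[OF \<mu>(1,4,5) False] by (simp add: meas)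
  qed
  have atoms: "atoms \<nu> = {x. complex_of_real x \<in> frakZ lam w}"
    by (simp add: atoms_def atom)
  have discrete: "purely_discrete \<nu>"
    unfolding purely_discrete_def
  proof (intro exI conjI)
    show "countable (atoms \<nu>)" unfolding atoms_def by (rule \<nu>.countable_atoms)
    show "AE x in \<nu>. x \<in> atoms \<nu>"
      unfolding \<nu>_def atoms[unfolded \<nu>_def]
      using AE_der_or_frakZ[OF \<mu>(1,4,5)] derb
      by (subst AE_density) (auto simp: indicator_def elim!: eventually_mono)
  qed
  define D where "D = {x. complex_of_real x \<in> point_spectrum (jacobi_operator lam w)} \<inter> der lam"
  have orth: "integrable \<nu> (\<lambda>x. p m x * p n x) \<and>
      (\<lambda>x. p m x * p n x / (l2_norm (\<lambda>k. p k x))\<^sup>2) summable_on D \<and>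
      (\<integral>x. p m x * p n x \<partial>\<nu>) + (\<Sum>\<^sub>\<infinity>x\<in>D. p m x * p n x / (l2_norm (\<lambda>k. p k x))\<^sup>2) = (if m = n then 1 else 0)" for m n
  proof -
    let ?f = "\<lambda>x. p m x * p n x"
    \<comment> \<open>The indicator in the density takes extended nonnegative values; the transfer
      rules for integrals ask for a real function under \<open>ennreal\<close>.\<close>
    have ind: "indicator (- der lam) = (\<lambda>x. ennreal (indicator (- der lam) x))"
      by (auto simp: indicator_def)
    have i1: "integrable \<mu> (\<lambda>x. indicator (- der lam) x * ?f x)" "integrable \<mu> (\<lambda>x. indicator (der lam) x * ?f x)"
      using \<mu>(2)[of m n] derb integrable_real_mult_indicator[of _ \<mu> ?f] by (auto simp: mult.commute)
    have int\<nu>: "integrable \<nu> ?f"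
      unfolding \<nu>_def ind using i1 derb by (subst integrable_density) auto
    have split: "(\<integral>x. ?f x \<partial>\<nu>) + (\<integral>x. indicator (der lam) x * ?f x \<partial>\<mu>) = (if m = n then 1 else 0)"
    proof -
      have "(\<integral>x. ?f x \<partial>\<nu>) = (\<integral>x. indicator (- der lam) x * ?f x \<partial>\<mu>)"
        unfolding \<nu>_def ind using derb by (subst integral_density) auto
      hence "(\<integral>x. ?f x \<partial>\<nu>) + (\<integral>x. indicator (der lam) x * ?f x \<partial>\<mu>)
          = (\<integral>x. indicator (- der lam) x * ?f x + indicator (der lam) x * ?f x \<partial>\<mu>)"
        using i1 by simp
      also have "\<dots> = (\<integral>x. ?f x \<partial>\<mu>)"
        by (intro Bochner_Integration.integral_cong) (auto simp: indicator_def)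
      finally show ?thesis by (simp add: \<mu>(3))
    qed
    have hs: "((\<lambda>x. measure \<mu> {x} * ?f x) has_sum (\<integral>x. indicator (der lam) x * ?f x \<partial>\<mu>)) (der lam)"
      by (rule \<mu>.has_sum_set_integral_countable[OF ctbl \<mu>(2)])
    have hsD: "((\<lambda>x. ?f x / (l2_norm (\<lambda>k. p k x))\<^sup>2) has_sum (\<integral>x. indicator (der lam) x * ?f x \<partial>\<mu>)) D"
    \<comment> \<open>Points of \<open>der lam\<close> outside \<open>D\<close> carry no mass. In
      both cases a point of \<open>der lam\<close> is at hand, so \<open>der lam\<close> is nonempty
      and \<open>jacobi_operator\<close> is the maximal operator.\<close>
    proof (subst has_sum_cong_neutral[where T = "der lam" and g = "\<lambda>x. measure \<mu> {x} * ?f x"])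
      fix x assume "x \<in> der lam - D"
      hence "der lam \<noteq> {}" "complex_of_real x \<notin> point_spectrum (jacobi_operator lam w)" by (auto simp: D_def)
      thus "measure \<mu> {x} * ?f x = 0" using measure_atom_der[OF \<mu>(1,2,3)] by simp
    next
      fix x assume "x \<in> D \<inter> der lam"
      hence ne: "der lam \<noteq> {}" and x: "complex_of_real x \<in> point_spectrum (jacobi_operator lam w)" by (auto simp: D_def)
      have "summable (\<lambda>k. (p k x)\<^sup>2)" using point_spectrum_iff[OF ne] x by simp
      hence "(l2_norm (\<lambda>k. p k x))\<^sup>2 = (\<Sum>k. (p k x)\<^sup>2)"
        by (simp add: l2_norm_def suminf_nonneg)
      thus "?f x / (l2_norm (\<lambda>k. p k x))\<^sup>2 = measure \<mu> {x} * ?f x"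
        using measure_atom_der[OF \<mu>(1,2,3) ne, of x] x by simp
    qed (use hs in \<open>auto simp: D_def\<close>)
    show ?thesis
      using int\<nu> split unfolding infsumI[OF hsD] by (intro conjI has_sum_imp_summable[OF hsD])
  qed
  have jump: "char_fun lam w field_differentiable at (complex_of_real x) \<and>
        deriv (char_fun lam w) (complex_of_real x) \<noteq> 0 \<and>
        complex_of_real (cdf \<nu> x - Lim (at_left x) (cdf \<nu>)) =
          1 / complex_of_real (x - lam 0) *
          frakF (\<lambda>k. of_real ((gam w (k + 1))\<^sup>2) / of_real (lam (k + 1) - x)) *
          inverse (deriv (char_fun lam w) (complex_of_real x))"
    if "complex_of_real x \<in> frakZ lam w" "x \<notin> range lam" for x
  proof -
    have "Lim (at_left x) (cdf \<nu>) = measure \<nu> {..<x}"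
      by (intro tendsto_Lim \<nu>.cdf_at_left) simp
    moreover have "cdf \<nu> x = measure \<nu> {..<x} + measure \<nu> {x}"
    proof -
      have "{..x} = {..<x} \<union> {x}" by auto
      thus ?thesis unfolding cdf_def2 by (subst \<nu>.finite_measure_Union[symmetric]) auto
    qed
    moreover have "measure \<nu> {x} = measure \<mu> {x}" using that(1) by (auto simp: meas frakZ_def)
    ultimately have "cdf \<nu> x - Lim (at_left x) (cdf \<nu>) = measure \<mu> {x}" by simp
    thus ?thesis using jump_formula[OF \<mu>(1,4,5) that] by simp
  qed
  show ?thesis
    unfolding Let_def Pp D_def[symmetric]
    by (intro exI[of _ \<nu>] conjI allI impI) (use \<nu>_fin discrete atoms orth jump in simp_all)
qed

end
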